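(* Let $N\in\mathbb{N}$, $\mathbf{y}\in\mathbb{R}^{2^N\times2^N}$, $\theta\in\,]0,1]$, $\lambda>0$, and let $$\mathcal{V}=\underset{f\in\mathcal{M}^+_{\mathrm{D}\otimes\mathrm{D},0}(\mathrm{K})}{\operatorname{argmin}}\big(\|\mathbf{y}-\boldsymbol{\nu}\{f\}\|_2^2+\lambda\|f\|_\theta\big),\qquad \mathcal{V}_N=\underset{f\in\mathcal{M}^+_{\mathrm{D}\otimes\mathrm{D},0}(\mathcal{X}_N)}{\operatorname{argmin}}\big(\|\mathbf{y}-\boldsymbol{\nu}\{f\}\|_2^2+\lambda\|f\|_\theta\big),$$ where $[\boldsymbol{\nu}\{f\}]_{\mathbf{n}}=\int_{E^N_{\mathbf{n}}}f(\mathbf{x})\,\mathrm{d}\mathbf{x}$ for all $\mathbf{n}\in\{1,\dots,2^N\}^2$. Then there is a unique solution $f^\star\in\mathcal{V}$ whose knots lie on the grid $\mathcal{X}_N$ (that is, with $f^\star\in\mathcal{M}^+_{\mathrm{D}\otimes\mathrm{D},0}(\mathcal{X}_N)$), i.e., $$\mathcal{V}_N=\{f^\star\}.$$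
   Context: $\mathrm{K}=[0,1]^2$ and $\mathrm{K}^c=\mathbb{R}^2\setminus\mathrm{K}$. Derivatives are in the sense of distributions: for $f\in\mathcal{D}'(\mathbb{R}^2)$, $[\mathrm{D}\otimes\mathrm{I}]\{f\}=\partial_{x_1}f$, $[\mathrm{I}\otimes\mathrm{D}]\{f\}=\partial_{x_2}f$, $[\mathrm{D}\otimes\mathrm{D}]\{f\}=\partial_{x_1}\partial_{x_2}f$. $\mathcal{M}(\mathrm{K})$ is the space of bounded (finite signed) Borel measures on $\mathbb{R}^2$ supported in $\mathrm{K}$, with total variation norm $\|\cdot\|_{\mathcal{M}}$. Define $$\mathcal{M}_{\mathrm{D}\otimes\mathrm{D},0}(\mathrm{K})=\{f\in\mathcal{D}'(\mathbb{R}^2):\ [\mathrm{D}\otimes\mathrm{D}]\{f\}\in\mathcal{M}(\mathrm{K})\ \text{and}\ \langle f,\phi\rangle=0\ \ \forall\phi\in\mathcal{C}_c^\infty(\mathrm{K}^c)\},$$ $$\|\nabla\{f\}\|_{\mathcal{M}^2}=\|[\mathrm{I}\otimes\mathrm{D}]\{f\}\|_{\mathcal{M}}+\|[\mathrm{D}\otimes\mathrm{I}]\{f\}\|_{\mathcal{M}},$$ $$\|f\|_\theta=\theta\,\|[\mathrm{D}\otimes\mathrm{D}]\{f\}\|_{\mathcal{M}}+(1-\theta)\,\|\nabla\{f\}\|_{\mathcal{M}^2}.$$ (Elements of $\mathcal{M}_{\mathrm{D}\otimes\mathrm{D},0}(\mathrm{K})$ are bounded measurable functions supported in $\mathrm{K}$,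 so their integrals over pixels make sense.) The convex cone of positive functions is $\mathcal{M}^+_{\mathrm{D}\otimes\mathrm{D},0}(\mathrm{K})=\{f\in\mathcal{M}_{\mathrm{D}\otimes\mathrm{D},0}(\mathrm{K}):\forall\phi\in\mathcal{C}_c^\infty(\mathbb{R}^2),\ \phi\ge0\Rightarrow\langle f,\phi\rangle\ge0\}$. The pixels at resolution $N$ are $E^N_{n_1,n_2}=\big[\tfrac{n_1-1}{2^N},\tfrac{n_1}{2^N}\big]\times\big[\tfrac{n_2-1}{2^N},\tfrac{n_2}{2^N}\big]$, $1\le n_1,n_2\le2^N$. The grid is $\mathcal{X}_N=2^{-N}\{0,\dots,2^N\}\times2^{-N}\{0,\dots,2^N\}$ (with $(2^N+1)^2$ knots), and $\mathcal{M}^+_{\mathrm{D}\otimes\mathrm{D},0}(\mathcal{X}_N)=\{f\in\mathcal{M}^+_{\mathrm{D}\otimes\mathrm{D},0}(\mathrm{K}):[\mathrm{D}\otimes\mathrm{D}]\{f\}\in\mathcal{M}(\mathcal{X}_N)\}$, where $\mathcal{M}(\mathcal{X}_N)$ is the set of measures supported on $\mathcal{X}_N$. $\|\cdot\|_2$ is the Euclidean (Frobenius) norm on $\mathbb{R}^{2^N\times2^N}$. *)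

theory Defs
  imports "HOL-Analysis.Analysis"
begin

section \<open>Test functions and distributions on the plane\<close>

type_synonym plane = "real \<times> real"

definition pderiv1 :: "(plane \<Rightarrow> real) \<Rightarrow> plane \<Rightarrow> real" where
  "pderiv1 \<phi> = (\<lambda>x. frechet_derivative \<phi> (at x) (1, 0))"

definition pderiv2 :: "(plane \<Rightarrow> real) \<Rightarrow> plane \<Rightarrow> real" where
  "pderiv2 \<phi> = (\<lambda>x. frechet_derivative \<phi> (at x) (0, 1))"

primrec C_diff :: "nat \<Rightarrow> (plane \<Rightarrow> real) \<Rightarrow> bool" where
  "C_diff 0 \<phi> \<longleftrightarrow> continuous_on UNIV \<phi>"
| "C_diff (Suc k) \<phi> \<longleftrightarrow>
     (\<forall>x. \<phi> differentiable (at x)) \<and> C_diff k (pderiv1 \<phi>) \<and> C_diff k (pderiv2 \<phi>)"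

definition supp :: "(plane \<Rightarrow> real) \<Rightarrow> plane set" where
  "supp \<phi> = closure {x. \<phi> x \<noteq> 0}"

definition test_functions :: "plane set \<Rightarrow> (plane \<Rightarrow> real) set" where
  "test_functions U = {\<phi>. (\<forall>k. C_diff k \<phi>) \<and> compact (supp \<phi>) \<and> supp \<phi> \<subseteq> U}"

type_synonym distr = "(plane \<Rightarrow> real) \<Rightarrow> real"

definition test_seminorm :: "nat \<Rightarrow> (plane \<Rightarrow> real) \<Rightarrow> real" where
  "test_seminorm p \<phi> =
     (\<Sum>(i, j)\<in>{(i, j). i + j \<le> p}. SUP x. \<bar>(pderiv1 ^^ i) ((pderiv2 ^^ j) \<phi>) x\<bar>)"

text \<open>Continuity for the usual inductive limit topology is expressed by seminorm estimates on
  every compact set. Distributions are made extensional (they take the value \<^term>\<open>undefined\<close>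
  off the test functions), so that equality in HOL is equality of distributions.\<close>

definition distributions :: "distr set" where
  "distributions = {T \<in> extensional (test_functions UNIV).
     (\<forall>\<phi>\<in>test_functions UNIV. \<forall>\<psi>\<in>test_functions UNIV. \<forall>a b.
        T (\<lambda>x. a * \<phi> x + b * \<psi> x) = a * T \<phi> + b * T \<psi>) \<and>
     (\<forall>C. compact C \<longrightarrow> (\<exists>c p. \<forall>\<phi>\<in>test_functions UNIV.
        supp \<phi> \<subseteq> C \<longrightarrow> \<bar>T \<phi>\<bar> \<le> c * test_seminorm p \<phi>))}"

definition distr_D1 :: "distr \<Rightarrow> distr" where
  "distr_D1 T = (\<lambda>\<phi>\<in>test_functions UNIV. - T (pderiv1 \<phi>))"

definition distr_D2 :: "distr \<Rightarrow> distr" where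
  "distr_D2 T = (\<lambda>\<phi>\<in>test_functions UNIV. - T (pderiv2 \<phi>))"

definition distr_DD :: "distr \<Rightarrow> distr" where
  "distr_DD T = distr_D1 (distr_D2 T)"


section \<open>Finite signed Borel measures\<close>

text \<open>Only the values of the set function on Borel sets matter.\<close>

definition finite_signed_measure :: "(plane set \<Rightarrow> real) \<Rightarrow> bool" where
  "finite_signed_measure m \<longleftrightarrow>
     (\<forall>A :: nat \<Rightarrow> plane set. range A \<subseteq> sets borel \<longrightarrow> disjoint_family A \<longrightarrow>
        (\<lambda>i. m (A i)) sums m (\<Union>i. A i))"

definition variation :: "(plane set \<Rightarrow> real) \<Rightarrow> plane set \<Rightarrow> ennreal" where
  "variation m A =
     (SUP P\<in>{P. finite P \<and> P \<subseteq> sets borel \<and> partition_on A P}. \<Sum>B\<in>P. ennreal \<bar>m B\<bar>)"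

text \<open>Jordan decomposition: the two parts are half of the variation plus or minus the measure.
  The variation of a finite signed measure is finite, so that \<^const>\<open>enn2real\<close> loses nothing.\<close>

definition pos_part :: "(plane set \<Rightarrow> real) \<Rightarrow> plane measure" where
  "pos_part m =
     measure_of UNIV (sets borel) (\<lambda>A. ennreal ((enn2real (variation m A) + m A) / 2))"

definition neg_part :: "(plane set \<Rightarrow> real) \<Rightarrow> plane measure" where
  "neg_part m =
     measure_of UNIV (sets borel) (\<lambda>A. ennreal ((enn2real (variation m A) - m A) / 2))"

definition measure_distr :: "(plane set \<Rightarrow> real) \<Rightarrow> distr" where
  "measure_distr m = (\<lambda>\<phi>\<in>test_functions UNIV.
     (\<integral>x. \<phi> x \<partial>pos_part m) - (\<integral>x. \<phi> x \<partial>neg_part m))"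

text \<open>\<open>S\<close> is meant to be closed.\<close>

definition measures_on :: "plane set \<Rightarrow> distr set" where
  "measures_on S = {measure_distr m | m. finite_signed_measure m \<and>
     (\<forall>A\<in>sets borel. A \<inter> S = {} \<longrightarrow> m A = 0)}"

text \<open>The signed measure representing a distribution is unique on Borel sets if there is one;
  otherwise the infimum is over the empty set and the norm is infinite.\<close>

definition norm_M :: "distr \<Rightarrow> ennreal" where
  "norm_M T =
     (INF m\<in>{m. finite_signed_measure m \<and> measure_distr m = T}. variation m UNIV)"


section \<open>The search space and the optimisation problems\<close>

definition K :: "plane set" where
  "K = {0..1} \<times> {0..1}"

definition M_DD0 :: "distr set" where
  "M_DD0 = {f \<in> distributions. distr_DD f \<in> measures_on K \<and>
     (\<forall>\<phi>\<in>test_functions (- K). f \<phi> = 0)}"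

definition M_DD0_pos :: "distr set" where
  "M_DD0_pos = {f \<in> M_DD0. \<forall>\<phi>\<in>test_functions UNIV. (\<forall>x. 0 \<le> \<phi> x) \<longrightarrow> 0 \<le> f \<phi>}"

definition grid :: "nat \<Rightarrow> plane set" where
  "grid N = {(real i / 2 ^ N, real j / 2 ^ N) | i j. i \<le> 2 ^ N \<and> j \<le> 2 ^ N}"

definition M_DD0_pos_grid :: "nat \<Rightarrow> distr set" where
  "M_DD0_pos_grid N = {f \<in> M_DD0_pos. distr_DD f \<in> measures_on (grid N)}"

definition norm_grad :: "distr \<Rightarrow> ennreal" where
  "norm_grad f = norm_M (distr_D2 f) + norm_M (distr_D1 f)"

definition norm_theta :: "real \<Rightarrow> distr \<Rightarrow> ennreal" where
  "norm_theta \<theta> f =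
     ennreal \<theta> * norm_M (distr_DD f) + ennreal (1 - \<theta>) * norm_grad f"

text \<open>A locally integrable function representing a given distribution is unique almost
  everywhere, so its integrals over pixels do not depend on the choice made. Every element of
  \<^const>\<open>M_DD0\<close> is represented by a bounded measurable function.\<close>

definition represents :: "(plane \<Rightarrow> real) \<Rightarrow> distr \<Rightarrow> bool" where
  "represents g f \<longleftrightarrow> g \<in> borel_measurable borel \<and>
     (\<forall>C. compact C \<longrightarrow> set_integrable lborel C g) \<and>
     (\<forall>\<phi>\<in>test_functions UNIV. f \<phi> = (\<integral>x. g x * \<phi> x \<partial>lborel))"

definition distr_fun :: "distr \<Rightarrow> plane \<Rightarrow> real" where
  "distr_fun f = (SOME g. represents g f)"

definition pixel :: "nat \<Rightarrow> nat \<times> nat \<Rightarrow> plane set" where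
  "pixel N = (\<lambda>(n1, n2). {(real n1 - 1) / 2 ^ N .. real n1 / 2 ^ N} \<times>
                           {(real n2 - 1) / 2 ^ N .. real n2 / 2 ^ N})"

definition pixel_indices :: "nat \<Rightarrow> (nat \<times> nat) set" where
  "pixel_indices N = {1..2 ^ N} \<times> {1..2 ^ N}"

definition nu :: "nat \<Rightarrow> distr \<Rightarrow> nat \<times> nat \<Rightarrow> real" where
  "nu N f n = (LINT x:pixel N n|lborel. distr_fun f x)"

text \<open>A matrix of size $2^N \times 2^N$ is a function on pairs of naturals of which only the
  entries with index in \<^term>\<open>pixel_indices N\<close> are used.\<close>

definition objective ::
  "nat \<Rightarrow> (nat \<times> nat \<Rightarrow> real) \<Rightarrow> real \<Rightarrow> real \<Rightarrow> distr \<Rightarrow> ennreal" where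
  "objective N y \<theta> \<Lambda> f =
     ennreal ((L2_set (\<lambda>n. y n - nu N f n) (pixel_indices N))\<^sup>2) +
     ennreal \<Lambda> * norm_theta \<theta> f"

definition argmin :: "('a \<Rightarrow> 'b::ord) \<Rightarrow> 'a set \<Rightarrow> 'a set" where
  "argmin J S = {f. is_arg_min J (\<lambda>g. g \<in> S) f}"

end

theory Submission
  imports Defs
begin

text \<open>
  Averaging over pixels turns any competitor into a step function at least as good, and on step
  functions the problem is a strictly convex one in finitely many variables.

  Let \<open>c\<close> be the matrix of the mean values of \<open>f\<close> over the pixels, extended by zero to indices
  outside the image. The data term of \<open>f\<close> only depends on \<open>c\<close>, so everything rests on comparing
  \<open>\<parallel>f\<parallel>\<^sub>\<theta>\<close> with the explicit seminorm \<open>step_norm\<close> of \<open>c\<close>, which sums the absolute values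
  of the jumps of \<open>c\<close> along edges and around knots.

  \<^item> Lower bound, for every \<open>f\<close> (\<open>norm_theta_ge\<close>). Total variation dominates testing against
    functions bounded by one. The test functions are products of smooth hats, centred at the grid
    points, and smooth bumps, supported inside the pixel intervals. The derivative of a hat is a
    difference of two neighbouring bumps, so testing \<open>D\<otimes>D f\<close>, \<open>D\<otimes>I f\<close> or
    \<open>I\<otimes>D f\<close> yields differences of the numbers \<open>f(bump \<otimes> bump)\<close>. As the bumps tend to
    indicators of open intervals, these numbers tend to the pixel integrals of \<open>f\<close>. The sum of all
    hats telescopes and is at most one; this is the partition of unity behind the contraction
    property of averaging.

  \<^item> Upper bound, for the step function with values \<open>c\<close> (\<open>norm_theta_step_le\<close>). Its derivatives
    are explicit combinations of point masses and of Lebesgue measures on edges, by the fundamental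
    theorem of calculus and summation by parts.

  \<^item> Every \<open>f\<close> in the search space is the distribution function of \<open>m = D\<otimes>D f\<close>, that is,
    \<open>f(x) = m({y. y \<le> x})\<close> (\<open>M_DD0_representation\<close>). Hence pixel integrals make sense, and \<open>f\<close> is
    a step function on the pixels if \<open>m\<close> lives on the grid (\<open>grid_imp_step_distr\<close>).

  So the objective of \<open>f\<close> is at least \<open>pixel_objective c\<close>, with equality for step functions. On the
  cone of nonnegative matrices \<open>pixel_objective\<close> attains its minimum, by compactness, and it does so
  only once, because the data term is strictly convex in \<open>c\<close>. The step function of the unique
  minimiser is the only minimiser on the grid, and it is at least as good as every competitor in the
  whole search space.
\<close>


section \<open>Finite signed measures and duality\<close>

lemma signed_measure_sums:
  assumes "finite_signed_measure m" "\<And>i. A i \<in> sets borel" "disjoint_family A"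
  shows "(\<lambda>i. m (A i)) sums m (\<Union>i. A i)"
  using assms unfolding finite_signed_measure_def by blast

lemma signed_measure_empty:
  assumes "finite_signed_measure m"
  shows "m {} = 0"
proof -
  have "(\<lambda>i::nat. m {}) sums m (\<Union>i::nat. {})"
    by (rule signed_measure_sums[OF assms]) (auto simp: disjoint_family_on_def)
  then show ?thesis
    using summable_const_iff sums_summable by blast
qed

lemma signed_measure_Un:
  assumes "finite_signed_measure m" "A \<in> sets borel" "B \<in> sets borel" "A \<inter> B = {}"
  shows "m (A \<union> B) = m A + m B"
proof -
  have "(\<lambda>i. m (binaryset A B i)) sums m (\<Union>i. binaryset A B i)"
    by (rule signed_measure_sums[OF assms(1)])
      (use assms in \<open>auto simp: disjoint_family_on_def binaryset_def\<close>)
  then show ?thesis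
    using binaryset_sums[of m A B, OF signed_measure_empty[OF assms(1)]] sums_unique2
    unfolding UN_binaryset_eq by blast
qed

lemma signed_measure_Diff:
  assumes "finite_signed_measure m" "A \<in> sets borel" "B \<in> sets borel" "B \<subseteq> A"
  shows "m (A - B) = m A - m B"
  using signed_measure_Un[OF assms(1), of B "A - B"] assms by (auto simp: Un_absorb1)

lemma signed_measure_Union:
  assumes "finite_signed_measure m" "finite P" "P \<subseteq> sets borel" "disjoint P"
  shows "m (\<Union>P) = (\<Sum>B\<in>P. m B)"
  using assms(2-)
proof (induction P)
  case empty
  show ?case using signed_measure_empty[OF assms(1)] by simp
next
  case (insert B P)
  have "\<Union>P \<in> sets borel"
    using insert by (intro sets.finite_Union) auto
  moreover have "B \<inter> \<Union>P = {}"
    using insert by (auto simp: pairwise_def disjnt_def)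
  moreover have "disjoint P"
    using insert by (auto simp: pairwise_insert)
  ultimately have "m (\<Union>P) = (\<Sum>B\<in>P. m B)" "m (B \<union> \<Union>P) = m B + m (\<Union>P)"
    using insert.prems insert.IH signed_measure_Un[OF assms(1), of B "\<Union>P"] by auto
  then show ?case using insert.hyps by simp
qed

text \<open>Suppose that the subsets of \<open>E\<close> have unbounded measure. A subset of very large measure and its
  complement in \<open>E\<close> then both have measure above one in absolute value, and one of the two again has
  subsets of unbounded measure. Iterating in that one leaves a disjoint sequence of sets whose
  measures do not tend to zero, which contradicts countable additivity.\<close>

lemma signed_measure_bounded:
  assumes m: "finite_signed_measure m"
  obtains C where "\<And>A. A \<in> sets borel \<Longrightarrow> \<bar>m A\<bar> \<le> C"
proof -
  define bad where "bad E \<longleftrightarrow> E \<in> sets borel \<and> (\<forall>C. \<exists>B\<in>sets borel. B \<subseteq> E \<and> C < \<bar>m B\<bar>)" for E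
  have step_fun: "\<exists>E'. bad E' \<and> E' \<subseteq> E \<and> 1 < \<bar>m (E - E')\<bar>" if "bad E" for E
  proof -
    obtain A where A: "A \<in> sets borel" "A \<subseteq> E" "1 + \<bar>m E\<bar> < \<bar>m A\<bar>"
      using \<open>bad E\<close> unfolding bad_def by blast
    have E: "E \<in> sets borel" using that by (simp add: bad_def)
    have "m (E - A) = m E - m A" by (rule signed_measure_Diff[OF m E A(1,2)])
    then have 1: "1 < \<bar>m (E - A)\<bar>" using A(3) by linarith
    have 2: "E - (E - A) = A" using A(2) by blast
    have good: "\<exists>C. \<forall>B\<in>sets borel. B \<subseteq> F \<longrightarrow> \<bar>m B\<bar> \<le> C" if "F \<in> sets borel" "\<not> bad F" for F
      using that by (simp add: bad_def not_less)
    have "bad A \<or> bad (E - A)"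
    proof (rule ccontr)
      assume *: "\<not> (bad A \<or> bad (E - A))"
      have "E - A \<in> sets borel" using A(1) E by simp
      with * obtain C1 C2 where C: "\<forall>B\<in>sets borel. B \<subseteq> A \<longrightarrow> \<bar>m B\<bar> \<le> C1"
          "\<forall>B\<in>sets borel. B \<subseteq> E - A \<longrightarrow> \<bar>m B\<bar> \<le> C2"
        using good[of A] good[of "E - A"] A(1) by blast
      obtain B where B: "B \<in> sets borel" "B \<subseteq> E" "C1 + C2 < \<bar>m B\<bar>"
        using \<open>bad E\<close> unfolding bad_def by blast
      have "m B = m (B \<inter> A) + m (B - A)"
        using signed_measure_Un[OF m, of "B \<inter> A" "B - A"] A B by (simp add: Int_Diff_Un Int_Diff_disjoint)
      moreover have "\<bar>m (B \<inter> A)\<bar> \<le> C1" using A B C(1)[THEN bspec, of "B \<inter> A"] by simp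
      moreover have "\<bar>m (B - A)\<bar> \<le> C2" using A B C(2)[THEN bspec, of "B - A"] by auto
      ultimately show False using B(3) by linarith
    qed
    then show ?thesis
    proof
      assume "bad A"
      then show ?thesis using A(2) 1 by blast
    next
      assume "bad (E - A)"
      moreover have "1 < \<bar>m (E - (E - A))\<bar>" unfolding 2 using A(3) by linarith
      ultimately show ?thesis by blast
    qed
  qed
  have "\<not> bad UNIV"
  proof
    assume "bad UNIV"
    have "\<exists>E. \<forall>n. bad (E n) \<and> (E (Suc n) \<subseteq> E n \<and> 1 < \<bar>m (E n - E (Suc n))\<bar>)"
    proof (rule dependent_nat_choice)
      show "\<exists>E. bad E" using \<open>bad UNIV\<close> ..
    qed (rule step_fun)
    then obtain E where E: "\<And>n. bad (E n)" "\<And>n. E (Suc n) \<subseteq> E n"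
      "\<And>n. 1 < \<bar>m (E n - E (Suc n))\<bar>" by blast
    have dec: "E j \<subseteq> E i" if "i \<le> j" for i j
      using lift_Suc_antimono_le[of E, OF E(2) that] .
    have disj: "(E i - E (Suc i)) \<inter> (E j - E (Suc j)) = {}" if "i < j" for i j
      using dec[of "Suc i" j] that by auto
    have "disjoint_family (\<lambda>n. E n - E (Suc n))"
      unfolding disjoint_family_on_def using disj by (metis Int_commute nat_neq_iff)
    then have "(\<lambda>n. m (E n - E (Suc n))) sums m (\<Union>n. E n - E (Suc n))"
      using E(1) by (intro signed_measure_sums[OF m]) (auto simp: bad_def)
    then have "(\<lambda>n. m (E n - E (Suc n))) \<longlonglongrightarrow> 0"
      using summable_LIMSEQ_zero sums_summable by blast
    then have "\<forall>\<^sub>F n in sequentially. \<bar>m (E n - E (Suc n))\<bar> < 1"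
      using order_tendstoD(2)[OF tendsto_rabs_zero, of _ _ 1] by simp
    then obtain n where "\<bar>m (E n - E (Suc n))\<bar> < 1"
      unfolding eventually_sequentially by blast
    then show False using E(3)[of n] by simp
  qed
  then obtain C where "\<And>B. B \<in> sets borel \<Longrightarrow> \<bar>m B\<bar> \<le> C"
    unfolding bad_def not_less by (metis sets.top space_borel top_greatest not_less)
  then show ?thesis using that by blast
qed

text \<open>The supremum form of the positive part in the Jordan decomposition. Unlike half of the variation
  plus the measure, it makes additivity and monotonicity easy to see.\<close>

definition pos_variation :: "(plane set \<Rightarrow> real) \<Rightarrow> plane set \<Rightarrow> real" where
  "pos_variation m A = (SUP B\<in>{B \<in> sets borel. B \<subseteq> A}. m B)"

lemma pos_variation_upper:
  assumes "finite_signed_measure m" "B \<in> sets borel" "B \<subseteq> A"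
  shows "m B \<le> pos_variation m A"
proof -
  obtain C where C: "\<And>A. A \<in> sets borel \<Longrightarrow> \<bar>m A\<bar> \<le> C" using signed_measure_bounded[OF assms(1)] by blast
  have "bdd_above (m ` {B \<in> sets borel. B \<subseteq> A})"
    by (rule bdd_aboveI2[of _ _ C]) (use C in \<open>fastforce simp: abs_le_iff\<close>)
  moreover have "B \<in> {B \<in> sets borel. B \<subseteq> A}" using assms(2,3) by simp
  ultimately show ?thesis unfolding pos_variation_def
    using cSUP_upper[of B "{B \<in> sets borel. B \<subseteq> A}" m] by simp
qed

lemma pos_variation_least:
  assumes "\<And>B. B \<in> sets borel \<Longrightarrow> B \<subseteq> A \<Longrightarrow> m B \<le> c"
  shows "pos_variation m A \<le> c"
  unfolding pos_variation_def by (rule cSUP_least) (use assms in auto)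

lemma pos_variation_nonneg: "finite_signed_measure m \<Longrightarrow> 0 \<le> pos_variation m A"
  using pos_variation_upper[of m "{}" A] signed_measure_empty[of m] sets.empty_sets by simp

lemma pos_variation_mono: "finite_signed_measure m \<Longrightarrow> A \<subseteq> A' \<Longrightarrow> pos_variation m A \<le> pos_variation m A'"
  using pos_variation_upper[of m _ A'] by (intro pos_variation_least) blast

lemma pos_variation_Un:
  assumes m: "finite_signed_measure m" and A: "A \<in> sets borel" "A' \<in> sets borel" "A \<inter> A' = {}"
  shows "pos_variation m (A \<union> A') = pos_variation m A + pos_variation m A'"
proof (rule antisym)
  show "pos_variation m (A \<union> A') \<le> pos_variation m A + pos_variation m A'"
  proof (rule pos_variation_least)
    fix B assume B: "B \<in> sets borel" "B \<subseteq> A \<union> A'"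
    then have "B = (B \<inter> A) \<union> (B \<inter> A')" by blast
    moreover have "m ((B \<inter> A) \<union> (B \<inter> A')) = m (B \<inter> A) + m (B \<inter> A')"
      using A B by (intro signed_measure_Un[OF m]) auto
    moreover have "m (B \<inter> A) \<le> pos_variation m A" "m (B \<inter> A') \<le> pos_variation m A'"
      using A B by (auto intro!: pos_variation_upper[OF m])
    ultimately show "m B \<le> pos_variation m A + pos_variation m A'" by simp
  qed
  have "pos_variation m A \<le> pos_variation m (A \<union> A') - pos_variation m A'"
  proof (rule pos_variation_least)
    fix B assume B: "B \<in> sets borel" "B \<subseteq> A"
    have "pos_variation m A' \<le> pos_variation m (A \<union> A') - m B"
    proof (rule pos_variation_least)
      fix B' assume B': "B' \<in> sets borel" "B' \<subseteq> A'"
      have "m (B \<union> B') = m B + m B'"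
        using A B B' by (intro signed_measure_Un[OF m]) auto
      moreover have "m (B \<union> B') \<le> pos_variation m (A \<union> A')"
        using B B' by (intro pos_variation_upper[OF m]) auto
      ultimately show "m B' \<le> pos_variation m (A \<union> A') - m B" by simp
    qed
    then show "m B \<le> pos_variation m (A \<union> A') - pos_variation m A'" by simp
  qed
  then show "pos_variation m A + pos_variation m A' \<le> pos_variation m (A \<union> A')" by simp
qed

lemma pos_variation_sums:
  assumes m: "finite_signed_measure m" and A: "\<And>i. A i \<in> sets borel" "disjoint_family A"
  shows "(\<lambda>i. pos_variation m (A i)) sums pos_variation m (\<Union>i. A i)"
proof -
  have fin: "(\<Sum>i<n. pos_variation m (A i)) = pos_variation m (\<Union>i<n. A i)" for n :: nat
  proof (induction n)
    case 0
    have "pos_variation m {} \<le> 0" by (rule pos_variation_least) (use signed_measure_empty[OF m] in auto)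
    then show ?case using pos_variation_nonneg[OF m, of "{}"] by simp
  next
    case (Suc n)
    have "(\<Union>i<n. A i) \<inter> A n = {}"
      using A(2) by (auto simp: disjoint_family_on_def) (metis UNIV_I disjoint_iff less_irrefl_nat)
    then have "pos_variation m ((\<Union>i<n. A i) \<union> A n) = pos_variation m (\<Union>i<n. A i) + pos_variation m (A n)"
      using A(1) by (intro pos_variation_Un[OF m]) auto
    moreover have "(\<Union>i<Suc n. A i) = (\<Union>i<n. A i) \<union> A n" by (auto simp: lessThan_Suc)
    ultimately show ?case using Suc by simp
  qed
  have le: "(\<Sum>i<n. pos_variation m (A i)) \<le> pos_variation m (\<Union>i. A i)" for n
    unfolding fin by (rule pos_variation_mono[OF m]) auto
  have sm: "summable (\<lambda>i. pos_variation m (A i))"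
    by (rule summableI_nonneg_bounded[OF _ le]) (rule pos_variation_nonneg[OF m])
  have "(\<Sum>i. pos_variation m (A i)) \<le> pos_variation m (\<Union>i. A i)"
    by (rule suminf_le_const[OF sm le])
  moreover have "pos_variation m (\<Union>i. A i) \<le> (\<Sum>i. pos_variation m (A i))"
  proof (rule pos_variation_least)
    fix B assume B: "B \<in> sets borel" "B \<subseteq> (\<Union>i. A i)"
    have "(\<lambda>i. m (B \<inter> A i)) sums m (\<Union>i. B \<inter> A i)"
    proof (rule signed_measure_sums[OF m])
      show "disjoint_family (\<lambda>i. B \<inter> A i)" using A(2) unfolding disjoint_family_on_def by blast
    qed (use A B in simp)
    moreover have "(\<Union>i. B \<inter> A i) = B" using B by blast
    ultimately have "(\<lambda>i. m (B \<inter> A i)) sums m B" by simp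
    then show "m B \<le> (\<Sum>i. pos_variation m (A i))"
      using A B by (intro sums_le[OF _ _ summable_sums[OF sm]]) (auto intro!: pos_variation_upper[OF m])
  qed
  ultimately show ?thesis using sm by (simp add: sums_iff)
qed

text \<open>The cells of a partition on which \<open>m\<close> is nonnegative have a union \<open>B\<close>, and the partition
  contributes \<open>2 * m B - m A\<close>. Conversely every such value is a lower bound for the contribution of
  the partition into \<open>B\<close> and \<open>A - B\<close>.\<close>

lemma variation_eq:
  assumes m: "finite_signed_measure m" and A: "A \<in> sets borel"
  shows "variation m A = ennreal (2 * pos_variation m A - m A)"
proof (rule antisym)
  show le: "variation m A \<le> ennreal (2 * pos_variation m A - m A)"
    unfolding variation_def
  proof (rule SUP_least)
    fix P assume "P \<in> {P. finite P \<and> P \<subseteq> sets borel \<and> partition_on A P}"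
    then have P: "finite P" "P \<subseteq> sets borel" "\<Union>P = A" "disjoint P"
      by (auto simp: partition_on_def)
    define Q where "Q = {B\<in>P. 0 \<le> m B}"
    have Q: "finite Q" "Q \<subseteq> sets borel" "disjoint Q"
      using P by (auto simp: Q_def pairwise_def)
    have "(\<Sum>B\<in>P. \<bar>m B\<bar>) = (\<Sum>B\<in>P. 2 * (if 0 \<le> m B then m B else 0) - m B)"
      by (rule sum.cong) auto
    also have "\<dots> = 2 * (\<Sum>B\<in>Q. m B) - (\<Sum>B\<in>P. m B)"
      unfolding sum_subtractf sum_distrib_left[symmetric] Q_def using P(1)
      by (simp add: sum.inter_filter)
    also have "\<dots> = 2 * m (\<Union>Q) - m A"
      using signed_measure_Union[OF m P(1,2,4)] signed_measure_Union[OF m Q] P(3) by simp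
    also have "\<dots> \<le> 2 * pos_variation m A - m A"
      using pos_variation_upper[OF m, of "\<Union>Q" A] Q P(3) by (auto simp: Q_def intro!: sets.finite_Union)
    finally show "(\<Sum>B\<in>P. ennreal \<bar>m B\<bar>) \<le> ennreal (2 * pos_variation m A - m A)"
      by (simp add: ennreal_leI)
  qed
  have fin: "variation m A < top" using le by (rule le_less_trans) simp
  have "pos_variation m A \<le> (enn2real (variation m A) + m A) / 2"
  proof (rule pos_variation_least)
    fix B assume B: "B \<in> sets borel" "B \<subseteq> A"
    let ?P = "{B, A - B} - {{}}"
    have "2 * m B - m A = m B - m (A - B)" using signed_measure_Diff[OF m A B] by simp
    also have "\<dots> \<le> \<bar>m B\<bar> + \<bar>m (A - B)\<bar>" by linarith
    also have "\<dots> = (\<Sum>B\<in>?P. \<bar>m B\<bar>)"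
    proof (cases "B = A - B")
      case True
      then have "B = {}" "A = {}" by auto
      then show ?thesis using signed_measure_empty[OF m] by simp
    next
      case False
      have "(\<Sum>B\<in>?P. \<bar>m B\<bar>) = (\<Sum>B\<in>{B, A - B}. \<bar>m B\<bar>)"
        by (rule sum.mono_neutral_left) (use signed_measure_empty[OF m] in auto)
      then show ?thesis using False by simp
    qed
    finally have "ennreal (2 * m B - m A) \<le> (\<Sum>B\<in>?P. ennreal \<bar>m B\<bar>)"
      by (simp add: ennreal_leI)
    also have "\<dots> \<le> variation m A"
      unfolding variation_def
      by (rule SUP_upper) (use A B in \<open>auto simp: partition_on_def pairwise_def disjnt_def\<close>)
    finally have "2 * m B - m A \<le> enn2real (variation m A)"
      using fin by (metis enn2real_ennreal enn2real_mono enn2real_nonneg less_imp_le linear ennreal_eq_0_iff order_trans)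
    then show "m B \<le> (enn2real (variation m A) + m A) / 2" by simp
  qed
  then have "2 * pos_variation m A - m A \<le> enn2real (variation m A)" by simp
  then show "ennreal (2 * pos_variation m A - m A) \<le> variation m A"
    using fin by (metis ennreal_enn2real ennreal_leI)
qed

lemma enn2real_variation:
  assumes m: "finite_signed_measure m" and A: "A \<in> sets borel"
  shows "enn2real (variation m A) = 2 * pos_variation m A - m A"
  using variation_eq[OF m A] pos_variation_upper[OF m A order_refl] pos_variation_nonneg[OF m, of A] by simp

text \<open>Countable additivity has to be checked here, since \<^const>\<open>measure_of\<close> yields the zero measure
  for a set function that is not a measure.\<close>

lemma measure_of_borel:
  assumes "\<And>A. A \<in> sets borel \<Longrightarrow> g A = ennreal (p A)" "\<And>A. A \<in> sets borel \<Longrightarrow> 0 \<le> p A"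
    "\<And>A. (\<And>i. A i \<in> sets borel) \<Longrightarrow> disjoint_family A \<Longrightarrow> (\<lambda>i::nat. p (A i)) sums p (\<Union>i. A i)"
    "p {} = 0"
  shows "sets (measure_of UNIV (sets borel) g) = sets (borel :: plane measure)"
    "A \<in> sets borel \<Longrightarrow> emeasure (measure_of UNIV (sets borel) g) A = ennreal (p (A :: plane set))"
proof -
  have sub: "sets borel \<subseteq> Pow (UNIV :: plane set)" by simp
  have sig: "sigma_sets UNIV (sets borel) = sets (borel :: plane measure)"
    using sets.sigma_sets_eq[of "borel :: plane measure"] by simp
  show "sets (measure_of UNIV (sets borel) g) = sets (borel :: plane measure)"
    using sig by simp
  have ca: "countably_additive (sets borel) g"
  proof (rule countably_additiveI)
    fix A :: "nat \<Rightarrow> plane set"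
    assume A: "range A \<subseteq> sets borel" "disjoint_family A" "\<Union> (range A) \<in> sets borel"
    have s: "(\<lambda>i. p (A i)) sums p (\<Union>i. A i)" using A by (intro assms(3)) auto
    have "(\<Sum>i. g (A i)) = (\<Sum>i. ennreal (p (A i)))" using A by (intro suminf_cong assms(1)) auto
    also have "\<dots> = ennreal (p (\<Union>i. A i))"
      using s A by (intro suminf_ennreal_eq assms(2)) auto
    finally show "(\<Sum>i. g (A i)) = g (\<Union>i. A i)" using A assms(1) by simp
  qed
  assume A: "A \<in> sets borel"
  have "emeasure (measure_of UNIV (sets borel) g) A = g A"
    by (rule emeasure_measure_of_sigma)
      (use ca A sets.sigma_algebra_axioms[of "borel :: plane measure"] assms in
        \<open>auto simp: positive_def sig\<close>)
  then show "emeasure (measure_of UNIV (sets borel) g) A = ennreal (p A)" using assms A by simp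
qed

lemma pos_variation_empty: "finite_signed_measure m \<Longrightarrow> pos_variation m {} = 0"
  using pos_variation_least[of "{}" m 0] pos_variation_nonneg[of m "{}"] signed_measure_empty[of m] by auto

lemma pos_part_eq:
  assumes m: "finite_signed_measure m"
  shows sets_pos_part: "sets (pos_part m) = sets borel"
    and emeasure_pos_part: "A \<in> sets borel \<Longrightarrow> emeasure (pos_part m) A = ennreal (pos_variation m A)"
  unfolding pos_part_def
  by (rule measure_of_borel[where p = "pos_variation m"];
      use m in \<open>auto simp: enn2real_variation pos_variation_nonneg pos_variation_sums pos_variation_empty\<close>)+

lemma neg_part_eq:
  assumes m: "finite_signed_measure m"
  shows sets_neg_part: "sets (neg_part m) = sets borel"
    and emeasure_neg_part: "A \<in> sets borel \<Longrightarrow> emeasure (neg_part m) A = ennreal (pos_variation m A - m A)"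
  unfolding neg_part_def
  by (rule measure_of_borel[where p = "\<lambda>A. pos_variation m A - m A"];
      use m in \<open>auto simp: enn2real_variation pos_variation_upper pos_variation_empty signed_measure_empty
      intro: sums_diff[OF pos_variation_sums signed_measure_sums]\<close>)+

lemma finite_measure_parts:
  assumes m: "finite_signed_measure m"
  shows "finite_measure (pos_part m)" "finite_measure (neg_part m)"
  by (auto intro!: finite_measureI simp: sets_eq_imp_space_eq[OF sets_pos_part[OF m]]
      sets_eq_imp_space_eq[OF sets_neg_part[OF m]] emeasure_pos_part[OF m] emeasure_neg_part[OF m])

lemma measure_parts:
  assumes m: "finite_signed_measure m" "A \<in> sets borel"
  shows "measure (pos_part m) A = pos_variation m A" "measure (neg_part m) A = pos_variation m A - m A"
  using emeasure_pos_part[OF m] emeasure_neg_part[OF m] pos_variation_nonneg[OF m(1), of A]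
    pos_variation_upper[OF m(1,2), of A] by (auto simp: measure_def)

lemma variation_UNIV:
  assumes m: "finite_signed_measure m"
  shows "variation m UNIV = ennreal (measure (pos_part m) UNIV + measure (neg_part m) UNIV)"
  using variation_eq[OF m, of UNIV] measure_parts[OF m, of UNIV] by simp

lemma bounded_integrable_finite_measure:
  assumes "finite_measure M" "sets M = sets borel" "\<phi> \<in> borel_measurable borel" "\<And>x. \<bar>\<phi> x\<bar> \<le> (C::real)"
  shows "integrable M \<phi>"
proof -
  interpret finite_measure M by fact
  show ?thesis
    by (rule integrable_const_bound[of _ C]) (use assms measurable_cong_sets[OF assms(2) refl, of borel] in auto)
qed

text \<open>A linear relation between finite measures passes from sets to bounded functions, because sums,
  multiples and increasing bounded limits preserve it.\<close>

lemma combination_integral_zero: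
  fixes M :: "'i \<Rightarrow> plane measure" and a :: "'i \<Rightarrow> real"
  assumes I: "finite I" and M: "\<And>i. i \<in> I \<Longrightarrow> finite_measure (M i)" "\<And>i. i \<in> I \<Longrightarrow> sets (M i) = sets borel"
    and zero: "\<And>A. A \<in> sets borel \<Longrightarrow> (\<Sum>i\<in>I. a i * measure (M i) A) = 0"
    and \<phi>: "\<phi> \<in> borel_measurable borel" "\<And>x. \<bar>\<phi> x\<bar> \<le> C"
  shows "(\<Sum>i\<in>I. a i * (\<integral>x. \<phi> x \<partial>M i)) = 0"
proof -
  have int: "integrable (M i) u" if "i \<in> I" "u \<in> borel_measurable borel" "\<And>x. \<bar>u x\<bar> \<le> D"
    for i u and D :: real
    using bounded_integrable_finite_measure[OF M(1)[OF that(1)] M(2)[OF that(1)] that(2,3)] .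
  have meas: "u \<in> borel_measurable (M i)" if "i \<in> I" "u \<in> borel_measurable borel" for i and u :: "plane \<Rightarrow> real"
    using that(2) measurable_cong_sets[OF M(2)[OF that(1)] refl[of "sets borel"]] by blast
  have nn: "(\<forall>x. u x \<le> D) \<longrightarrow> (\<Sum>i\<in>I. a i * (\<integral>x. u x \<partial>M i)) = 0"
    if "u \<in> borel_measurable borel" "\<And>x. 0 \<le> u x" for u :: "plane \<Rightarrow> real" and D
    using that
  proof (induction u arbitrary: D rule: borel_measurable_induct_real)
    case (set A)
    have "(\<Sum>i\<in>I. a i * (\<integral>x. indicator A x \<partial>M i)) = (\<Sum>i\<in>I. a i * measure (M i) A)"
      using set by (intro sum.cong refl) (auto simp: M(2) sets_eq_imp_space_eq[OF M(2)])
    then show ?case using zero[OF set] by simp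
  next
    case (mult u c)
    show ?case
    proof (cases "c = 0")
      case False
      then have "c > 0" using mult by simp
      show ?thesis
      proof
        assume *: "\<forall>x. c * u x \<le> D"
        have "\<forall>x. u x \<le> D / c" using * \<open>c > 0\<close> by (simp add: field_simps)
        then have "(\<Sum>i\<in>I. a i * (\<integral>x. u x \<partial>M i)) = 0" using mult.IH by blast
        then have "c * (\<Sum>i\<in>I. a i * (\<integral>x. u x \<partial>M i)) = 0" by simp
        then show "(\<Sum>i\<in>I. a i * (\<integral>x. c * u x \<partial>M i)) = 0"
          by (simp add: sum_distrib_left mult.left_commute)
      qed
    qed simp
  next
    case (add u v)
    show ?case
    proof
      assume *: "\<forall>x. v x + u x \<le> D"
      have u: "\<bar>u x\<bar> \<le> D" and v: "\<bar>v x\<bar> \<le> D" for x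
        using add.hyps(2,4)[of x] spec[OF *, of x] by linarith+
      have "(\<Sum>i\<in>I. a i * (\<integral>x. v x + u x \<partial>M i)) =
        (\<Sum>i\<in>I. a i * (\<integral>x. v x \<partial>M i) + a i * (\<integral>x. u x \<partial>M i))"
        using int[OF _ add.hyps(1) u] int[OF _ add.hyps(3) v] by (intro sum.cong refl) (simp add: algebra_simps)
      also have "\<dots> = 0"
        using add.IH(1)[of D] add.IH(2)[of D] u v by (simp add: sum.distrib abs_le_iff)
      finally show "(\<Sum>i\<in>I. a i * (\<integral>x. v x + u x \<partial>M i)) = 0" .
    qed
  next
    case (seq U)
    show ?case
    proof
      assume *: "\<forall>x. u x \<le> D"
      have le: "U n x \<le> u x" for n x
        by (rule incseq_le[OF _ seq.hyps(4)]) (use seq.hyps(3) in \<open>simp_all add: incseq_def le_fun_def del: split_paired_All\<close>)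
      have bnd: "\<bar>U n x\<bar> \<le> D" for n x using le[of n x] spec[OF *, of x] seq.hyps(2)[of n x] by linarith
      have u: "u \<in> borel_measurable borel"
        by (rule borel_measurable_LIMSEQ_real[OF seq.hyps(4) seq.hyps(1)])
      have "(\<lambda>n. \<integral>x. U n x \<partial>M i) \<longlonglongrightarrow> (\<integral>x. u x \<partial>M i)" if "i \<in> I" for i
      proof (rule integral_dominated_convergence[where w = "\<lambda>_. D"])
        show "integrable (M i) (\<lambda>_. D)" using int[OF that, of "\<lambda>_. D" "\<bar>D\<bar>"] by simp
        show "u \<in> borel_measurable (M i)" by (rule meas[OF that u])
        show "\<And>n. U n \<in> borel_measurable (M i)" by (rule meas[OF that seq.hyps(1)])
        show "AE x in M i. (\<lambda>n. U n x) \<longlonglongrightarrow> u x" by (rule AE_I2) (rule seq.hyps(4), simp)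
        show "\<And>n. AE x in M i. norm (U n x) \<le> D" unfolding real_norm_def by (rule AE_I2) (rule bnd)
      qed
      then have "(\<lambda>n. \<Sum>i\<in>I. a i * (\<integral>x. U n x \<partial>M i)) \<longlonglongrightarrow> (\<Sum>i\<in>I. a i * (\<integral>x. u x \<partial>M i))"
        by (intro tendsto_intros)
      moreover have "(\<Sum>i\<in>I. a i * (\<integral>x. U n x \<partial>M i)) = 0" for n
        using seq.IH[of n D] bnd by (simp add: abs_le_iff)
      ultimately have "(\<lambda>n. 0) \<longlonglongrightarrow> (\<Sum>i\<in>I. a i * (\<integral>x. u x \<partial>M i))" by simp
      then show "(\<Sum>i\<in>I. a i * (\<integral>x. u x \<partial>M i)) = 0" unfolding LIMSEQ_const_iff by simp
    qed
  qed
  define p q where "p = (\<lambda>x. max (\<phi> x) 0)" and "q = (\<lambda>x. max (- \<phi> x) 0)"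
  have "\<bar>p x\<bar> \<le> \<bar>\<phi> x\<bar>" "\<bar>q x\<bar> \<le> \<bar>\<phi> x\<bar>" for x by (simp_all add: p_def q_def max_def)
  then have pq_le: "\<bar>p x\<bar> \<le> C" "\<bar>q x\<bar> \<le> C" for x using \<phi>(2) order_trans by blast+
  have "p \<in> borel_measurable borel" "q \<in> borel_measurable borel"
    unfolding p_def q_def using \<phi>(1) by simp_all
  moreover have "0 \<le> p x" "0 \<le> q x" "\<phi> x = p x - q x" for x by (simp_all add: p_def q_def)
  ultimately have pq: "p \<in> borel_measurable borel" "q \<in> borel_measurable borel" "\<And>x. 0 \<le> p x" "\<And>x. 0 \<le> q x"
    "\<And>x. \<bar>p x\<bar> \<le> C" "\<And>x. \<bar>q x\<bar> \<le> C" "\<And>x. \<phi> x = p x - q x"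
    using pq_le by blast+
  have "(\<Sum>i\<in>I. a i * (\<integral>x. \<phi> x \<partial>M i)) =
      (\<Sum>i\<in>I. a i * (\<integral>x. p x \<partial>M i) - a i * (\<integral>x. q x \<partial>M i))"
    using int[OF _ pq(1,5)] int[OF _ pq(2,6)] by (intro sum.cong refl) (simp add: pq(7) algebra_simps)
  also have "\<dots> = 0"
    using nn[OF pq(1,3), of C] nn[OF pq(2,4), of C] pq(5,6) by (simp add: sum_subtractf abs_le_iff)
  finally show ?thesis .
qed

text \<open>Integrals against the Jordan parts can be read off from any representation of a signed measure as
  a linear combination of finite measures, and every such representation bounds the variation.\<close>

lemma combination_signed_measure:
  fixes M :: "'i \<Rightarrow> plane measure" and a :: "'i \<Rightarrow> real"
  assumes I: "finite I" and M: "\<And>i. i \<in> I \<Longrightarrow> finite_measure (M i)" "\<And>i. i \<in> I \<Longrightarrow> sets (M i) = sets borel"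
  defines "m \<equiv> \<lambda>A. \<Sum>i\<in>I. a i * measure (M i) A"
  shows "finite_signed_measure m"
    and "variation m UNIV \<le> ennreal (\<Sum>i\<in>I. \<bar>a i\<bar> * measure (M i) UNIV)"
    and "\<phi> \<in> borel_measurable borel \<Longrightarrow> (\<And>x. \<bar>\<phi> x\<bar> \<le> C) \<Longrightarrow>
      (\<integral>x. \<phi> x \<partial>pos_part m) - (\<integral>x. \<phi> x \<partial>neg_part m) = (\<Sum>i\<in>I. a i * (\<integral>x. \<phi> x \<partial>M i))"
proof -
  show m: "finite_signed_measure m"
    unfolding finite_signed_measure_def m_def
    using M by (auto intro!: sums_sum sums_mult finite_measure.finite_measure_UNION)
  show "variation m UNIV \<le> ennreal (\<Sum>i\<in>I. \<bar>a i\<bar> * measure (M i) UNIV)"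
    unfolding variation_def
  proof (rule SUP_least)
    fix P :: "plane set set" assume "P \<in> {P. finite P \<and> P \<subseteq> sets borel \<and> partition_on UNIV P}"
    then have P: "finite P" "P \<subseteq> sets borel" "\<Union>P = UNIV" "disjoint P"
      by (auto simp: partition_on_def)
    have "(\<Sum>B\<in>P. \<bar>m B\<bar>) \<le> (\<Sum>B\<in>P. \<Sum>i\<in>I. \<bar>a i\<bar> * measure (M i) B)"
      unfolding m_def by (intro sum_mono order_trans[OF sum_abs]) (simp add: abs_mult)
    also have "\<dots> = (\<Sum>i\<in>I. \<bar>a i\<bar> * (\<Sum>B\<in>P. measure (M i) B))"
      by (subst sum.swap) (simp add: sum_distrib_left)
    also have "\<dots> = (\<Sum>i\<in>I. \<bar>a i\<bar> * measure (M i) UNIV)"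
    proof (intro sum.cong refl arg_cong2[where f = "(*)"])
      fix i assume i: "i \<in> I"
      interpret finite_measure "M i" by (rule M(1)[OF i])
      have "measure (M i) (\<Union>B\<in>P. B) = (\<Sum>B\<in>P. measure (M i) B)"
        by (rule finite_measure_finite_Union)
          (use P M(2)[OF i] in \<open>auto simp: disjoint_family_on_def pairwise_def disjnt_def\<close>)
      then show "(\<Sum>B\<in>P. measure (M i) B) = measure (M i) UNIV" using P by simp
    qed
    finally show "(\<Sum>B\<in>P. ennreal \<bar>m B\<bar>) \<le> ennreal (\<Sum>i\<in>I. \<bar>a i\<bar> * measure (M i) UNIV)"
      by (simp add: ennreal_leI)
  qed
  assume \<phi>: "\<phi> \<in> borel_measurable borel" "\<And>x. \<bar>\<phi> x\<bar> \<le> C"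
  \<comment> \<open>The relation \<open>pos_part m - neg_part m = \<Sum>i. a i * M i\<close> has the two Jordan parts, indexed
    by booleans, and the given measures as terms.\<close>
  define M' where "M' = case_sum (\<lambda>b. if b then pos_part m else neg_part m) M"
  define a' where "a' = case_sum (\<lambda>b. if b then 1 else - 1) (\<lambda>i. - a i)"
  have "(\<Sum>i\<in>UNIV <+> I. a' i * (\<integral>x. \<phi> x \<partial>M' i)) = 0"
  proof (rule combination_integral_zero[where C = C])
    fix A :: "plane set" assume A: "A \<in> sets borel"
    show "(\<Sum>i\<in>UNIV <+> I. a' i * measure (M' i) A) = 0"
      using I measure_parts[OF m A] by (simp add: sum.Plus a'_def M'_def UNIV_bool sum_negf m_def)
  next
    show "\<And>i. i \<in> UNIV <+> I \<Longrightarrow> finite_measure (M' i)"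
      by (elim PlusE) (simp_all add: M'_def finite_measure_parts[OF m] M)
    show "\<And>i. i \<in> UNIV <+> I \<Longrightarrow> sets (M' i) = sets borel"
      by (elim PlusE) (simp_all add: M'_def sets_pos_part[OF m] sets_neg_part[OF m] M)
  qed (use I \<phi> in simp_all)
  then show "(\<integral>x. \<phi> x \<partial>pos_part m) - (\<integral>x. \<phi> x \<partial>neg_part m) = (\<Sum>i\<in>I. a i * (\<integral>x. \<phi> x \<partial>M i))"
    using I by (simp add: sum.Plus a'_def M'_def UNIV_bool sum_negf)
qed

text \<open>The duality that yields lower bounds for the norm: the absolute values on the left amount to
  testing once against a signed sum of the functions, which is bounded by one.\<close>

lemma sum_measure_distr_le_variation:
  fixes \<phi> :: "'i \<Rightarrow> plane \<Rightarrow> real"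
  assumes m: "finite_signed_measure m" and I: "finite I"
    and \<phi>: "\<And>i. i \<in> I \<Longrightarrow> \<phi> i \<in> test_functions UNIV" "\<And>i. i \<in> I \<Longrightarrow> \<phi> i \<in> borel_measurable borel"
    and le: "\<And>x. (\<Sum>i\<in>I. \<bar>\<phi> i x\<bar>) \<le> 1"
  shows "ennreal (\<Sum>i\<in>I. \<bar>measure_distr m (\<phi> i)\<bar>) \<le> variation m UNIV"
proof -
  have bnd: "\<bar>\<phi> i x\<bar> \<le> 1" if "i \<in> I" for i x
    using le[of x] member_le_sum[OF that, of "\<lambda>i. \<bar>\<phi> i x\<bar>"] I by fastforce
  have *: "(\<Sum>i\<in>I. \<integral>x. \<bar>\<phi> i x\<bar> \<partial>M) \<le> measure M UNIV"
    if M: "finite_measure M" "sets M = sets borel" for M :: "plane measure"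
  proof -
    have int: "integrable M (\<lambda>x. \<bar>\<phi> i x\<bar>)" if "i \<in> I" for i
      by (rule bounded_integrable_finite_measure[OF M, of _ 1]) (use that \<phi> bnd in auto)
    have "(\<Sum>i\<in>I. \<integral>x. \<bar>\<phi> i x\<bar> \<partial>M) = (\<integral>x. (\<Sum>i\<in>I. \<bar>\<phi> i x\<bar>) \<partial>M)"
      using int by simp
    also have "\<dots> \<le> (\<integral>x. 1 \<partial>M)"
      using int le finite_measure.integrable_const[OF M(1), of "1::real"] by (intro integral_mono) auto
    also have "\<dots> = measure M UNIV" using sets_eq_imp_space_eq[OF M(2)] by simp
    finally show ?thesis .
  qed
  have "(\<Sum>i\<in>I. \<bar>measure_distr m (\<phi> i)\<bar>) \<le>
      (\<Sum>i\<in>I. (\<integral>x. \<bar>\<phi> i x\<bar> \<partial>pos_part m) + (\<integral>x. \<bar>\<phi> i x\<bar> \<partial>neg_part m))"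
  proof (rule sum_mono)
    fix i assume "i \<in> I"
    then have "measure_distr m (\<phi> i) = (\<integral>x. \<phi> i x \<partial>pos_part m) - (\<integral>x. \<phi> i x \<partial>neg_part m)"
      using \<phi> by (simp add: measure_distr_def)
    then show "\<bar>measure_distr m (\<phi> i)\<bar> \<le> (\<integral>x. \<bar>\<phi> i x\<bar> \<partial>pos_part m) + (\<integral>x. \<bar>\<phi> i x\<bar> \<partial>neg_part m)"
      using integral_abs_bound[of "pos_part m" "\<phi> i"] integral_abs_bound[of "neg_part m" "\<phi> i"] by linarith
  qed
  also have "\<dots> \<le> measure (pos_part m) UNIV + measure (neg_part m) UNIV"
    unfolding sum.distrib
    by (intro add_mono *) (auto simp: finite_measure_parts[OF m] sets_pos_part[OF m] sets_neg_part[OF m])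
  finally show ?thesis unfolding variation_UNIV[OF m] by (rule ennreal_leI)
qed

lemma sum_le_norm_M:
  fixes \<phi> :: "'i \<Rightarrow> plane \<Rightarrow> real"
  assumes "finite I" "\<And>i. i \<in> I \<Longrightarrow> \<phi> i \<in> test_functions UNIV" "\<And>i. i \<in> I \<Longrightarrow> \<phi> i \<in> borel_measurable borel"
    and "\<And>x. (\<Sum>i\<in>I. \<bar>\<phi> i x\<bar>) \<le> 1"
  shows "ennreal (\<Sum>i\<in>I. \<bar>T (\<phi> i)\<bar>) \<le> norm_M T"
  unfolding norm_M_def
  by (rule INF_greatest) (use sum_measure_distr_le_variation[OF _ assms] in auto)

section \<open>Smooth functions of two variables\<close>

definition smooth :: "(plane \<Rightarrow> real) \<Rightarrow> bool" where
  "smooth \<phi> \<longleftrightarrow> (\<forall>k. C_diff k \<phi>)"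

lemma pderiv_eq:
  assumes "(\<phi> has_derivative D) (at x)"
  shows "pderiv1 \<phi> x = D (1, 0)" "pderiv2 \<phi> x = D (0, 1)"
  using frechet_derivative_at[OF assms] by (simp_all add: pderiv1_def pderiv2_def)

text \<open>This identifies both partial derivatives from one total derivative, which is how all partial
  derivatives below are computed.\<close>

lemma pderivs_eqI:
  assumes "\<And>x. (\<phi> has_derivative (\<lambda>h. d1 x * fst h + d2 x * snd h)) (at x)"
  shows "pderiv1 \<phi> = d1" "pderiv2 \<phi> = d2"
  using pderiv_eq[OF assms] by (auto simp: fun_eq_iff)

lemma has_derivative_pderivs:
  assumes "\<phi> differentiable (at x)"
  shows "(\<phi> has_derivative (\<lambda>h. pderiv1 \<phi> x * fst h + pderiv2 \<phi> x * snd h)) (at x)"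
proof -
  let ?D = "frechet_derivative \<phi> (at x)"
  have D: "(\<phi> has_derivative ?D) (at x)" using assms frechet_derivative_works by blast
  interpret linear ?D by (rule has_derivative_linear[OF D])
  have "?D h = pderiv1 \<phi> x * fst h + pderiv2 \<phi> x * snd h" for h
  proof -
    have "h = fst h *\<^sub>R (1, 0) + snd h *\<^sub>R (0, 1)" by (cases h) simp
    then have "?D h = ?D (fst h *\<^sub>R (1, 0) + snd h *\<^sub>R (0, 1))" by simp
    then show ?thesis unfolding add scale by (simp add: pderiv1_def pderiv2_def)
  qed
  then have "?D = (\<lambda>h. pderiv1 \<phi> x * fst h + pderiv2 \<phi> x * snd h)" by (rule ext)
  then show ?thesis using D by simp
qed

lemma C_diff_SucI:
  assumes "\<And>x. (\<phi> has_derivative (\<lambda>h. d1 x * fst h + d2 x * snd h)) (at x)"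
    "C_diff k d1" "C_diff k d2"
  shows "C_diff (Suc k) \<phi>"
  using assms pderivs_eqI[OF assms(1)] by (auto simp: differentiable_def)

lemma C_diff_SucD:
  assumes "C_diff (Suc k) \<phi>"
  shows "\<And>x. (\<phi> has_derivative (\<lambda>h. pderiv1 \<phi> x * fst h + pderiv2 \<phi> x * snd h)) (at x)"
    "C_diff k (pderiv1 \<phi>)" "C_diff k (pderiv2 \<phi>)"
  using assms by (auto intro: has_derivative_pderivs)

lemma C_diff_continuous: "C_diff k \<phi> \<Longrightarrow> continuous_on UNIV \<phi>"
  by (cases k) (auto simp: continuous_on_eq_continuous_at intro: differentiable_imp_continuous_within)

lemma C_diff_Suc_imp: "C_diff (Suc k) \<phi> \<Longrightarrow> C_diff k \<phi>"
proof (induction k arbitrary: \<phi>)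
  case 0
  then show ?case using C_diff_continuous[of "Suc 0" \<phi>] by simp
next
  case (Suc k)
  note D = C_diff_SucD[OF Suc.prems]
  show ?case by (rule C_diff_SucI[OF D(1) Suc.IH[OF D(2)] Suc.IH[OF D(3)]])
qed

lemma C_diff_linear:
  "C_diff k \<phi> \<Longrightarrow> C_diff k \<psi> \<Longrightarrow> C_diff k (\<lambda>x. a * \<phi> x + b * \<psi> x)"
proof (induction k arbitrary: \<phi> \<psi>)
  case 0
  then show ?case unfolding C_diff.simps by (intro continuous_intros)
next
  case (Suc k)
  note D = C_diff_SucD[OF Suc.prems(1)] C_diff_SucD[OF Suc.prems(2)]
  show ?case
  proof (rule C_diff_SucI)
    show "((\<lambda>x. a * \<phi> x + b * \<psi> x) has_derivative
        (\<lambda>h. (a * pderiv1 \<phi> x + b * pderiv1 \<psi> x) * fst h + (a * pderiv2 \<phi> x + b * pderiv2 \<psi> x) * snd h)) (at x)" for x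
      using has_derivative_add[OF has_derivative_mult_right[OF D(1)[of x], of a]
          has_derivative_mult_right[OF D(4)[of x], of b]]
      by (rule has_derivative_eq_rhs) (simp add: fun_eq_iff algebra_simps)
  qed (intro Suc.IH D)+
qed

lemma C_diff_mult: "C_diff k \<phi> \<Longrightarrow> C_diff k \<psi> \<Longrightarrow> C_diff k (\<lambda>x. \<phi> x * \<psi> x)"
proof (induction k arbitrary: \<phi> \<psi>)
  case 0
  then show ?case unfolding C_diff.simps by (intro continuous_intros)
next
  case (Suc k)
  note D = C_diff_SucD[OF Suc.prems(1)] C_diff_SucD[OF Suc.prems(2)]
  note C = C_diff_Suc_imp[OF Suc.prems(1)] C_diff_Suc_imp[OF Suc.prems(2)]
  have c: "C_diff k (\<lambda>x. 1 * (pderiv1 \<phi> x * \<psi> x) + 1 * (\<phi> x * pderiv1 \<psi> x))"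
    "C_diff k (\<lambda>x. 1 * (pderiv2 \<phi> x * \<psi> x) + 1 * (\<phi> x * pderiv2 \<psi> x))"
    using C_diff_linear[OF Suc.IH[OF D(2) C(2)] Suc.IH[OF C(1) D(5)], of 1 1]
      C_diff_linear[OF Suc.IH[OF D(3) C(2)] Suc.IH[OF C(1) D(6)], of 1 1] by blast+
  have d: "((\<lambda>x. \<phi> x * \<psi> x) has_derivative
        (\<lambda>h. (1 * (pderiv1 \<phi> x * \<psi> x) + 1 * (\<phi> x * pderiv1 \<psi> x)) * fst h +
          (1 * (pderiv2 \<phi> x * \<psi> x) + 1 * (\<phi> x * pderiv2 \<psi> x)) * snd h)) (at x)" for x
      using has_derivative_mult[OF D(1) D(4), of x]
      by (rule has_derivative_eq_rhs) (simp add: fun_eq_iff algebra_simps)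
  show ?case by (rule C_diff_SucI[OF d c])
qed

text \<open>Exchanging the two coordinates reduces statements about the second variable to the first.\<close>

lemma C_diff_swap: "C_diff k \<phi> \<Longrightarrow> C_diff k (\<lambda>x. \<phi> (prod.swap x))"
  and pderiv_swap: "C_diff (Suc k) \<phi> \<Longrightarrow> pderiv1 (\<lambda>x. \<phi> (prod.swap x)) = (\<lambda>x. pderiv2 \<phi> (prod.swap x))"
    "C_diff (Suc k) \<phi> \<Longrightarrow> pderiv2 (\<lambda>x. \<phi> (prod.swap x)) = (\<lambda>x. pderiv1 \<phi> (prod.swap x))"
proof -
  have D: "((\<lambda>x. \<phi> (prod.swap x)) has_derivative
        (\<lambda>h. pderiv2 \<phi> (prod.swap x) * fst h + pderiv1 \<phi> (prod.swap x) * snd h)) (at x)"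
    if "C_diff (Suc k) \<phi>" for \<phi> k x
  proof -
    have s: "(prod.swap has_derivative prod.swap) (at x)" for x :: plane
      unfolding prod.swap_def[abs_def]
      by (intro has_derivative_Pair has_derivative_fst has_derivative_snd has_derivative_ident)
    show ?thesis
      using has_derivative_compose[OF s C_diff_SucD(1)[OF that]] by (simp add: add.commute)
  qed
  show "C_diff k \<phi> \<Longrightarrow> C_diff k (\<lambda>x. \<phi> (prod.swap x))"
  proof (induction k arbitrary: \<phi>)
    case 0
    have "continuous_on UNIV (prod.swap :: plane \<Rightarrow> plane)"
      unfolding prod.swap_def[abs_def] by (intro continuous_intros)
    then show ?case using 0 continuous_on_compose2[of UNIV \<phi> UNIV prod.swap] by simp
  next
    case (Suc k)
    show ?case
      by (rule C_diff_SucI[OF D[OF Suc.prems] Suc.IH[OF C_diff_SucD(3)[OF Suc.prems]]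
            Suc.IH[OF C_diff_SucD(2)[OF Suc.prems]]])
  qed
  show "C_diff (Suc k) \<phi> \<Longrightarrow> pderiv1 (\<lambda>x. \<phi> (prod.swap x)) = (\<lambda>x. pderiv2 \<phi> (prod.swap x))"
    "C_diff (Suc k) \<phi> \<Longrightarrow> pderiv2 (\<lambda>x. \<phi> (prod.swap x)) = (\<lambda>x. pderiv1 \<phi> (prod.swap x))"
    using pderivs_eqI[OF D] by auto
qed

lemma smooth_pderivs: "smooth \<phi> \<Longrightarrow> smooth (pderiv1 \<phi>)" "smooth \<phi> \<Longrightarrow> smooth (pderiv2 \<phi>)"
  unfolding smooth_def using C_diff_SucD(2,3) by blast+

lemma smooth_has_derivative:
  "smooth \<phi> \<Longrightarrow> (\<phi> has_derivative (\<lambda>h. pderiv1 \<phi> x * fst h + pderiv2 \<phi> x * snd h)) (at x)"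
  unfolding smooth_def using C_diff_SucD(1) by blast

lemma smooth_continuous: "smooth \<phi> \<Longrightarrow> continuous_on UNIV \<phi>"
  unfolding smooth_def using C_diff_continuous by blast

lemma smooth_measurable: "smooth \<phi> \<Longrightarrow> \<phi> \<in> borel_measurable borel"
  using smooth_continuous borel_measurable_continuous_onI by blast

lemma smooth_linear: "smooth \<phi> \<Longrightarrow> smooth \<psi> \<Longrightarrow> smooth (\<lambda>x. a * \<phi> x + b * \<psi> x)"
  unfolding smooth_def using C_diff_linear by blast

lemma smooth_mult: "smooth \<phi> \<Longrightarrow> smooth \<psi> \<Longrightarrow> smooth (\<lambda>x. \<phi> x * \<psi> x)"
  unfolding smooth_def using C_diff_mult by blast

lemma smooth_swap: "smooth \<phi> \<Longrightarrow> smooth (\<lambda>x. \<phi> (prod.swap x))"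
  unfolding smooth_def using C_diff_swap by blast

lemma smooth_pderiv_swap:
  assumes "smooth \<phi>"
  shows "pderiv1 (\<lambda>x. \<phi> (prod.swap x)) = (\<lambda>x. pderiv2 \<phi> (prod.swap x))"
    "pderiv2 (\<lambda>x. \<phi> (prod.swap x)) = (\<lambda>x. pderiv1 \<phi> (prod.swap x))"
  using assms pderiv_swap[of 0 \<phi>] unfolding smooth_def by blast+

lemma smooth_section_derivative:
  assumes "smooth \<phi>"
  shows "((\<lambda>t. \<phi> (t, y)) has_real_derivative pderiv1 \<phi> (t, y)) (at t)"
    "((\<lambda>t. \<phi> (y, t)) has_real_derivative pderiv2 \<phi> (y, t)) (at t)"
proof -
  have 1: "((\<lambda>t. (t, y)) has_derivative (\<lambda>h. (h, 0))) (at t)" "((\<lambda>t. (y, t)) has_derivative (\<lambda>h. (0, h))) (at t)"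
    by (auto intro!: derivative_eq_intros)
  show "((\<lambda>t. \<phi> (t, y)) has_real_derivative pderiv1 \<phi> (t, y)) (at t)"
    "((\<lambda>t. \<phi> (y, t)) has_real_derivative pderiv2 \<phi> (y, t)) (at t)"
    using has_derivative_compose[OF 1(1) smooth_has_derivative[OF assms]]
      has_derivative_compose[OF 1(2) smooth_has_derivative[OF assms]]
    by (auto simp: has_field_derivative_def)
qed

lemma smooth_section_continuous:
  assumes "smooth \<phi>"
  shows "continuous_on UNIV (\<lambda>t. \<phi> (t, y))" "continuous_on UNIV (\<lambda>t. \<phi> (y, t))"
  by (rule continuous_on_compose2[OF smooth_continuous[OF assms]]; auto intro!: continuous_intros)+

lemma pderivs_cong_open:
  assumes "open U" "x \<in> U" "\<And>y. y \<in> U \<Longrightarrow> \<phi> y = \<psi> y" "smooth \<phi>"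
  shows "pderiv1 \<phi> x = pderiv1 \<psi> x" "pderiv2 \<phi> x = pderiv2 \<psi> x"
proof -
  have "(\<psi> has_derivative (\<lambda>h. pderiv1 \<phi> x * fst h + pderiv2 \<phi> x * snd h)) (at x)"
    by (rule has_derivative_transform_within_open[OF smooth_has_derivative[OF assms(4)] assms(1,2,3)])
  then show "pderiv1 \<phi> x = pderiv1 \<psi> x" "pderiv2 \<phi> x = pderiv2 \<psi> x"
    using pderiv_eq[of \<psi> _ x] by simp_all
qed

lemma test_functionsI:
  assumes "smooth \<phi>" "compact C" "C \<subseteq> U" "\<And>x. x \<notin> C \<Longrightarrow> \<phi> x = 0"
  shows "\<phi> \<in> test_functions U"
proof -
  have "supp \<phi> \<subseteq> C"
    unfolding supp_def using assms by (intro closure_minimal) (auto intro: compact_imp_closed)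
  moreover have "compact (supp \<phi>)"
    using calculation assms(2) compact_Int_closed[of C "supp \<phi>"] by (simp add: supp_def Int_absorb1)
  ultimately show ?thesis using assms by (auto simp: test_functions_def smooth_def)
qed

lemma test_functionsD:
  assumes "\<phi> \<in> test_functions U"
  shows "smooth \<phi>" "compact (supp \<phi>)" "supp \<phi> \<subseteq> U" "x \<notin> supp \<phi> \<Longrightarrow> \<phi> x = 0"
  using assms closure_subset[of "{x. \<phi> x \<noteq> 0}"] by (auto simp: test_functions_def smooth_def supp_def)

lemma test_functions_UNIV: "\<phi> \<in> test_functions U \<Longrightarrow> \<phi> \<in> test_functions UNIV"
  by (auto simp: test_functions_def)

lemma test_functions_measurable: "\<phi> \<in> test_functions U \<Longrightarrow> \<phi> \<in> borel_measurable borel"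
  using test_functionsD(1) smooth_measurable by blast

lemma test_functions_linear:
  assumes "\<phi> \<in> test_functions U" "\<psi> \<in> test_functions U"
  shows "(\<lambda>x. a * \<phi> x + b * \<psi> x) \<in> test_functions U"
proof -
  note D = test_functionsD[OF assms(1)] test_functionsD[OF assms(2)]
  show ?thesis
  proof (rule test_functionsI[where C = "supp \<phi> \<union> supp \<psi>"])
    show "smooth (\<lambda>x. a * \<phi> x + b * \<psi> x)" by (rule smooth_linear[OF D(1,5)])
    show "compact (supp \<phi> \<union> supp \<psi>)" by (rule compact_Un[OF D(2,6)])
    show "supp \<phi> \<union> supp \<psi> \<subseteq> U" using D(3,7) by simp
    show "a * \<phi> x + b * \<psi> x = 0" if "x \<notin> supp \<phi> \<union> supp \<psi>" for x
      using that D(4)[of x] D(8)[of x] by simp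
  qed
qed

text \<open>Off its support a test function vanishes locally, so that its derivatives do as well.\<close>

lemma test_functions_pderiv:
  assumes "\<phi> \<in> test_functions U"
  shows "pderiv1 \<phi> \<in> test_functions U" "pderiv2 \<phi> \<in> test_functions U"
proof -
  note D = test_functionsD[OF assms]
  have op: "open (- supp \<phi>)" using closed_closure by (simp add: supp_def open_Compl)
  have z: "smooth (\<lambda>_. 0)" using smooth_linear[OF D(1) D(1), of 0 0] by simp
  have "pderiv1 (\<lambda>_::plane. 0) x = 0" "pderiv2 (\<lambda>_::plane. 0) x = 0" for x
    using pderiv_eq[OF has_derivative_const] by auto
  moreover have "pderiv1 \<phi> x = pderiv1 (\<lambda>_. 0) x" "pderiv2 \<phi> x = pderiv2 (\<lambda>_. 0) x"
    if "x \<notin> supp \<phi>" for x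
    using that D(4) by (intro pderivs_cong_open[OF op _ _ D(1)]; simp)+
  ultimately have *: "pderiv1 \<phi> x = 0" "pderiv2 \<phi> x = 0" if "x \<notin> supp \<phi>" for x
    using that by simp_all
  show "pderiv1 \<phi> \<in> test_functions U"
    by (rule test_functionsI[OF smooth_pderivs(1)[OF D(1)] D(2,3) *(1)])
  show "pderiv2 \<phi> \<in> test_functions U"
    by (rule test_functionsI[OF smooth_pderivs(2)[OF D(1)] D(2,3) *(2)])
qed

lemma test_functions_bounded:
  assumes "\<phi> \<in> test_functions U"
  obtains C where "\<And>x. \<bar>\<phi> x\<bar> \<le> C"
proof -
  note D = test_functionsD[OF assms]
  have "continuous_on (supp \<phi>) \<phi>"
    by (rule continuous_on_subset[OF smooth_continuous[OF D(1)]]) simp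
  then have "bounded (\<phi> ` supp \<phi>)"
    by (intro compact_imp_bounded compact_continuous_image D(2))
  then obtain C where C: "\<forall>x\<in>supp \<phi>. \<bar>\<phi> x\<bar> \<le> C"
    unfolding bounded_real by blast
  have "\<bar>\<phi> x\<bar> \<le> max C 0" for x
  proof (cases "x \<in> supp \<phi>")
    case True
    then show ?thesis using C by (simp add: le_max_iff_disj)
  next
    case False
    then show ?thesis using D(4)[OF False] by simp
  qed
  then show ?thesis using that[of "max C 0"] by auto
qed

lemma test_functions_box:
  assumes "\<phi> \<in> test_functions U"
  obtains B where "0 < B" "\<And>x. B \<le> \<bar>fst x\<bar> \<or> B \<le> \<bar>snd x\<bar> \<Longrightarrow> \<phi> x = 0"
proof -
  note D = test_functionsD[OF assms]
  obtain B where B: "\<And>x. x \<in> supp \<phi> \<Longrightarrow> norm x \<le> B"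
    using compact_imp_bounded[OF D(2)] unfolding bounded_iff by blast
  have "\<phi> x = 0" if "\<bar>B\<bar> + 1 \<le> \<bar>fst x\<bar> \<or> \<bar>B\<bar> + 1 \<le> \<bar>snd x\<bar>" for x
  proof -
    have "\<bar>fst x\<bar> \<le> norm x" "\<bar>snd x\<bar> \<le> norm x"
      using norm_fst_le[of "fst x" "snd x"] norm_snd_le[of "snd x" "fst x"] by simp_all
    then have "x \<notin> supp \<phi>" using B[of x] that by auto
    then show ?thesis by (rule D(4))
  qed
  then show ?thesis using that[of "\<bar>B\<bar> + 1"] by auto
qed



section \<open>Smooth functions of one variable and tensor products\<close>

text \<open>Functions of one variable are regarded as functions of the plane, so that the calculus of
  \<^const>\<open>C_diff\<close> applies to them.\<close>

definition smooth1 :: "(real \<Rightarrow> real) \<Rightarrow> bool" where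
  "smooth1 u \<longleftrightarrow> smooth (\<lambda>x. u (fst x))"

lemma fst_has_derivative:
  assumes "\<And>t. (u has_real_derivative u' t) (at t)"
  shows "((\<lambda>x::plane. u (fst x)) has_derivative (\<lambda>h. u' (fst x) * fst h + 0 * snd h)) (at x)"
  using DERIV_compose_FDERIV[OF assms has_derivative_fst[OF has_derivative_ident], of x UNIV]
  by (simp add: mult.commute)

lemma C_diff_const: "C_diff k (\<lambda>_. c)"
proof (induction k arbitrary: c)
  case (Suc k)
  show ?case by (rule C_diff_SucI[OF _ Suc.IH[of 0] Suc.IH[of 0]]) simp
qed simp

lemma smooth1_const: "smooth1 (\<lambda>_. c)"
  by (simp add: smooth1_def smooth_def C_diff_const)

lemma smooth1_linear: "smooth1 u \<Longrightarrow> smooth1 v \<Longrightarrow> smooth1 (\<lambda>x. a * u x + b * v x)"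
  unfolding smooth1_def by (rule smooth_linear)

lemma smooth1_mult: "smooth1 u \<Longrightarrow> smooth1 v \<Longrightarrow> smooth1 (\<lambda>x. u x * v x)"
  unfolding smooth1_def by (rule smooth_mult)

lemma smooth1_derivative: "smooth1 u \<Longrightarrow> (u has_real_derivative pderiv1 (\<lambda>x. u (fst x)) (t, 0)) (at t)"
  using smooth_section_derivative(1)[of "\<lambda>x. u (fst x)" 0 t] by (simp add: smooth1_def)

lemma smooth1_continuous: "smooth1 u \<Longrightarrow> continuous_on UNIV u"
  using smooth_section_continuous(1)[of "\<lambda>x. u (fst x)"] by (simp add: smooth1_def)

lemma smooth1_antiderivative:
  assumes "smooth1 u" "\<And>x. (w has_real_derivative u x) (at x)"
  shows "smooth1 w"
proof -
  have "C_diff (Suc k) (\<lambda>x. w (fst x))" for k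
    by (rule C_diff_SucI[OF fst_has_derivative[OF assms(2)] _ C_diff_const])
      (use assms(1) in \<open>simp add: smooth1_def smooth_def\<close>)
  then show ?thesis unfolding smooth1_def smooth_def using C_diff_Suc_imp by blast
qed

lemma smooth1_affine:
  assumes "smooth1 u"
  shows "smooth1 (\<lambda>x. u (a * x + b))"
proof -
  have "C_diff k (\<lambda>x. \<phi> (a * fst x + b, snd x))" if "C_diff k \<phi>" for k and \<phi> :: "plane \<Rightarrow> real"
    using that
  proof (induction k arbitrary: \<phi>)
    case 0
    then show ?case unfolding C_diff.simps
      by (rule continuous_on_compose2) (intro continuous_intros, simp)
  next
    case (Suc k)
    have "((\<lambda>x. \<phi> (a * fst x + b, snd x)) has_derivative
        (\<lambda>h. (a * pderiv1 \<phi> (a * fst x + b, snd x) + 0 * pderiv1 \<phi> (a * fst x + b, snd x)) * fst h +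
          pderiv2 \<phi> (a * fst x + b, snd x) * snd h)) (at x)" for x
    proof -
      have "((\<lambda>x. (a * fst x + b, snd x)) has_derivative (\<lambda>h. (a * fst h, snd h))) (at x)"
        by (auto intro!: derivative_eq_intros)
      from has_derivative_compose[OF this C_diff_SucD(1)[OF Suc.prems]]
      show ?thesis by (simp add: mult_ac)
    qed
    then show ?case
      by (rule C_diff_SucI) (intro C_diff_linear Suc.IH C_diff_SucD[OF Suc.prems])+
  qed
  from this[of _ "\<lambda>x. u (fst x)"] show ?thesis
    using assms by (simp add: smooth1_def smooth_def)
qed

lemma tensor_has_derivative:
  assumes "\<And>x. (u has_real_derivative u' x) (at x)" "\<And>x. (v has_real_derivative v' x) (at x)"
  shows "((\<lambda>x. u (fst x) * v (snd x)) has_derivative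
    (\<lambda>h. (u' (fst x) * v (snd x)) * fst h + (u (fst x) * v' (snd x)) * snd h)) (at x)"
proof -
  have u: "((\<lambda>x. u (fst x)) has_derivative (\<lambda>h. u' (fst x) * fst h)) (at x)"
    using DERIV_compose_FDERIV[OF assms(1) has_derivative_fst[OF has_derivative_ident], of x UNIV]
    by (simp add: mult.commute)
  have v: "((\<lambda>x. v (snd x)) has_derivative (\<lambda>h. v' (snd x) * snd h)) (at x)"
    using DERIV_compose_FDERIV[OF assms(2) has_derivative_snd[OF has_derivative_ident], of x UNIV]
    by (simp add: mult.commute)
  show ?thesis
    using has_derivative_mult[OF u v]
    by (rule has_derivative_eq_rhs) (simp add: fun_eq_iff algebra_simps)
qed

lemma smooth_tensor:
  assumes "smooth1 u" "smooth1 v"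
  shows "smooth (\<lambda>x. u (fst x) * v (snd x))"
  using smooth_mult[of "\<lambda>x. u (fst x)" "\<lambda>x. v (snd x)"] smooth_swap[of "\<lambda>x. v (fst x)"] assms
  by (simp add: smooth1_def)

lemma pderiv1_tensor:
  assumes "smooth1 u" "smooth1 v" "\<And>x. (u has_real_derivative u' x) (at x)"
  shows "pderiv1 (\<lambda>x. u (fst x) * v (snd x)) = (\<lambda>x. u' (fst x) * v (snd x))"
  by (rule pderivs_eqI(1)[OF tensor_has_derivative[OF assms(3) smooth1_derivative[OF assms(2)]]])

lemma pderiv2_tensor:
  assumes "smooth1 u" "smooth1 v" "\<And>x. (v has_real_derivative v' x) (at x)"
  shows "pderiv2 (\<lambda>x. u (fst x) * v (snd x)) = (\<lambda>x. u (fst x) * v' (snd x))"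
  by (rule pderivs_eqI(2)[OF tensor_has_derivative[OF smooth1_derivative[OF assms(1)] assms(3)]])

lemma test_functions_tensor:
  assumes "smooth1 u" "smooth1 v" "\<And>x. x \<notin> {a..b} \<Longrightarrow> u x = 0" "\<And>x. x \<notin> {c..d} \<Longrightarrow> v x = 0"
    "{a..b} \<times> {c..d} \<subseteq> U"
  shows "(\<lambda>x. u (fst x) * v (snd x)) \<in> test_functions U"
  using assms
  by (intro test_functionsI[where C = "{a..b} \<times> {c..d}"] smooth_tensor compact_Times) (auto simp: mem_Times_iff)

section \<open>Bumps and hats on the dyadic grid\<close>

text \<open>The classical functions \<open>P(1/x) exp(-1/x)\<close>, extended by zero to \<open>x \<le> 0\<close>. Keeping the
  polynomial \<open>P\<close> as a parameter makes the family closed under differentiation.\<close>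

definition flat_fun :: "real poly \<Rightarrow> real \<Rightarrow> real" where
  "flat_fun P x = (if x \<le> 0 then 0 else poly P (1 / x) * exp (- (1 / x)))"

lemma poly_times_exp_minus_tendsto_0:
  fixes P :: "real poly"
  shows "((\<lambda>y. poly P y * exp (- y)) \<longlongrightarrow> 0) at_top"
proof -
  have "((\<lambda>y. \<Sum>i\<le>degree P. coeff P i * (y ^ i / exp y)) \<longlongrightarrow> (\<Sum>i\<le>degree P. coeff P i * 0)) at_top"
    by (intro tendsto_sum tendsto_mult tendsto_const tendsto_power_div_exp_0)
  moreover have "(\<lambda>y. \<Sum>i\<le>degree P. coeff P i * (y ^ i / exp y)) = (\<lambda>y. poly P y * exp (- y))"
    by (simp add: fun_eq_iff poly_altdef sum_distrib_right exp_minus divide_inverse mult.assoc)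
  ultimately show ?thesis by simp
qed

text \<open>To the right of \<open>0\<close> the difference quotient is \<open>y P(y) exp(-y)\<close> with \<open>y = 1/x\<close>, and the exponential
  beats the polynomial as \<open>y\<close> tends to infinity.\<close>

lemma flat_fun_has_derivative:
  "(flat_fun P has_real_derivative flat_fun (monom 1 2 * (P - pderiv P)) x) (at x)"
proof -
  consider "x < 0" | "x > 0" | "x = 0" by linarith
  then show ?thesis
  proof cases
    case 1
    have "(flat_fun P has_real_derivative 0) (at x)"
      by (rule has_field_derivative_transform_within_open[of "\<lambda>_. 0" _ _ "{..<0}"])
        (use 1 in \<open>auto simp: flat_fun_def\<close>)
    then show ?thesis using 1 by (simp add: flat_fun_def)
  next
    case 2
    have inv: "((\<lambda>x. 1 / x) has_real_derivative - ((1 / x)\<^sup>2)) (at x)"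
      using 2 by (auto intro!: derivative_eq_intros simp: power2_eq_square)
    have "((\<lambda>x. poly P (1 / x) * exp (- (1 / x))) has_real_derivative
        poly (pderiv P) (1 / x) * (- ((1 / x)\<^sup>2)) * exp (- (1 / x)) +
        exp (- (1 / x)) * (- (- ((1 / x)\<^sup>2))) * poly P (1 / x)) (at x)"
      by (intro DERIV_mult DERIV_chain2[OF poly_DERIV inv] DERIV_chain2[OF DERIV_exp DERIV_minus[OF inv]])
    moreover have "poly (pderiv P) (1 / x) * (- ((1 / x)\<^sup>2)) * exp (- (1 / x)) +
        exp (- (1 / x)) * (- (- ((1 / x)\<^sup>2))) * poly P (1 / x) = flat_fun (monom 1 2 * (P - pderiv P)) x"
      using 2 by (simp add: flat_fun_def poly_monom algebra_simps)
    ultimately have "((\<lambda>x. poly P (1 / x) * exp (- (1 / x))) has_real_derivative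
        flat_fun (monom 1 2 * (P - pderiv P)) x) (at x)" by simp
    then show ?thesis
      by (rule has_field_derivative_transform_within_open[of _ _ _ "{0<..}"])
        (use 2 in \<open>auto simp: flat_fun_def\<close>)
  next
    case 3
    have "((\<lambda>h. flat_fun P h / h) \<longlongrightarrow> 0) (at_left 0)"
      by (rule tendsto_eventually) (auto simp: flat_fun_def eventually_at_filter)
    moreover have "((\<lambda>h. flat_fun P h / h) \<longlongrightarrow> 0) (at_right 0)"
    proof (rule Lim_transform_eventually)
      show "((\<lambda>h. poly (pCons 0 P) (inverse h) * exp (- inverse h)) \<longlongrightarrow> 0) (at_right (0::real))"
        by (rule filterlim_compose[OF poly_times_exp_minus_tendsto_0 filterlim_inverse_at_top_right])
      show "\<forall>\<^sub>F h in at_right 0. poly (pCons 0 P) (inverse h) * exp (- inverse h) = flat_fun P h / h"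
        by (auto simp: flat_fun_def eventually_at_filter field_simps)
    qed
    ultimately have "((\<lambda>h. flat_fun P h / h) \<longlongrightarrow> 0) (at 0)"
      by (simp add: filterlim_split_at)
    then show ?thesis using 3 by (simp add: DERIV_def flat_fun_def)
  qed
qed

lemma smooth1_flat_fun: "smooth1 (flat_fun P)"
proof -
  have "C_diff k (\<lambda>x. flat_fun P (fst x))" for k
  proof (induction k arbitrary: P)
    case 0
    have "isCont (flat_fun P) t" for t using flat_fun_has_derivative by (rule DERIV_isCont)
    then have "continuous_on UNIV (flat_fun P)" by (simp add: continuous_on_eq_continuous_at)
    then show ?case unfolding C_diff.simps
      by (rule continuous_on_compose2) (intro continuous_intros, simp)
  next
    case (Suc k)
    show ?case by (rule C_diff_SucI[OF fst_has_derivative[OF flat_fun_has_derivative] Suc.IH C_diff_const])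
  qed
  then show ?thesis by (simp add: smooth1_def smooth_def)
qed

lemma continuous_antiderivative:
  fixes u :: "real \<Rightarrow> real"
  assumes "continuous_on UNIV u"
  obtains w where "\<And>x. (w has_real_derivative u x) (at x)" "w 0 = 0"
proof -
  have "\<exists>F. \<forall>x. -\<infinity> < ereal x \<longrightarrow> ereal x < \<infinity> \<longrightarrow> (F has_vector_derivative u x) (at x)"
    by (rule einterval_antiderivative) (use assms in \<open>auto simp: continuous_on_eq_continuous_at\<close>)
  then obtain F where F: "\<And>x. (F has_real_derivative u x) (at x)"
    by (auto simp: has_real_derivative_iff_has_vector_derivative)
  have "((\<lambda>x. F x - F 0) has_real_derivative u x) (at x)" for x
    using DERIV_diff[OF F DERIV_const] by simp
  then show ?thesis by (intro that[of "\<lambda>x. F x - F 0"]) auto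
qed

lemma antiderivative_mono:
  fixes w :: "real \<Rightarrow> real"
  assumes "\<And>x. (w has_real_derivative u x) (at x)" "\<And>x. 0 \<le> u x" "x \<le> y"
  shows "w x \<le> w y"
  using DERIV_nonneg_imp_nondecreasing[of x y w] assms by blast

lemma antiderivative_const:
  fixes w :: "real \<Rightarrow> real"
  assumes "\<And>x. (w has_real_derivative u x) (at x)" "\<And>t. x \<le> t \<Longrightarrow> t \<le> y \<Longrightarrow> u t = 0" "x \<le> y"
  shows "w x = w y"
proof (rule antisym)
  show "w x \<le> w y"
    by (rule DERIV_nonneg_imp_nondecreasing[OF assms(3)]) (use assms in \<open>metis order_refl\<close>)
  show "w y \<le> w x"
    by (rule DERIV_nonpos_imp_nonincreasing[OF assms(3)]) (use assms in \<open>metis order_refl\<close>)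
qed

text \<open>The normalised antiderivative of a function that is positive exactly on the unit interval.\<close>

lemma smooth_step_exists:
  "\<exists>h. smooth1 h \<and> (\<forall>x. 0 \<le> h x \<and> h x \<le> 1) \<and> (\<forall>x\<le>0. h x = 0) \<and> (\<forall>x\<ge>1. h x = 1)"
proof -
  define \<beta> where "\<beta> x = flat_fun 1 x * flat_fun 1 (- 1 * x + 1)" for x
  have \<beta>: "smooth1 \<beta>" unfolding \<beta>_def by (intro smooth1_mult smooth1_flat_fun smooth1_affine)
  have \<beta>0: "0 \<le> \<beta> x" "x \<le> 0 \<Longrightarrow> \<beta> x = 0" "1 \<le> x \<Longrightarrow> \<beta> x = 0" "0 < x \<Longrightarrow> x < 1 \<Longrightarrow> 0 < \<beta> x" for x
    by (auto simp: \<beta>_def flat_fun_def)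
  obtain w where w: "\<And>x. (w has_real_derivative \<beta> x) (at x)" "w 0 = 0"
    using continuous_antiderivative[OF smooth1_continuous[OF \<beta>]] by blast
  have "w 0 < w 1"
  proof (rule DERIV_pos_imp_increasing_open[of 0 1 w])
    show "\<exists>y. (w has_real_derivative y) (at x) \<and> 0 < y" if "0 < x" "x < 1" for x
      using w(1)[of x] \<beta>0(4)[OF that] by blast
    show "continuous_on {0..1} w" using w(1) by (intro DERIV_continuous_on) (auto intro: DERIV_subset)
  qed simp
  then have pos: "0 < w 1" using w(2) by simp
  have w0: "w x = 0" if "x \<le> 0" for x
    using antiderivative_const[OF w(1), of x 0] \<beta>0(2) that w(2) by simp
  have w1: "w x = w 1" if "1 \<le> x" for x
    using antiderivative_const[OF w(1), of 1 x] \<beta>0(3) that by simp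
  have "0 \<le> w x" "w x \<le> w 1" for x
    using antiderivative_mono[OF w(1) \<beta>0(1), of "min x 0" x] antiderivative_mono[OF w(1) \<beta>0(1), of x "max x 1"]
      w0[of "min x 0"] w1[of "max x 1"] by (simp_all only: min.cobounded1 min.cobounded2 max.cobounded1 max.cobounded2)
  note bnd = this
  have "smooth1 (\<lambda>x. (1 / w 1) * w x + 0 * w x)"
    by (intro smooth1_linear smooth1_antiderivative[OF \<beta> w(1)])
  then have "smooth1 (\<lambda>x. w x / w 1)" by simp
  moreover have "0 \<le> w x / w 1 \<and> w x / w 1 \<le> 1" for x using bnd[of x] pos by simp
  moreover have "\<forall>x\<le>0. w x / w 1 = 0" using w0 by simp
  moreover have "\<forall>x\<ge>1. w x / w 1 = 1"
  proof (intro allI impI)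
    fix x :: real assume "1 \<le> x"
    then have "w x = w 1" by (rule w1)
    then show "w x / w 1 = 1" using pos by simp
  qed
  ultimately show ?thesis by blast
qed

definition smooth_step :: "real \<Rightarrow> real" where
  "smooth_step = (SOME h. smooth1 h \<and> (\<forall>x. 0 \<le> h x \<and> h x \<le> 1) \<and> (\<forall>x\<le>0. h x = 0) \<and> (\<forall>x\<ge>1. h x = 1))"

lemma smooth_step:
  shows smooth1_smooth_step: "smooth1 smooth_step"
    and smooth_step_bounds: "0 \<le> smooth_step x" "smooth_step x \<le> 1"
    and smooth_step_0: "x \<le> 0 \<Longrightarrow> smooth_step x = 0"
    and smooth_step_1: "1 \<le> x \<Longrightarrow> smooth_step x = 1"
  using someI_ex[OF smooth_step_exists] unfolding smooth_step_def by blast+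

text \<open>Smooth approximations from inside of the indicator of the open unit interval: the value is one
  on the interval from \<open>2/j\<close> to \<open>1 - 2/j\<close> and zero outside the one from \<open>1/j\<close> to \<open>1 - 1/j\<close>.
  For \<open>j = 0\<close> it is the zero function.\<close>

definition bump :: "nat \<Rightarrow> real \<Rightarrow> real" where
  "bump j x = smooth_step (real j * x + (- 1)) * smooth_step ((- real j) * x + (real j - 1))"

lemma smooth1_bump: "smooth1 (bump j)"
  unfolding bump_def[abs_def] by (intro smooth1_mult smooth1_affine smooth1_smooth_step)

lemma bump_bounds: "0 \<le> bump j x" "bump j x \<le> 1"
  unfolding bump_def by (auto intro!: mult_nonneg_nonneg mult_le_one simp: smooth_step_bounds)

lemma bump_eq_0:
  assumes "j > 0" "x \<notin> {1 / real j .. 1 - 1 / real j}"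
  shows "bump j x = 0"
proof -
  have "real j * x + (- 1) \<le> 0 \<or> (- real j) * x + (real j - 1) \<le> 0"
    using assms by (auto simp: field_simps)
  then show ?thesis unfolding bump_def using smooth_step_0 by auto
qed

lemma bump_eq_0_outside:
  assumes "x \<le> 0 \<or> 1 \<le> x"
  shows "bump j x = 0"
proof (cases "j = 0")
  case True
  then show ?thesis by (simp add: bump_def smooth_step_0)
next
  case False
  then have "0 < 1 / real j" by simp
  then have "x \<notin> {1 / real j .. 1 - 1 / real j}" using assms unfolding atLeastAtMost_iff by linarith
  then show ?thesis using False by (intro bump_eq_0) auto
qed

lemma bump_tendsto_1:
  assumes "0 < x" "x < 1"
  shows "(\<lambda>j. bump j x) \<longlonglongrightarrow> 1"
proof (rule tendsto_eventually)
  have "\<forall>\<^sub>F j in sequentially. 2 / x \<le> real j" "\<forall>\<^sub>F j in sequentially. 2 / (1 - x) \<le> real j"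
    using filterlim_real_sequentially by (auto simp: filterlim_at_top)
  then show "\<forall>\<^sub>F j in sequentially. bump j x = 1"
  proof eventually_elim
    case (elim j)
    then have "1 \<le> real j * x + (- 1)" "1 \<le> (- real j) * x + (real j - 1)"
      using assms by (auto simp: field_simps)
    then show ?case by (simp add: bump_def smooth_step_1)
  qed
qed

text \<open>The antiderivative of a bump that vanishes at the origin; it rises from zero to a value of at
  most one.\<close>

definition bump_int :: "nat \<Rightarrow> real \<Rightarrow> real" where
  "bump_int j = (SOME w. (\<forall>x. (w has_real_derivative bump j x) (at x)) \<and> w 0 = 0)"

lemma bump_int:
  shows bump_int_deriv: "(bump_int j has_real_derivative bump j x) (at x)" and bump_int_0: "bump_int j 0 = 0"
proof -
  have "\<exists>w. (\<forall>x. (w has_real_derivative bump j x) (at x)) \<and> w 0 = 0"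
    using continuous_antiderivative[OF smooth1_continuous[OF smooth1_bump, of j]] by metis
  from someI_ex[OF this] show "(bump_int j has_real_derivative bump j x) (at x)" "bump_int j 0 = 0"
    unfolding bump_int_def by blast+
qed

lemma smooth1_bump_int: "smooth1 (bump_int j)"
  by (rule smooth1_antiderivative[OF smooth1_bump bump_int_deriv])

lemma bump_int_mono: "x \<le> y \<Longrightarrow> bump_int j x \<le> bump_int j y"
  by (rule antiderivative_mono[OF bump_int_deriv bump_bounds(1)])

lemma bump_int_eq_0: "x \<le> 0 \<Longrightarrow> bump_int j x = 0"
  using antiderivative_const[OF bump_int_deriv, of x 0 j] bump_eq_0_outside bump_int_0 by simp

lemma bump_int_eq_1: "1 \<le> x \<Longrightarrow> bump_int j x = bump_int j 1"
  using antiderivative_const[OF bump_int_deriv, of 1 x j] bump_eq_0_outside by simp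

lemma bump_int_le_1: "bump_int j x \<le> 1"
proof -
  have "bump_int j 1 - 1 \<le> bump_int j 0 - 0"
  proof (rule DERIV_nonpos_imp_nonincreasing[of 0 1 "\<lambda>x. bump_int j x - x"])
    fix x
    show "\<exists>y. ((\<lambda>x. bump_int j x - x) has_real_derivative y) (at x) \<and> y \<le> 0"
      using DERIV_diff[OF bump_int_deriv DERIV_ident, of j x] bump_bounds(2)[of j x] by force
  qed simp
  then have "bump_int j 1 \<le> 1" using bump_int_0 by simp
  moreover have "bump_int j x \<le> bump_int j (max x 1)" by (rule bump_int_mono) simp
  ultimately show ?thesis using bump_int_eq_1[of "max x 1" j] by simp
qed

text \<open>The bump of the open interval from \<open>(k - 1) / 2^N\<close> to \<open>k / 2^N\<close>. For \<open>k = 0\<close> and for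
  \<open>k = 2^N + 1\<close> this interval lies next to the unit interval.\<close>

definition cell_bump :: "nat \<Rightarrow> nat \<Rightarrow> nat \<Rightarrow> real \<Rightarrow> real" where
  "cell_bump N j k x = bump j (2 ^ N * x + (1 - real k))"

text \<open>A smoothed hat centred at the grid point \<open>k / 2^N\<close>. It is written as a difference so that its
  derivative is a difference of neighbouring bumps and the hats sum up telescopically.\<close>

definition hat :: "nat \<Rightarrow> nat \<Rightarrow> nat \<Rightarrow> real \<Rightarrow> real" where
  "hat N j k x = 1 * bump_int j (2 ^ N * x + (1 - real k)) + (- 1) * bump_int j (2 ^ N * x + (1 - real (Suc k)))"

lemma smooth1_cell_bump: "smooth1 (cell_bump N j k)"
  unfolding cell_bump_def[abs_def] by (intro smooth1_affine smooth1_bump)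

lemma smooth1_hat: "smooth1 (hat N j k)"
  unfolding hat_def[abs_def] by (intro smooth1_linear smooth1_affine smooth1_bump_int)

lemma cell_bump_bounds: "0 \<le> cell_bump N j k x" "cell_bump N j k x \<le> 1"
  by (simp_all add: cell_bump_def bump_bounds)

lemma hat_deriv:
  "(hat N j k has_real_derivative 2 ^ N * cell_bump N j k x + (- (2 ^ N)) * cell_bump N j (Suc k) x) (at x)"
proof -
  have D: "((\<lambda>x. bump_int j (2 ^ N * x + c)) has_real_derivative bump j (2 ^ N * x + c) * 2 ^ N) (at x)" for c :: real
    by (rule DERIV_chain2[OF bump_int_deriv]) (auto intro!: derivative_eq_intros)
  from DERIV_add[OF DERIV_cmult[OF D[of "1 - real k"], of 1] DERIV_cmult[OF D[of "1 - real (Suc k)"], of "- 1"]] show ?thesis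
    unfolding hat_def[abs_def] cell_bump_def by (simp add: mult.commute)
qed

lemma hat_nonneg: "0 \<le> hat N j k x"
  unfolding hat_def using bump_int_mono[of "2 ^ N * x + (1 - real (Suc k))" "2 ^ N * x + (1 - real k)" j] by simp

lemma sum_hat_le_1: "(\<Sum>k\<le>n. hat N j k x) \<le> 1"
proof -
  have "(\<Sum>k\<le>n. hat N j k x) = bump_int j (2 ^ N * x + (1 - real 0)) - bump_int j (2 ^ N * x + (1 - real (Suc n)))"
    by (induction n) (simp_all add: hat_def algebra_simps)
  also have "\<dots> \<le> 1 - 0"
    using bump_int_le_1 bump_int_mono[of "min 0 (2 ^ N * x + (1 - real (Suc n)))" "2 ^ N * x + (1 - real (Suc n))" j]
      bump_int_eq_0[of "min 0 (2 ^ N * x + (1 - real (Suc n)))" j]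
    by (intro diff_mono) auto
  finally show ?thesis by simp
qed

lemma hat_eq_0:
  assumes "x \<notin> {(real k - 1) / 2 ^ N .. (real k + 1) / 2 ^ N}"
  shows "hat N j k x = 0"
proof -
  have "x < (real k - 1) / 2 ^ N \<or> (real k + 1) / 2 ^ N < x" using assms by auto
  then show ?thesis
  proof
    assume "x < (real k - 1) / 2 ^ N"
    then have "2 ^ N * x + (1 - real k) \<le> 0" "2 ^ N * x + (1 - real (Suc k)) \<le> 0"
      by (auto simp: field_simps)
    then show ?thesis by (simp add: hat_def bump_int_eq_0)
  next
    assume "(real k + 1) / 2 ^ N < x"
    then have "1 \<le> 2 ^ N * x + (1 - real k)" "1 \<le> 2 ^ N * x + (1 - real (Suc k))"
      by (auto simp: field_simps)
    then show ?thesis unfolding hat_def by (simp only: bump_int_eq_1[of "2 ^ N * x + (1 - real k)"]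
          bump_int_eq_1[of "2 ^ N * x + (1 - real (Suc k))"])
  qed
qed

lemma cell_bump_eq_0:
  assumes "j > 0" "x \<notin> {(real k - 1 + 1 / real j) / 2 ^ N .. (real k - 1 / real j) / 2 ^ N}"
  shows "cell_bump N j k x = 0"
  unfolding cell_bump_def
proof (rule bump_eq_0[OF assms(1)])
  show "2 ^ N * x + (1 - real k) \<notin> {1 / real j..1 - 1 / real j}"
  proof
    assume "2 ^ N * x + (1 - real k) \<in> {1 / real j..1 - 1 / real j}"
    then have "real k - 1 + 1 / real j \<le> x * 2 ^ N" "x * 2 ^ N \<le> real k - 1 / real j"
      by (auto simp: algebra_simps)
    then have "x \<in> {(real k - 1 + 1 / real j) / 2 ^ N .. (real k - 1 / real j) / 2 ^ N}"
      by (simp add: pos_divide_le_eq pos_le_divide_eq)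
    then show False using assms(2) by blast
  qed
qed

lemma cell_bump_eq_0_outside:
  assumes "x \<notin> {(real k - 1) / 2 ^ N <..< real k / 2 ^ N}"
  shows "cell_bump N j k x = 0"
proof -
  have "x \<le> (real k - 1) / 2 ^ N \<or> real k / 2 ^ N \<le> x" using assms by auto
  then have "2 ^ N * x + (1 - real k) \<le> 0 \<or> 1 \<le> 2 ^ N * x + (1 - real k)"
    by (auto simp: field_simps)
  then show ?thesis unfolding cell_bump_def by (rule bump_eq_0_outside)
qed

lemma cell_bump_tendsto:
  "(\<lambda>j. cell_bump N j k x) \<longlonglongrightarrow> indicator {(real k - 1) / 2 ^ N <..< real k / 2 ^ N} x"
proof (cases "x \<in> {(real k - 1) / 2 ^ N <..< real k / 2 ^ N}")
  case True
  then have "0 < 2 ^ N * x + (1 - real k)" "2 ^ N * x + (1 - real k) < 1"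
    by (auto simp: field_simps)
  from bump_tendsto_1[OF this] show ?thesis using True by (simp add: cell_bump_def)
next
  case False
  then show ?thesis using cell_bump_eq_0_outside[OF False] by simp
qed

text \<open>The bumps have disjoint supports.\<close>

lemma sum_cell_bump_le_1:
  assumes "finite I"
  shows "(\<Sum>k\<in>I. cell_bump N j k x) \<le> 1"
proof (cases "\<exists>k\<in>I. cell_bump N j k x \<noteq> 0")
  case True
  then obtain k where k: "k \<in> I" "cell_bump N j k x \<noteq> 0" by blast
  have "cell_bump N j l x = 0" if "l \<noteq> k" for l
  proof (rule ccontr)
    assume l: "cell_bump N j l x \<noteq> 0"
    have "x \<in> {(real k - 1) / 2 ^ N <..< real k / 2 ^ N}" "x \<in> {(real l - 1) / 2 ^ N <..< real l / 2 ^ N}"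
      using cell_bump_eq_0_outside k(2) l by blast+
    then have "real k - 1 < x * 2 ^ N" "x * 2 ^ N < real k" "real l - 1 < x * 2 ^ N" "x * 2 ^ N < real l"
      by (auto simp: field_simps)
    then have "real k < real l + 1" "real l < real k + 1" by linarith+
    then show False using \<open>l \<noteq> k\<close> by linarith
  qed
  then have "(\<Sum>k\<in>I. cell_bump N j k x) = (\<Sum>k\<in>{k}. cell_bump N j k x)"
    using k assms by (intro sum.mono_neutral_right) auto
  then show ?thesis using cell_bump_bounds(2) by simp
next
  case False
  then have "(\<Sum>k\<in>I. cell_bump N j k x) = 0" by (intro sum.neutral) blast
  then show ?thesis by simp
qed

section \<open>Distributions with measure-valued mixed derivative are distribution functions\<close>

text \<open>For \<open>L\<close> large, this is the integral of \<open>\<phi>\<close> over the horizontal half-line starting at \<open>x\<close>.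
  The fixed bounded range of integration allows differentiation under the integral sign.\<close>

definition tail_int :: "real \<Rightarrow> (plane \<Rightarrow> real) \<Rightarrow> plane \<Rightarrow> real" where
  "tail_int L \<phi> x = integral (cbox 0 L) (\<lambda>s. \<phi> (fst x + s, snd x))"

lemma continuous_shift:
  assumes "smooth \<phi>"
  shows "continuous_on S (\<lambda>z. \<phi> (fst (fst z) + snd z, snd (fst z)))"
proof -
  have "continuous_on UNIV (\<lambda>z. \<phi> (fst (fst z) + snd z, snd (fst z)))"
    by (rule continuous_on_compose2[OF smooth_continuous[OF assms]]) (auto intro!: continuous_intros)
  then show ?thesis using continuous_on_subset by blast
qed

lemma continuous_shift1:
  assumes "smooth \<phi>"
  shows "continuous_on S (\<lambda>s. \<phi> (a + s, b))"
proof -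
  have "continuous_on UNIV (\<lambda>s. \<phi> (a + s, b))"
    by (rule continuous_on_compose2[OF smooth_continuous[OF assms]]) (auto intro!: continuous_intros)
  then show ?thesis using continuous_on_subset by blast
qed

lemma tail_int_has_derivative:
  assumes \<phi>: "smooth \<phi>"
  shows "(tail_int L \<phi> has_derivative
    (\<lambda>h. tail_int L (pderiv1 \<phi>) x * fst h + tail_int L (pderiv2 \<phi>) x * snd h)) (at x)"
proof -
  define F S :: "plane \<Rightarrow>\<^sub>L real" where "F = Blinfun fst" and "S = Blinfun snd"
  have FS: "blinfun_apply F h = fst h" "blinfun_apply S h = snd h" for h
    by (simp_all add: F_def S_def bounded_linear_Blinfun_apply bounded_linear_fst bounded_linear_snd)
  define D where "D x s = pderiv1 \<phi> (fst x + s, snd x) *\<^sub>R F + pderiv2 \<phi> (fst x + s, snd x) *\<^sub>R S" for x s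
  have Dapp: "blinfun_apply (D x s) =
      (\<lambda>h. pderiv1 \<phi> (fst x + s, snd x) * fst h + pderiv2 \<phi> (fst x + s, snd x) * snd h)" for x s
    by (simp add: fun_eq_iff D_def FS blinfun.bilinear_simps)
  have cD: "continuous_on U (\<lambda>z. D (fst z) (snd z))" for U
    unfolding D_def
    by (intro continuous_intros continuous_shift smooth_pderivs \<phi>)
  have "((\<lambda>x. integral (cbox 0 L) ((\<lambda>x s. \<phi> (fst x + s, snd x)) x)) has_derivative
      blinfun_apply (integral (cbox 0 L) (D x))) (at x within UNIV)"
  proof (rule leibniz_rule)
    fix x :: plane and t :: real
    have "((\<lambda>x. (fst x + t, snd x)) has_derivative (\<lambda>h. h)) (at x)"
      by (auto intro!: derivative_eq_intros)
    from has_derivative_compose[OF this smooth_has_derivative[OF \<phi>]]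
    show "((\<lambda>x. \<phi> (fst x + t, snd x)) has_derivative blinfun_apply (D x t)) (at x within UNIV)"
      by (simp add: Dapp)
  next
    show "(\<lambda>s. \<phi> (fst x + s, snd x)) integrable_on cbox 0 L" for x :: plane
      by (rule integrable_continuous[OF continuous_shift1[OF \<phi>]])
  next
    show "continuous_on (UNIV \<times> cbox 0 L) (\<lambda>(x, t). D x t)"
      unfolding case_prod_beta by (rule cD)
  qed auto
  then have "(tail_int L \<phi> has_derivative blinfun_apply (integral (cbox 0 L) (D x))) (at x)"
    by (simp add: tail_int_def[abs_def])
  moreover have "blinfun_apply (integral (cbox 0 L) (D x)) =
      (\<lambda>h. tail_int L (pderiv1 \<phi>) x * fst h + tail_int L (pderiv2 \<phi>) x * snd h)"
  proof
    fix h :: plane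
    note c = continuous_shift1[OF smooth_pderivs(1)[OF \<phi>]] continuous_shift1[OF smooth_pderivs(2)[OF \<phi>]]
    have "D x integrable_on cbox 0 L"
      unfolding D_def by (intro integrable_continuous continuous_intros c)
    then have "blinfun_apply (integral (cbox 0 L) (D x)) h = integral (cbox 0 L) (\<lambda>s. blinfun_apply (D x s) h)"
      by (rule blinfun_apply_integral)
    also have "\<dots> = integral (cbox 0 L)
        (\<lambda>s. pderiv1 \<phi> (fst x + s, snd x) * fst h + pderiv2 \<phi> (fst x + s, snd x) * snd h)"
      by (simp add: Dapp)
    also have "\<dots> = integral (cbox 0 L) (\<lambda>s. pderiv1 \<phi> (fst x + s, snd x) * fst h) +
        integral (cbox 0 L) (\<lambda>s. pderiv2 \<phi> (fst x + s, snd x) * snd h)"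
      by (rule integral_add) (intro integrable_continuous continuous_intros c)+
    also have "\<dots> = tail_int L (pderiv1 \<phi>) x * fst h + tail_int L (pderiv2 \<phi>) x * snd h"
      by (simp add: tail_int_def)
    finally show "blinfun_apply (integral (cbox 0 L) (D x)) h =
      tail_int L (pderiv1 \<phi>) x * fst h + tail_int L (pderiv2 \<phi>) x * snd h" .
  qed
  ultimately show ?thesis by simp
qed

lemma smooth_tail_int:
  assumes "smooth \<phi>"
  shows "smooth (tail_int L \<phi>)"
proof -
  have "C_diff k (tail_int L \<phi>)" if "smooth \<phi>" for k \<phi>
    using that
  proof (induction k arbitrary: \<phi>)
    case 0
    have "tail_int L \<phi> differentiable (at x)" for x
      using tail_int_has_derivative[OF 0] unfolding differentiable_def by blast
    then show ?case unfolding C_diff.simps continuous_on_eq_continuous_at[OF open_UNIV]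
      using differentiable_imp_continuous_within by blast
  next
    case (Suc k)
    show ?case
      by (rule C_diff_SucI[OF tail_int_has_derivative[OF Suc.prems]
            Suc.IH[OF smooth_pderivs(1)[OF Suc.prems]] Suc.IH[OF smooth_pderivs(2)[OF Suc.prems]]])
  qed
  then show ?thesis using assms by (simp add: smooth_def)
qed

lemma smooth_cutoff: "smooth (\<lambda>x. smooth_step (fst x + 3))"
proof -
  have "smooth (\<lambda>x. smooth_step (1 * fst x + 3) * (\<lambda>_. 1) (snd x))"
    by (rule smooth_tensor[OF smooth1_affine[OF smooth1_smooth_step] smooth1_const])
  then show ?thesis by simp
qed

text \<open>The integral over a half-line to the right is minus an antiderivative, but it does not vanish far
  to the left. Cutting it off between \<open>-3\<close> and \<open>-2\<close> restores compact support and does not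
  change anything near \<open>K\<close>.\<close>

lemma test_function_antiderivative1:
  assumes \<phi>: "\<phi> \<in> test_functions UNIV"
  obtains \<psi> where "\<psi> \<in> test_functions UNIV" "\<And>x. - 2 < fst x \<Longrightarrow> pderiv1 \<psi> x = \<phi> x"
    "\<And>x. - 2 < fst x \<Longrightarrow> \<psi> x = - (\<integral>t. indicator {fst x..} t * \<phi> (t, snd x) \<partial>lborel)"
proof -
  note sm = test_functionsD(1)[OF \<phi>]
  obtain B where B: "0 < B" "\<And>x. B \<le> \<bar>fst x\<bar> \<or> B \<le> \<bar>snd x\<bar> \<Longrightarrow> \<phi> x = 0"
    using test_functions_box[OF \<phi>] by blast
  \<comment> \<open>With this length, the range of integration covers the support from every point to the
    right of \<open>-3\<close>, which is where the cutoff does not vanish.\<close>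
  define L where "L = B + 3"
  define \<psi> where "\<psi> x = (- 1) * (smooth_step (fst x + 3) * tail_int L \<phi> x) + 0 * \<phi> x" for x
  have sm\<psi>: "smooth \<psi>"
    unfolding \<psi>_def[abs_def]
    by (rule smooth_linear[OF smooth_mult[OF smooth_cutoff smooth_tail_int[OF sm]] sm])
  have L: "0 \<le> L" using B(1) by (simp add: L_def)
  have "\<psi> x = 0" if "x \<notin> {- 3..B} \<times> {- B..B}" for x
  proof -
    have "fst x < - 3 \<or> B < fst x \<or> B < \<bar>snd x\<bar>" using that by (auto simp: mem_Times_iff)
    then consider "fst x \<le> - 3" | "B \<le> fst x \<or> B \<le> \<bar>snd x\<bar>" by linarith
    then show ?thesis
    proof cases
      case 1
      then show ?thesis by (simp add: \<psi>_def smooth_step_0)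
    next
      case 2
      have "integral (cbox 0 L) (\<lambda>s. \<phi> (fst x + s, snd x)) = integral (cbox 0 L) (\<lambda>s. 0)"
        by (rule integral_cong) (rule B(2), use 2 in auto)
      then show ?thesis using B(2)[of x] by (simp add: \<psi>_def tail_int_def)
    qed
  qed
  then have 1: "\<psi> \<in> test_functions UNIV"
    by (intro test_functionsI[OF sm\<psi>, of "{- 3..B} \<times> {- B..B}"]) (auto intro!: compact_Times)
  have \<psi>_eq: "\<psi> x = (- 1) * tail_int L \<phi> x + 0 * \<phi> x" if "- 2 < fst x" for x
    using that by (simp add: \<psi>_def smooth_step_1)
  have 2: "pderiv1 \<psi> x = \<phi> x" if x: "- 2 < fst x" for x
  proof -
    have op: "open {x::plane. - 2 < fst x}" by (intro open_Collect_less continuous_intros)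
    have "(\<psi> has_derivative (\<lambda>h. pderiv1 \<psi> x * fst h + pderiv2 \<psi> x * snd h)) (at x)"
      by (rule smooth_has_derivative[OF sm\<psi>])
    then have "((\<lambda>x. - tail_int L \<phi> x) has_derivative (\<lambda>h. pderiv1 \<psi> x * fst h + pderiv2 \<psi> x * snd h)) (at x)"
      by (rule has_derivative_transform_within_open[OF _ op]) (use x \<psi>_eq in auto)
    from pderiv_eq(1)[OF this] pderiv_eq(1)[OF has_derivative_minus[OF tail_int_has_derivative[OF sm, of L x]]]
    have "pderiv1 \<psi> x = - tail_int L (pderiv1 \<phi>) x" by simp
    moreover have "((\<lambda>s. pderiv1 \<phi> (fst x + s, snd x)) has_integral
        \<phi> (fst x + L, snd x) - \<phi> (fst x + 0, snd x)) {0..L}"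
    proof (rule fundamental_theorem_of_calculus[OF L])
      fix s
      have "((\<lambda>t. \<phi> (t, snd x)) has_real_derivative pderiv1 \<phi> (fst x + s, snd x)) (at (fst x + s))"
        by (rule smooth_section_derivative(1)[OF sm])
      moreover have "((\<lambda>s. fst x + s) has_real_derivative 1) (at s)" by (auto intro!: derivative_eq_intros)
      ultimately have "((\<lambda>s. \<phi> (fst x + s, snd x)) has_real_derivative pderiv1 \<phi> (fst x + s, snd x) * 1) (at s)"
        by (rule DERIV_chain2)
      then show "((\<lambda>s. \<phi> (fst x + s, snd x)) has_vector_derivative pderiv1 \<phi> (fst x + s, snd x)) (at s within {0..L})"
        unfolding has_real_derivative_iff_has_vector_derivative[symmetric]
        by (auto intro: DERIV_subset)
    qed
    then have "tail_int L (pderiv1 \<phi>) x = \<phi> (fst x + L, snd x) - \<phi> (fst x + 0, snd x)"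
      unfolding tail_int_def by (simp add: integral_unique)
    moreover have "\<phi> (fst x + L, snd x) = 0" using x B(1) by (intro B(2)) (simp add: L_def abs_if)
    ultimately show ?thesis by simp
  qed
  have 3: "\<psi> x = - (\<integral>t. indicator {fst x..} t * \<phi> (t, snd x) \<partial>lborel)" if x: "- 2 < fst x" for x
  proof -
    have "(\<integral>t. indicator {fst x..} t * \<phi> (t, snd x) \<partial>lborel) =
        (\<integral>s. indicator {fst x..} (fst x + 1 * s) * \<phi> (fst x + 1 * s, snd x) \<partial>lborel)"
      by (subst lborel_integral_real_affine[of 1 _ "fst x"]) simp_all
    also have "\<dots> = (\<integral>s. indicator {0..L} s *\<^sub>R \<phi> (fst x + s, snd x) \<partial>lborel)"
    proof (rule Bochner_Integration.integral_cong[OF refl])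
      fix s :: real
      have "\<phi> (fst x + s, snd x) = 0" if "L < s" using x that B(1) by (intro B(2)) (simp add: L_def abs_if)
      then show "indicator {fst x..} (fst x + 1 * s) * \<phi> (fst x + 1 * s, snd x) =
          indicator {0..L} s *\<^sub>R \<phi> (fst x + s, snd x)"
        by (cases "L < s") (auto simp: indicator_def)
    qed
    also have "\<dots> = tail_int L \<phi> x"
      using set_borel_integral_eq_integral(2)[OF borel_integrable_atLeastAtMost'[OF continuous_shift1[OF sm], of 0 L "fst x" "snd x"]]
      by (simp add: tail_int_def set_lebesgue_integral_def)
    finally show ?thesis using \<psi>_eq[OF x] by simp
  qed
  show ?thesis by (rule that[OF 1 2 3])
qed

lemma test_functions_swap:
  assumes "\<phi> \<in> test_functions UNIV"
  shows "(\<lambda>x. \<phi> (prod.swap x)) \<in> test_functions UNIV"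
proof -
  obtain B where B: "0 < B" "\<And>x. B \<le> \<bar>fst x\<bar> \<or> B \<le> \<bar>snd x\<bar> \<Longrightarrow> \<phi> x = 0"
    using test_functions_box[OF assms] by blast
  show ?thesis
  proof (rule test_functionsI[OF smooth_swap[OF test_functionsD(1)[OF assms]], of "{- B..B} \<times> {- B..B}"])
    show "\<phi> (prod.swap x) = 0" if "x \<notin> {- B..B} \<times> {- B..B}" for x
      by (rule B(2)) (use that in \<open>auto simp: mem_Times_iff\<close>)
  qed (auto intro!: compact_Times)
qed

lemma test_function_antiderivative2:
  assumes \<phi>: "\<phi> \<in> test_functions UNIV"
  obtains \<psi> where "\<psi> \<in> test_functions UNIV" "\<And>x. - 2 < snd x \<Longrightarrow> pderiv2 \<psi> x = \<phi> x"
    "\<And>x. - 2 < snd x \<Longrightarrow> \<psi> x = - (\<integral>t. indicator {snd x..} t * \<phi> (fst x, t) \<partial>lborel)"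
proof -
  obtain \<psi> where \<psi>: "\<psi> \<in> test_functions UNIV" "\<And>x. - 2 < fst x \<Longrightarrow> pderiv1 \<psi> x = \<phi> (prod.swap x)"
    "\<And>x. - 2 < fst x \<Longrightarrow> \<psi> x = - (\<integral>t. indicator {fst x..} t * \<phi> (prod.swap (t, snd x)) \<partial>lborel)"
    using test_function_antiderivative1[OF test_functions_swap[OF \<phi>]] by blast
  show ?thesis
    by (rule that[OF test_functions_swap[OF \<psi>(1)]])
      (simp_all add: smooth_pderiv_swap[OF test_functionsD(1)[OF \<psi>(1)]] \<psi>(2,3))
qed

lemma test_function_integrable:
  assumes "\<phi> \<in> test_functions U"
  shows "integrable lborel \<phi>"
proof -
  note D = test_functionsD[OF assms]
  have "integrable lborel (\<lambda>x. indicator (supp \<phi>) x *\<^sub>R \<phi> x)"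
    by (rule borel_integrable_compact[OF D(2)]) (rule continuous_on_subset[OF smooth_continuous[OF D(1)]], simp)
  moreover have "(\<lambda>x. indicator (supp \<phi>) x *\<^sub>R \<phi> x) = \<phi>"
    using D(4) by (auto simp: fun_eq_iff indicator_def)
  ultimately show ?thesis by simp
qed

definition quadrant :: "plane \<Rightarrow> plane set" where
  "quadrant x = {..fst x} \<times> {..snd x}"

lemma quadrant_measurable: "quadrant x \<in> sets borel"
  unfolding quadrant_def by (intro borel_closed closed_Times) auto

lemma lborel_plane: "(lborel \<Otimes>\<^sub>M lborel :: plane measure) = lborel"
  by (rule lborel_prod)

text \<open>Near \<open>K\<close> the test function \<open>\<psi>\<close> inverts the mixed derivative, so that \<open>f\<close> can be
  recovered from \<open>D\<otimes>D f\<close>.\<close>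

lemma test_function_double_antiderivative:
  assumes \<phi>: "\<phi> \<in> test_functions UNIV"
  obtains \<psi> where "\<psi> \<in> test_functions UNIV"
    "\<And>x. - 2 < fst x \<Longrightarrow> - 2 < snd x \<Longrightarrow> pderiv2 (pderiv1 \<psi>) x = \<phi> x"
    "\<And>y. - 2 < fst y \<Longrightarrow> - 2 < snd y \<Longrightarrow> \<psi> y = (\<integral>x. indicator (quadrant x) y * \<phi> x \<partial>lborel)"
proof -
  obtain \<psi>2 where \<psi>2: "\<psi>2 \<in> test_functions UNIV" "\<And>x. - 2 < snd x \<Longrightarrow> pderiv2 \<psi>2 x = \<phi> x"
    "\<And>x. - 2 < snd x \<Longrightarrow> \<psi>2 x = - (\<integral>t. indicator {snd x..} t * \<phi> (fst x, t) \<partial>lborel)"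
    using test_function_antiderivative2[OF \<phi>] by blast
  obtain \<psi> where \<psi>: "\<psi> \<in> test_functions UNIV" "\<And>x. - 2 < fst x \<Longrightarrow> pderiv1 \<psi> x = \<psi>2 x"
    "\<And>x. - 2 < fst x \<Longrightarrow> \<psi> x = - (\<integral>t. indicator {fst x..} t * \<psi>2 (t, snd x) \<partial>lborel)"
    using test_function_antiderivative1[OF \<psi>2(1)] by blast
  have op: "open {x::plane. - 2 < fst x}" by (intro open_Collect_less continuous_intros)
  have 2: "pderiv2 (pderiv1 \<psi>) x = \<phi> x" if "- 2 < fst x" "- 2 < snd x" for x
  proof -
    have "pderiv2 (pderiv1 \<psi>) x = pderiv2 \<psi>2 x"
      by (rule pderivs_cong_open(2)[OF op]) (use that \<psi>(2) smooth_pderivs(1)[OF test_functionsD(1)[OF \<psi>(1)]] in auto)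
    then show ?thesis using \<psi>2(2) that by simp
  qed
  have 3: "\<psi> y = (\<integral>x. indicator (quadrant x) y * \<phi> x \<partial>lborel)" if y: "- 2 < fst y" "- 2 < snd y" for y
  proof -
    define f where "f x = indicator ({fst y..} \<times> {snd y..}) x * \<phi> x" for x
    have "integrable lborel (\<lambda>x. indicator ({fst y..} \<times> {snd y..}) x *\<^sub>R \<phi> x)"
      by (rule integrable_mult_indicator)
        (auto intro!: borel_closed closed_Times test_function_integrable[OF \<phi>])
    then have int: "integrable (lborel \<Otimes>\<^sub>M lborel) f" by (simp add: f_def[abs_def] lborel_plane)
    have "\<psi> y = - (\<integral>t. indicator {fst y..} t * \<psi>2 (t, snd y) \<partial>lborel)" using \<psi>(3) y by simp
    also have "\<dots> = - (\<integral>t. - (\<integral>s. f (t, s) \<partial>lborel) \<partial>lborel)"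
    proof (intro arg_cong[where f = uminus] Bochner_Integration.integral_cong[OF refl])
      fix t
      have "indicator {fst y..} t * \<psi>2 (t, snd y) = - (indicator {fst y..} t * (\<integral>s. indicator {snd y..} s * \<phi> (t, s) \<partial>lborel))"
        using \<psi>2(3)[of "(t, snd y)"] y by simp
      also have "\<dots> = - (\<integral>s. f (t, s) \<partial>lborel)"
        by (simp add: f_def indicator_times mult.assoc)
      finally show "indicator {fst y..} t * \<psi>2 (t, snd y) = - (\<integral>s. f (t, s) \<partial>lborel)" .
    qed
    also have "\<dots> = (\<integral>t. (\<integral>s. f (t, s) \<partial>lborel) \<partial>lborel)" by simp
    also have "\<dots> = (\<integral>x. f x \<partial>lborel)"
      using lborel_pair.integral_fst'[OF int] by (simp add: lborel_plane)
    also have "\<dots> = (\<integral>x. indicator (quadrant x) y * \<phi> x \<partial>lborel)"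
      by (rule Bochner_Integration.integral_cong[OF refl])
        (auto simp: f_def quadrant_def indicator_def mem_Times_iff)
    finally show ?thesis .
  qed
  show ?thesis by (rule that[OF \<psi>(1) 2 3])
qed

lemma quadrant_relation_measurable: "{p::plane \<times> plane. fst p \<in> quadrant (snd p)} \<in> sets borel"
  unfolding quadrant_def mem_Times_iff
  by (intro borel_closed closed_Collect_conj closed_Collect_le continuous_intros) 
    (simp_all add: closed_Collect_le continuous_intros)

text \<open>By Fubini, as \<open>y\<close> lies below \<open>x\<close> exactly if \<open>x\<close> lies above \<open>y\<close>.\<close>

lemma quadrant_integral:
  fixes M :: "plane measure"
  assumes M: "finite_measure M" "sets M = sets borel" and \<phi>: "\<phi> \<in> test_functions UNIV"
  shows "(\<lambda>x. measure M (quadrant x)) \<in> borel_measurable borel"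
    and "integrable lborel (\<lambda>x. measure M (quadrant x) * \<phi> x)"
    and "(\<lambda>y. \<integral>x. indicator (quadrant x) y * \<phi> x \<partial>lborel) \<in> borel_measurable M"
    and "(\<integral>y. (\<integral>x. indicator (quadrant x) y * \<phi> x \<partial>lborel) \<partial>M) = (\<integral>x. measure M (quadrant x) * \<phi> x \<partial>lborel)"
proof -
  interpret finite_measure M by fact
  interpret P: pair_sigma_finite M "lborel :: plane measure" ..
  interpret Q: pair_sigma_finite "lborel :: plane measure" M ..
  note int = test_function_integrable[OF \<phi>]
  note meas = test_functions_measurable[OF \<phi>]
  have spM: "space M = UNIV" using sets_eq_imp_space_eq[OF M(2)] by simp
  have sets_pair: "sets (M \<Otimes>\<^sub>M (lborel :: plane measure)) = sets borel"
    using sets_pair_measure_cong[OF M(2), of lborel "borel :: plane measure"] by (simp only: borel_prod sets_lborel)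
  have sets_pair': "sets ((lborel :: plane measure) \<Otimes>\<^sub>M M) = sets borel"
    using sets_pair_measure_cong[OF _ M(2), of lborel "borel :: plane measure"] by (simp only: borel_prod sets_lborel)
  define R where "R = {p::plane \<times> plane. fst p \<in> quadrant (snd p)}"
  have R: "R \<in> sets (M \<Otimes>\<^sub>M lborel)" unfolding sets_pair R_def by (rule quadrant_relation_measurable)
  have "{p::plane \<times> plane. snd p \<in> quadrant (fst p)} \<in> sets (lborel \<Otimes>\<^sub>M M)"
    unfolding sets_pair' quadrant_def mem_Times_iff
    by (intro borel_closed closed_Collect_conj closed_Collect_le continuous_intros)
      (simp_all add: closed_Collect_le continuous_intros)
  from measurable_emeasure_Pair[OF this]
  have "(\<lambda>x. emeasure M (quadrant x)) \<in> borel_measurable lborel" by (simp add: vimage_def)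
  then show m: "(\<lambda>x. measure M (quadrant x)) \<in> borel_measurable borel" by (simp add: measure_def)
  show "integrable lborel (\<lambda>x. measure M (quadrant x) * \<phi> x)"
  proof (rule Bochner_Integration.integrable_bound[of _ "\<lambda>x. measure M UNIV * \<phi> x"])
    show "AE x in lborel. norm (measure M (quadrant x) * \<phi> x) \<le> norm (measure M UNIV * \<phi> x)"
      by (rule AE_I2)
        (use spM in \<open>auto simp: abs_mult intro!: mult_right_mono finite_measure_mono simp: M(2)\<close>)
  qed (use int m meas in auto)
  have int1: "integrable (M \<Otimes>\<^sub>M lborel) (\<lambda>p. \<phi> (snd p))"
  proof (rule P.Fubini_integrable)
    show "(\<lambda>p. \<phi> (snd p)) \<in> borel_measurable (M \<Otimes>\<^sub>M lborel)"
      by (rule measurable_compose[OF measurable_snd]) (use meas in simp)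
  qed (use int in auto)
  have int2: "integrable (M \<Otimes>\<^sub>M lborel) (\<lambda>p. indicator R p *\<^sub>R \<phi> (snd p))"
    by (rule integrable_mult_indicator[OF R int1])
  have ind: "(\<lambda>y. \<integral>x. indicator (quadrant x) y * \<phi> x \<partial>lborel) =
      (\<lambda>y. \<integral>x. indicator R (y, x) *\<^sub>R \<phi> (snd (y, x)) \<partial>lborel)"
    by (intro ext Bochner_Integration.integral_cong refl) (auto simp: R_def indicator_def)
  show "(\<lambda>y. \<integral>x. indicator (quadrant x) y * \<phi> x \<partial>lborel) \<in> borel_measurable M"
    unfolding ind by (rule borel_measurable_integrable[OF P.integrable_fst'[OF int2]])
  have "(\<integral>y. (\<integral>x. indicator (quadrant x) y * \<phi> x \<partial>lborel) \<partial>M) =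
      (\<integral>y. (\<integral>x. indicator R (y, x) *\<^sub>R \<phi> (snd (y, x)) \<partial>lborel) \<partial>M)"
    unfolding ind ..
  also have "\<dots> = (\<integral>p. indicator R p *\<^sub>R \<phi> (snd p) \<partial>(M \<Otimes>\<^sub>M lborel))"
    by (rule P.integral_fst'[OF int2])
  also have "\<dots> = (\<integral>(x,y). indicator R (y, x) *\<^sub>R \<phi> (snd (y, x)) \<partial>(lborel \<Otimes>\<^sub>M M))"
    by (rule P.integral_product_swap[symmetric]) (use int2 in simp)
  also have "\<dots> = (\<integral>x. (\<integral>y. indicator R (y, x) *\<^sub>R \<phi> (snd (y, x)) \<partial>M) \<partial>lborel)"
    using Q.integral_fst'[OF P.integrable_product_swap[OF int2]] by simp
  also have "\<dots> = (\<integral>x. measure M (quadrant x) * \<phi> x \<partial>lborel)"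
  proof (intro Bochner_Integration.integral_cong refl)
    fix x
    have "(\<integral>y. indicator R (y, x) *\<^sub>R \<phi> (snd (y, x)) \<partial>M) = (\<integral>y. indicator (quadrant x) y * \<phi> x \<partial>M)"
      by (intro Bochner_Integration.integral_cong refl) (auto simp: R_def indicator_def)
    then show "(\<integral>y. indicator R (y, x) *\<^sub>R \<phi> (snd (y, x)) \<partial>M) = measure M (quadrant x) * \<phi> x"
      using spM by simp
  qed
  finally show "(\<integral>y. (\<integral>x. indicator (quadrant x) y * \<phi> x \<partial>lborel) \<partial>M) =
    (\<integral>x. measure M (quadrant x) * \<phi> x \<partial>lborel)" .
qed

lemma distributions_linear:
  assumes "T \<in> distributions" "\<phi> \<in> test_functions UNIV" "\<psi> \<in> test_functions UNIV"
  shows "T (\<lambda>x. a * \<phi> x + b * \<psi> x) = a * T \<phi> + b * T \<psi>"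
  using assms unfolding distributions_def by blast

lemma distr_D1_eq: "\<phi> \<in> test_functions UNIV \<Longrightarrow> distr_D1 T \<phi> = - T (pderiv1 \<phi>)"
  by (simp add: distr_D1_def)

lemma distr_D2_eq: "\<phi> \<in> test_functions UNIV \<Longrightarrow> distr_D2 T \<phi> = - T (pderiv2 \<phi>)"
  by (simp add: distr_D2_def)

lemma distr_DD_eq: "\<phi> \<in> test_functions UNIV \<Longrightarrow> distr_DD T \<phi> = T (pderiv2 (pderiv1 \<phi>))"
  using test_functions_pderiv(1) by (simp add: distr_DD_def distr_D1_eq distr_D2_eq)

lemma compact_K: "compact K" unfolding K_def by (intro compact_Times) auto

text \<open>Let \<open>\<psi>\<close> be the double antiderivative of \<open>\<phi>\<close>. The function \<open>\<phi> - \<partial>\<^sub>2\<partial>\<^sub>1 \<psi>\<close> vanishes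
  near \<open>K\<close>, so \<open>f\<close> does not see it, and \<open>f \<phi> = f (\<partial>\<^sub>2\<partial>\<^sub>1 \<psi>)\<close> is the integral of \<open>\<psi>\<close>
  against \<open>m\<close>. Fubini turns this into the integral of \<open>\<phi>\<close> against the distribution function
  of \<open>m\<close>.\<close>

lemma M_DD0_representation:
  assumes f: "f \<in> M_DD0" and m: "finite_signed_measure m" "distr_DD f = measure_distr m"
    and K: "\<And>A. A \<in> sets borel \<Longrightarrow> A \<inter> K = {} \<Longrightarrow> m A = 0"
  shows "represents (\<lambda>x. m (quadrant x)) f"
proof -
  let ?F = "\<lambda>x. m (quadrant x)"
  note fp = finite_measure_parts[OF m(1)]
  note sp = sets_pos_part[OF m(1)] sets_neg_part[OF m(1)]
  have F: "?F x = measure (pos_part m) (quadrant x) - measure (neg_part m) (quadrant x)" for x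
    using measure_parts[OF m(1) quadrant_measurable, of x] by simp
  have f_dist: "f \<in> distributions" using f by (simp add: M_DD0_def)
  have zero: "(\<lambda>_. 0) \<in> test_functions UNIV"
    using smooth_tensor[OF smooth1_const[of 0] smooth1_const[of 0]]
    by (intro test_functionsI[of _ "{}"]) simp_all
  have meas: "?F \<in> borel_measurable borel"
    unfolding F using quadrant_integral(1)[OF fp(1) sp(1) zero] quadrant_integral(1)[OF fp(2) sp(2) zero] by simp
  obtain C where C: "\<And>A. A \<in> sets borel \<Longrightarrow> \<bar>m A\<bar> \<le> C" using signed_measure_bounded[OF m(1)] by blast
  have loc: "set_integrable lborel S ?F" if "compact S" for S
    unfolding set_integrable_def
  proof (rule Bochner_Integration.integrable_bound[of _ "\<lambda>x. indicator S x *\<^sub>R C"])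
    show "integrable lborel (\<lambda>x. indicator S x *\<^sub>R C)"
      using borel_integrable_compact[OF that continuous_on_const] .
    show "(\<lambda>x. indicator S x *\<^sub>R ?F x) \<in> borel_measurable lborel"
      using meas borel_compact[OF that] by simp
    show "AE x in lborel. norm (indicator S x *\<^sub>R ?F x) \<le> norm (indicator S x *\<^sub>R C)"
    proof (rule AE_I2)
      fix x :: plane
      have "\<bar>?F x\<bar> \<le> \<bar>C\<bar>" using C[OF quadrant_measurable, of x] by linarith
      then show "norm (indicator S x *\<^sub>R ?F x) \<le> norm (indicator S x *\<^sub>R C)"
        by (simp add: indicator_def)
    qed
  qed
  have "f \<phi> = (\<integral>x. ?F x * \<phi> x \<partial>lborel)" if \<phi>: "\<phi> \<in> test_functions UNIV" for \<phi>
  proof -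
    obtain \<psi> where \<psi>: "\<psi> \<in> test_functions UNIV"
      "\<And>x. - 2 < fst x \<Longrightarrow> - 2 < snd x \<Longrightarrow> pderiv2 (pderiv1 \<psi>) x = \<phi> x"
      "\<And>y. - 2 < fst y \<Longrightarrow> - 2 < snd y \<Longrightarrow> \<psi> y = (\<integral>x. indicator (quadrant x) y * \<phi> x \<partial>lborel)"
      using test_function_double_antiderivative[OF \<phi>] by blast
    let ?\<chi> = "pderiv2 (pderiv1 \<psi>)"
    have \<chi>: "?\<chi> \<in> test_functions UNIV" using \<psi>(1) by (intro test_functions_pderiv)
    let ?\<delta> = "\<lambda>x. 1 * \<phi> x + (- 1) * ?\<chi> x"
    have "?\<delta> \<in> test_functions (- K)"
    proof (rule test_functionsI)
      show "smooth ?\<delta>" using test_functionsD(1)[OF \<phi>] test_functionsD(1)[OF \<chi>] by (rule smooth_linear)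
      let ?U = "{x::plane. - 2 < fst x \<and> - 2 < snd x}"
      have op: "open ?U" by (intro open_Collect_conj open_Collect_less continuous_intros)
      show "compact ((supp \<phi> \<union> supp ?\<chi>) - ?U)"
        by (intro compact_diff compact_Un test_functionsD(2)[OF \<phi>] test_functionsD(2)[OF \<chi>] op)
      show "(supp \<phi> \<union> supp ?\<chi>) - ?U \<subseteq> - K" by (auto simp: K_def)
      show "?\<delta> x = 0" if "x \<notin> (supp \<phi> \<union> supp ?\<chi>) - ?U" for x
      proof (cases "x \<in> ?U")
        case True
        then show ?thesis using \<psi>(2)[of x] by simp
      next
        case False
        then show ?thesis using that test_functionsD(4)[OF \<phi>, of x] test_functionsD(4)[OF \<chi>, of x] by auto
      qed
    qed
    then have "f ?\<delta> = 0" using f by (auto simp: M_DD0_def)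
    then have "f \<phi> = f ?\<chi>" using distributions_linear[OF f_dist \<phi> \<chi>, of 1 "- 1"] by simp
    also have "\<dots> = measure_distr m \<psi>" using m(2) distr_DD_eq[OF \<psi>(1), of f] by simp
    also have "\<dots> = (\<integral>y. \<psi> y \<partial>pos_part m) - (\<integral>y. \<psi> y \<partial>neg_part m)"
      using \<psi>(1) by (simp add: measure_distr_def)
    also have "\<dots> = (\<integral>x. measure (pos_part m) (quadrant x) * \<phi> x \<partial>lborel) -
        (\<integral>x. measure (neg_part m) (quadrant x) * \<phi> x \<partial>lborel)"
    proof -
      have Kb: "- K \<in> sets borel" using borel_compact[OF compact_K] by auto
      have pK: "pos_variation m (- K) = 0"
        using pos_variation_nonneg[OF m(1), of "- K"] pos_variation_least[of "- K" m 0] K by (metis antisym disjoint_eq_subset_Compl order_refl)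
      have mK: "m (- K) = 0" using K[OF Kb] by simp
      have int: "(\<integral>y. \<psi> y \<partial>M) = (\<integral>x. measure M (quadrant x) * \<phi> x \<partial>lborel)"
        if M: "finite_measure M" "sets M = sets borel" "emeasure M (- K) = 0" for M
      proof -
        have "AE y in M. y \<notin> - K"
          by (rule AE_not_in) (use Kb M in \<open>auto simp: null_sets_def\<close>)
        then have "AE y in M. \<psi> y = (\<integral>x. indicator (quadrant x) y * \<phi> x \<partial>lborel)"
          by eventually_elim (rule \<psi>(3), auto simp: K_def)
        then have "(\<integral>y. \<psi> y \<partial>M) = (\<integral>y. (\<integral>x. indicator (quadrant x) y * \<phi> x \<partial>lborel) \<partial>M)"
        proof (rule integral_cong_AE[rotated 2])
          show "\<psi> \<in> borel_measurable M"
            using test_functions_measurable[OF \<psi>(1)] measurable_cong_sets[OF M(2) refl[of "sets borel"]] by blast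
          show "(\<lambda>y. \<integral>x. indicator (quadrant x) y * \<phi> x \<partial>lborel) \<in> borel_measurable M"
            by (rule quadrant_integral(3)[OF M(1,2) \<phi>])
        qed
        then show ?thesis using quadrant_integral(4)[OF M(1,2) \<phi>] by simp
      qed
      show ?thesis
        using int[OF fp(1) sp(1)] int[OF fp(2) sp(2)] emeasure_pos_part[OF m(1) Kb] emeasure_neg_part[OF m(1) Kb] pK mK
        by simp
    qed
    also have "\<dots> = (\<integral>x. ?F x * \<phi> x \<partial>lborel)"
      unfolding F left_diff_distrib
      using quadrant_integral(2)[OF fp(1) sp(1) \<phi>] quadrant_integral(2)[OF fp(2) sp(2) \<phi>] by simp
    finally show ?thesis .
  qed
  then show ?thesis using meas loc unfolding represents_def by blast
qed

section \<open>Pixel means and lower bounds for the norm\<close>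

definition cell_test :: "nat \<Rightarrow> nat \<Rightarrow> nat \<Rightarrow> nat \<Rightarrow> plane \<Rightarrow> real" where
  "cell_test N j k l x = cell_bump N (Suc j) k (fst x) * cell_bump N (Suc j) l (snd x)"

text \<open>The bumps are supported strictly inside their intervals. Therefore the functions that belong to
  cells outside the image have support disjoint from \<open>K\<close>, even if the cell touches \<open>K\<close>.\<close>

lemma cell_test_functions:
  "cell_test N j k l \<in> test_functions UNIV"
  "(k, l) \<notin> pixel_indices N \<Longrightarrow> cell_test N j k l \<in> test_functions (- K)"
proof -
  let ?I = "\<lambda>k. {(real k - 1 + 1 / real (Suc j)) / 2 ^ N .. (real k - 1 / real (Suc j)) / 2 ^ N}"
  have *: "cell_test N j k l \<in> test_functions U" if "?I k \<times> ?I l \<subseteq> U" for U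
    unfolding cell_test_def[abs_def]
    by (rule test_functions_tensor[OF smooth1_cell_bump smooth1_cell_bump _ _ that])
      (rule cell_bump_eq_0; simp)+
  show "cell_test N j k l \<in> test_functions UNIV" by (rule *) simp
  show "cell_test N j k l \<in> test_functions (- K)" if "(k, l) \<notin> pixel_indices N"
  proof (rule *)
    have disj: "x \<notin> {0..1}" if "x \<in> ?I k" "k \<notin> {1..2 ^ N}" for x and k :: nat
    proof -
      have p: "0 < 1 / real (Suc j)" by simp
      have x: "real k - 1 + 1 / real (Suc j) \<le> x * 2 ^ N" "x * 2 ^ N \<le> real k - 1 / real (Suc j)"
        using that(1) by (simp_all add: pos_divide_le_eq pos_le_divide_eq)
      have "k = 0 \<or> 2 ^ N + 1 \<le> k" using that(2) by auto
      then show ?thesis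
      proof
        assume "k = 0"
        then have "x * 2 ^ N < 0" using x p by linarith
        then show ?thesis by (auto simp: mult_less_0_iff)
      next
        assume "2 ^ N + 1 \<le> k"
        then have "real (2 ^ N + 1) \<le> real k" unfolding of_nat_le_iff .
        then have "2 ^ N + 1 \<le> real k" by simp
        then have "1 * 2 ^ N < x * 2 ^ N" using x p by linarith
        then show ?thesis by simp
      qed
    qed
    have "k \<notin> {1..2 ^ N} \<or> l \<notin> {1..2 ^ N}" using that by (auto simp: pixel_indices_def)
    then show "?I k \<times> ?I l \<subseteq> - K"
      unfolding K_def using disj[of _ k] disj[of _ l] by blast
  qed
qed

lemma AE_off_line:
  "AE x in (lborel :: plane measure). fst x \<noteq> a" "AE x in (lborel :: plane measure). snd x \<noteq> a"
  using AE_lborel_inner_neq[of "(1, 0) :: plane" a] AE_lborel_inner_neq[of "(0, 1) :: plane" a]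
  by (simp_all add: Basis_prod_def inner_prod_def)

lemma compact_pixel: "compact (pixel N n)"
  unfolding pixel_def by (cases n) (simp add: compact_Times)

text \<open>Dominated convergence; the boundary of a pixel is a null set. The left side does not involve \<open>g\<close>,
  so pixel integrals are determined by the distribution.\<close>

lemma pixel_integral_limit:
  assumes g: "represents g f"
  shows "(\<lambda>j. f (cell_test N j k l)) \<longlonglongrightarrow> (LINT x:pixel N (k, l)|lborel. g x)"
proof -
  let ?J = "\<lambda>k::nat. {(real k - 1) / 2 ^ N <..< real k / 2 ^ N}"
  have gm: "g \<in> borel_measurable borel" and gi: "set_integrable lborel (pixel N (k, l)) g"
    and gf: "\<And>\<phi>. \<phi> \<in> test_functions UNIV \<Longrightarrow> f \<phi> = (\<integral>x. g x * \<phi> x \<partial>lborel)"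
    using g compact_pixel unfolding represents_def by blast+
  have lim_meas: "(\<lambda>x. g x * (indicator (?J k) (fst x) * indicator (?J l) (snd x))) \<in> borel_measurable borel"
  proof -
    have "(\<lambda>x. indicator (?J k \<times> ?J l) x :: real) \<in> borel_measurable borel"
      by (intro borel_measurable_indicator borel_open open_Times) auto
    moreover have "indicator (?J k \<times> ?J l) x = (indicator (?J k) (fst x) * indicator (?J l) (snd x) :: real)" for x
      by (cases x) (simp add: indicator_times)
    ultimately show ?thesis using gm by simp
  qed
  have "(\<lambda>j. \<integral>x. g x * cell_test N j k l x \<partial>lborel) \<longlonglongrightarrow>
      (\<integral>x. g x * (indicator (?J k) (fst x) * indicator (?J l) (snd x)) \<partial>lborel)"
  proof (rule integral_dominated_convergence[where w = "\<lambda>x. norm (indicator (pixel N (k, l)) x *\<^sub>R g x)"])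
    show "(\<lambda>x. g x * (indicator (?J k) (fst x) * indicator (?J l) (snd x))) \<in> borel_measurable lborel"
      using lim_meas by simp
    show "(\<lambda>x. g x * cell_test N j k l x) \<in> borel_measurable lborel" for j
      using borel_measurable_times[OF gm test_functions_measurable[OF cell_test_functions(1)]] by simp
    show "integrable lborel (\<lambda>x. norm (indicator (pixel N (k, l)) x *\<^sub>R g x))"
      using gi unfolding set_integrable_def by (rule integrable_norm)
    show "AE x in lborel. (\<lambda>j. g x * cell_test N j k l x) \<longlonglongrightarrow>
        g x * (indicator (?J k) (fst x) * indicator (?J l) (snd x))"
    proof (rule AE_I2)
      fix x :: plane
      show "(\<lambda>j. g x * cell_test N j k l x) \<longlonglongrightarrow>
        g x * (indicator (?J k) (fst x) * indicator (?J l) (snd x))"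
        unfolding cell_test_def
        by (intro tendsto_mult tendsto_const LIMSEQ_Suc[OF cell_bump_tendsto])
    qed
    show "AE x in lborel. norm (g x * cell_test N j k l x) \<le> norm (indicator (pixel N (k, l)) x *\<^sub>R g x)" for j
    proof (rule AE_I2)
      fix x :: plane
      show "norm (g x * cell_test N j k l x) \<le> norm (indicator (pixel N (k, l)) x *\<^sub>R g x)"
      proof (cases "fst x \<in> ?J k \<and> snd x \<in> ?J l")
        case True
        then have "x \<in> pixel N (k, l)" by (cases x) (auto simp: pixel_def)
        moreover have "\<bar>g x\<bar> * \<bar>cell_test N j k l x\<bar> \<le> \<bar>g x\<bar> * 1"
          unfolding cell_test_def using cell_bump_bounds
          by (intro mult_left_mono) (auto simp: abs_mult intro!: mult_le_one)
        ultimately show ?thesis by (simp add: abs_mult)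
      next
        case False
        then have "cell_test N j k l x = 0" unfolding cell_test_def using cell_bump_eq_0_outside by auto
        then show ?thesis by simp
      qed
    qed
  qed
  moreover have "(\<integral>x. g x * (indicator (?J k) (fst x) * indicator (?J l) (snd x)) \<partial>lborel) =
      (LINT x:pixel N (k, l)|lborel. g x)"
    unfolding set_lebesgue_integral_def
  proof (rule integral_cong_AE)
    show "(\<lambda>x. g x * (indicator (?J k) (fst x) * indicator (?J l) (snd x))) \<in> borel_measurable lborel"
      using lim_meas by simp
    show "(\<lambda>x. indicator (pixel N (k, l)) x *\<^sub>R g x) \<in> borel_measurable lborel"
      using gm borel_compact[OF compact_pixel[of N "(k, l)"]]
      by (intro borel_measurable_scaleR borel_measurable_indicator) simp_all
    show "AE x in lborel. g x * (indicator (?J k) (fst x) * indicator (?J l) (snd x)) =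
        indicator (pixel N (k, l)) x *\<^sub>R g x"
      using AE_off_line(1)[of "(real k - 1) / 2 ^ N"] AE_off_line(1)[of "real k / 2 ^ N"]
        AE_off_line(2)[of "(real l - 1) / 2 ^ N"] AE_off_line(2)[of "real l / 2 ^ N"]
    proof eventually_elim
      case (elim x)
      have I: "u \<in> {a..b} \<longleftrightarrow> u \<in> {a<..<b}" if "u \<noteq> a" "u \<noteq> b" for u a b :: real
        using that by (simp add: less_le eq_commute)
      have "x \<in> pixel N (k, l) \<longleftrightarrow> fst x \<in> ?J k \<and> snd x \<in> ?J l"
        unfolding pixel_def prod.case mem_Times_iff I[OF elim(1,2)] I[OF elim(3,4)] ..
      then show ?case by (simp add: indicator_def)
    qed
  qed
  moreover have "f (cell_test N j k l) = (\<integral>x. g x * cell_test N j k l x \<partial>lborel)" for j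
    by (rule gf[OF cell_test_functions(1)])
  ultimately show ?thesis by simp
qed

lemma nu_eq:
  assumes "represents g f"
  shows "nu N f (k, l) = (LINT x:pixel N (k, l)|lborel. g x)"
proof -
  have "represents (distr_fun f) f" unfolding distr_fun_def by (rule someI[of "\<lambda>g. represents g f", OF assms])
  from LIMSEQ_unique[OF pixel_integral_limit[OF this] pixel_integral_limit[OF assms]]
  show ?thesis unfolding nu_def .
qed

text \<open>The mean value over a pixel, extended by zero to the indices next to the image so that jumps at
  the boundary need no special treatment.\<close>

definition pixel_mean :: "nat \<Rightarrow> distr \<Rightarrow> nat \<times> nat \<Rightarrow> real" where
  "pixel_mean N f n = (if n \<in> pixel_indices N then 4 ^ N * nu N f n else 0)"

lemma M_DD0_represented:
  assumes "f \<in> M_DD0"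
  obtains g where "represents g f"
proof -
  obtain m where "finite_signed_measure m" "distr_DD f = measure_distr m"
    "\<And>A. A \<in> sets borel \<Longrightarrow> A \<inter> K = {} \<Longrightarrow> m A = 0"
    using assms by (auto simp: M_DD0_def measures_on_def)
  from that[OF M_DD0_representation[OF assms this]] show thesis .
qed

lemma pixel_mean_limit:
  assumes "f \<in> M_DD0"
  shows "(\<lambda>j. 4 ^ N * f (cell_test N j k l)) \<longlonglongrightarrow> pixel_mean N f (k, l)"
proof (cases "(k, l) \<in> pixel_indices N")
  case True
  obtain g where g: "represents g f" using M_DD0_represented[OF assms] .
  show ?thesis using True tendsto_mult_left[OF pixel_integral_limit[OF g, of N k l], of "4 ^ N"]
    by (simp add: pixel_mean_def nu_eq[OF g])
next
  case False
  then have "f (cell_test N j k l) = 0" for j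
    using cell_test_functions(2)[OF False] assms by (auto simp: M_DD0_def)
  then show ?thesis using False by (simp add: pixel_mean_def)
qed

lemma pixel_mean_nonneg:
  assumes "f \<in> M_DD0_pos"
  shows "0 \<le> pixel_mean N f n"
proof (cases n)
  case (Pair k l)
  have f: "f \<in> M_DD0" and pos: "\<And>\<phi>. \<phi> \<in> test_functions UNIV \<Longrightarrow> (\<And>x. 0 \<le> \<phi> x) \<Longrightarrow> 0 \<le> f \<phi>"
    using assms by (auto simp: M_DD0_pos_def)
  have "0 \<le> f (cell_test N j k l)" for j
    by (rule pos[OF cell_test_functions(1)]) (simp add: cell_test_def cell_bump_bounds)
  then show ?thesis unfolding Pair by (intro LIMSEQ_le_const[OF pixel_mean_limit[OF f]]) auto
qed

text \<open>The jumps around the knot, across the vertical edge and across the horizontal edge with the given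
  index. The step function has value \<open>c (k, l)\<close> on the cell below and to the left of the knot
  \<open>(k / 2^N, l / 2^N)\<close>.\<close>

definition jump12 :: "(nat \<times> nat \<Rightarrow> real) \<Rightarrow> nat \<times> nat \<Rightarrow> real" where
  "jump12 c = (\<lambda>(k, l). c (k, l) - c (Suc k, l) - c (k, Suc l) + c (Suc k, Suc l))"

definition jump1 :: "(nat \<times> nat \<Rightarrow> real) \<Rightarrow> nat \<times> nat \<Rightarrow> real" where
  "jump1 c = (\<lambda>(k, l). c (Suc k, l) - c (k, l))"

definition jump2 :: "(nat \<times> nat \<Rightarrow> real) \<Rightarrow> nat \<times> nat \<Rightarrow> real" where
  "jump2 c = (\<lambda>(k, l). c (k, Suc l) - c (k, l))"

text \<open>If \<open>c\<close> vanishes outside the image, this is the value of \<^const>\<open>norm_theta\<close> on the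
  step function with values \<open>c\<close>. The factor \<open>1 / 2^N\<close> is the length of an edge.\<close>

definition step_norm :: "nat \<Rightarrow> real \<Rightarrow> (nat \<times> nat \<Rightarrow> real) \<Rightarrow> real" where
  "step_norm N \<theta> c = \<theta> * (\<Sum>n\<in>{..2 ^ N} \<times> {..2 ^ N}. \<bar>jump12 c n\<bar>) +
     (1 - \<theta>) * ((\<Sum>n\<in>{1..2 ^ N} \<times> {..2 ^ N}. \<bar>jump2 c n\<bar> / 2 ^ N) +
       (\<Sum>n\<in>{..2 ^ N} \<times> {1..2 ^ N}. \<bar>jump1 c n\<bar> / 2 ^ N))"

lemma norm_M_ge_limit:
  fixes \<phi> :: "nat \<Rightarrow> 'i \<Rightarrow> plane \<Rightarrow> real"
  assumes "finite I" "\<And>j i. i \<in> I \<Longrightarrow> \<phi> j i \<in> test_functions UNIV"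
    "\<And>j x. (\<Sum>i\<in>I. \<bar>\<phi> j i x\<bar>) \<le> 1"
    "\<And>i. i \<in> I \<Longrightarrow> (\<lambda>j. T (\<phi> j i)) \<longlonglongrightarrow> a i"
  shows "ennreal (\<Sum>i\<in>I. \<bar>a i\<bar>) \<le> norm_M T"
proof -
  have lim: "(\<lambda>j. ennreal (\<Sum>i\<in>I. \<bar>T (\<phi> j i)\<bar>)) \<longlonglongrightarrow> ennreal (\<Sum>i\<in>I. \<bar>a i\<bar>)"
    using assms(4) by (intro tendsto_ennrealI tendsto_sum tendsto_rabs)
  have le: "ennreal (\<Sum>i\<in>I. \<bar>T (\<phi> j i)\<bar>) \<le> norm_M T" for j
    using assms(1-3) by (intro sum_le_norm_M test_functions_measurable[of _ UNIV])
  show ?thesis by (rule tendsto_upperbound[OF lim]) (simp_all add: le)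
qed

text \<open>For nonnegative factors the sum of all products is the product of the two sums.\<close>

lemma norm_M_ge_tensor_limit:
  fixes u v :: "nat \<Rightarrow> nat \<Rightarrow> real \<Rightarrow> real"
  assumes fin: "finite A" "finite B"
    and tf: "\<And>j k l. (\<lambda>x. u j k (fst x) * v j l (snd x)) \<in> test_functions UNIV"
    and nonneg: "\<And>j k t. 0 \<le> u j k t" "\<And>j l t. 0 \<le> v j l t"
    and le: "\<And>j t. (\<Sum>k\<in>A. u j k t) \<le> 1" "\<And>j t. (\<Sum>l\<in>B. v j l t) \<le> 1"
    and lim: "\<And>k l. (\<lambda>j. T (\<lambda>x. u j k (fst x) * v j l (snd x))) \<longlonglongrightarrow> a (k, l)"
  shows "ennreal (\<Sum>n\<in>A \<times> B. \<bar>a n\<bar>) \<le> norm_M T"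
proof (rule norm_M_ge_limit[where \<phi> = "\<lambda>j n x. u j (fst n) (fst x) * v j (snd n) (snd x)"])
  show "(\<Sum>n\<in>A \<times> B. \<bar>u j (fst n) (fst x) * v j (snd n) (snd x)\<bar>) \<le> 1" for j x
  proof -
    have "(\<Sum>n\<in>A \<times> B. \<bar>u j (fst n) (fst x) * v j (snd n) (snd x)\<bar>) =
        (\<Sum>k\<in>A. u j k (fst x)) * (\<Sum>l\<in>B. v j l (snd x))"
      by (simp add: sum_product sum.cartesian_product case_prod_beta abs_mult nonneg)
    also have "\<dots> \<le> 1" by (intro mult_le_one sum_nonneg le nonneg)
    finally show ?thesis .
  qed
  show "(\<lambda>j. T (\<lambda>x. u j (fst n) (fst x) * v j (snd n) (snd x))) \<longlonglongrightarrow> a n" for n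
    using lim[of "fst n" "snd n"] by simp
qed (simp_all add: fin tf)

lemma hat_bump_tests:
  "(\<lambda>x. hat N j k (fst x) * hat N j l (snd x)) \<in> test_functions UNIV"
  "(\<lambda>x. hat N j k (fst x) * cell_bump N j l (snd x)) \<in> test_functions UNIV"
  "(\<lambda>x. cell_bump N j k (fst x) * hat N j l (snd x)) \<in> test_functions UNIV"
proof -
  have b: "cell_bump N j k t = 0" if "t \<notin> {(real k - 1) / 2 ^ N .. real k / 2 ^ N}" for k t
    by (rule cell_bump_eq_0_outside) (use that in auto)
  show "(\<lambda>x. hat N j k (fst x) * hat N j l (snd x)) \<in> test_functions UNIV"
    by (rule test_functions_tensor[OF smooth1_hat smooth1_hat hat_eq_0 hat_eq_0 subset_UNIV])
  show "(\<lambda>x. hat N j k (fst x) * cell_bump N j l (snd x)) \<in> test_functions UNIV"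
    by (rule test_functions_tensor[OF smooth1_hat smooth1_cell_bump hat_eq_0 b subset_UNIV])
  show "(\<lambda>x. cell_bump N j k (fst x) * hat N j l (snd x)) \<in> test_functions UNIV"
    by (rule test_functions_tensor[OF smooth1_cell_bump smooth1_hat b hat_eq_0 subset_UNIV])
qed

lemma four_power: "(4::real) ^ N = 2 ^ N * 2 ^ N"
  by (simp add: power_mult_distrib[symmetric])

text \<open>The mixed derivative of a product of two hats is a combination of four products of bumps.\<close>

lemma norm_DD_ge:
  assumes f: "f \<in> M_DD0"
  shows "ennreal (\<Sum>n\<in>{..2 ^ N} \<times> {..2 ^ N}. \<bar>jump12 (pixel_mean N f) n\<bar>) \<le> norm_M (distr_DD f)"
proof (rule norm_M_ge_tensor_limit[where u = "\<lambda>j. hat N (Suc j)" and v = "\<lambda>j. hat N (Suc j)"])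
  have fd: "f \<in> distributions" using f by (simp add: M_DD0_def)
  note ct = cell_test_functions(1)
  fix k l
  have "distr_DD f (\<lambda>x. hat N (Suc j) k (fst x) * hat N (Suc j) l (snd x)) =
      4 ^ N * f (cell_test N j k l) - 4 ^ N * f (cell_test N j (Suc k) l)
      - 4 ^ N * f (cell_test N j k (Suc l)) + 4 ^ N * f (cell_test N j (Suc k) (Suc l))" for j
  proof -
    let ?b = "cell_bump N (Suc j)"
    let ?d = "\<lambda>k x. 2 ^ N * ?b k x + (- (2 ^ N)) * ?b (Suc k) x"
    have sd: "smooth1 (?d k)" for k by (intro smooth1_linear smooth1_cell_bump)
    have "distr_DD f (\<lambda>x. hat N (Suc j) k (fst x) * hat N (Suc j) l (snd x)) =
        f (\<lambda>x. ?d k (fst x) * ?d l (snd x))"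
      unfolding distr_DD_eq[OF hat_bump_tests(1)] pderiv1_tensor[OF smooth1_hat smooth1_hat hat_deriv]
        pderiv2_tensor[OF sd smooth1_hat hat_deriv] ..
    also have "(\<lambda>x. ?d k (fst x) * ?d l (snd x)) =
        (\<lambda>x. 1 * (4 ^ N * cell_test N j k l x + (- (4 ^ N)) * cell_test N j (Suc k) l x) +
          1 * ((- (4 ^ N)) * cell_test N j k (Suc l) x + 4 ^ N * cell_test N j (Suc k) (Suc l) x))"
      unfolding four_power cell_test_def by (simp add: fun_eq_iff algebra_simps)
    finally show ?thesis
      unfolding distributions_linear[OF fd test_functions_linear[OF ct ct] test_functions_linear[OF ct ct]]
        distributions_linear[OF fd ct ct] by simp
  qed
  then show "(\<lambda>j. distr_DD f (\<lambda>x. hat N (Suc j) k (fst x) * hat N (Suc j) l (snd x)))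
      \<longlonglongrightarrow> jump12 (pixel_mean N f) (k, l)"
    unfolding jump12_def prod.case by (simp only:) (intro tendsto_add tendsto_diff pixel_mean_limit[OF f])
qed (simp_all add: hat_bump_tests hat_nonneg sum_hat_le_1)

text \<open>A hat in the first variable, to be differentiated, times a bump in the second one.\<close>

lemma norm_D1_ge:
  assumes f: "f \<in> M_DD0"
  shows "ennreal (\<Sum>n\<in>{..2 ^ N} \<times> {1..2 ^ N}. \<bar>jump1 (pixel_mean N f) n / 2 ^ N\<bar>) \<le> norm_M (distr_D1 f)"
proof (rule norm_M_ge_tensor_limit[where u = "\<lambda>j. hat N (Suc j)" and v = "\<lambda>j. cell_bump N (Suc j)"])
  have fd: "f \<in> distributions" using f by (simp add: M_DD0_def)
  fix k l
  have "distr_D1 f (\<lambda>x. hat N (Suc j) k (fst x) * cell_bump N (Suc j) l (snd x)) =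
      (4 ^ N * f (cell_test N j (Suc k) l) - 4 ^ N * f (cell_test N j k l)) / 2 ^ N" for j
  proof -
    let ?b = "cell_bump N (Suc j)"
    have "pderiv1 (\<lambda>x. hat N (Suc j) k (fst x) * ?b l (snd x)) =
        (\<lambda>x. 2 ^ N * cell_test N j k l x + (- (2 ^ N)) * cell_test N j (Suc k) l x)"
      unfolding pderiv1_tensor[OF smooth1_hat smooth1_cell_bump hat_deriv]
      by (simp add: fun_eq_iff cell_test_def algebra_simps)
    then have "distr_D1 f (\<lambda>x. hat N (Suc j) k (fst x) * ?b l (snd x)) =
        - (2 ^ N * f (cell_test N j k l) + (- (2 ^ N)) * f (cell_test N j (Suc k) l))"
      unfolding distr_D1_eq[OF hat_bump_tests(2)]
      by (simp only: distributions_linear[OF fd cell_test_functions(1) cell_test_functions(1)])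
    then show ?thesis unfolding four_power by (simp only:) (simp add: field_simps)
  qed
  then show "(\<lambda>j. distr_D1 f (\<lambda>x. hat N (Suc j) k (fst x) * cell_bump N (Suc j) l (snd x)))
      \<longlonglongrightarrow> jump1 (pixel_mean N f) (k, l) / 2 ^ N"
    unfolding jump1_def prod.case
    by (simp only:) (intro tendsto_divide tendsto_diff pixel_mean_limit[OF f] tendsto_const, simp)
qed (simp_all add: hat_bump_tests hat_nonneg sum_hat_le_1 cell_bump_bounds sum_cell_bump_le_1)

lemma norm_D2_ge:
  assumes f: "f \<in> M_DD0"
  shows "ennreal (\<Sum>n\<in>{1..2 ^ N} \<times> {..2 ^ N}. \<bar>jump2 (pixel_mean N f) n / 2 ^ N\<bar>) \<le> norm_M (distr_D2 f)"
proof (rule norm_M_ge_tensor_limit[where u = "\<lambda>j. cell_bump N (Suc j)" and v = "\<lambda>j. hat N (Suc j)"])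
  have fd: "f \<in> distributions" using f by (simp add: M_DD0_def)
  fix k l
  have "distr_D2 f (\<lambda>x. cell_bump N (Suc j) k (fst x) * hat N (Suc j) l (snd x)) =
      (4 ^ N * f (cell_test N j k (Suc l)) - 4 ^ N * f (cell_test N j k l)) / 2 ^ N" for j
  proof -
    let ?b = "cell_bump N (Suc j)"
    have "pderiv2 (\<lambda>x. ?b k (fst x) * hat N (Suc j) l (snd x)) =
        (\<lambda>x. 2 ^ N * cell_test N j k l x + (- (2 ^ N)) * cell_test N j k (Suc l) x)"
      unfolding pderiv2_tensor[OF smooth1_cell_bump smooth1_hat hat_deriv]
      by (simp add: fun_eq_iff cell_test_def algebra_simps)
    then have "distr_D2 f (\<lambda>x. ?b k (fst x) * hat N (Suc j) l (snd x)) =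
        - (2 ^ N * f (cell_test N j k l) + (- (2 ^ N)) * f (cell_test N j k (Suc l)))"
      unfolding distr_D2_eq[OF hat_bump_tests(3)]
      by (simp only: distributions_linear[OF fd cell_test_functions(1) cell_test_functions(1)])
    then show ?thesis unfolding four_power by (simp only:) (simp add: field_simps)
  qed
  then show "(\<lambda>j. distr_D2 f (\<lambda>x. cell_bump N (Suc j) k (fst x) * hat N (Suc j) l (snd x)))
      \<longlonglongrightarrow> jump2 (pixel_mean N f) (k, l) / 2 ^ N"
    unfolding jump2_def prod.case
    by (simp only:) (intro tendsto_divide tendsto_diff pixel_mean_limit[OF f] tendsto_const, simp)
qed (simp_all add: hat_bump_tests hat_nonneg sum_hat_le_1 cell_bump_bounds sum_cell_bump_le_1)

lemma ennreal_step_norm: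
  assumes "0 \<le> \<theta>" "\<theta> \<le> 1"
  shows "ennreal (step_norm N \<theta> c) = ennreal \<theta> * ennreal (\<Sum>n\<in>{..2 ^ N} \<times> {..2 ^ N}. \<bar>jump12 c n\<bar>) +
    ennreal (1 - \<theta>) * (ennreal (\<Sum>n\<in>{1..2 ^ N} \<times> {..2 ^ N}. \<bar>jump2 c n\<bar> / 2 ^ N) +
      ennreal (\<Sum>n\<in>{..2 ^ N} \<times> {1..2 ^ N}. \<bar>jump1 c n\<bar> / 2 ^ N))"
  unfolding step_norm_def using assms
  by (simp add: ennreal_plus ennreal_mult sum_nonneg del: ennreal_plus[symmetric] sum_ennreal)

lemma norm_theta_ge:
  assumes "f \<in> M_DD0" "0 \<le> \<theta>" "\<theta> \<le> 1"
  shows "ennreal (step_norm N \<theta> (pixel_mean N f)) \<le> norm_theta \<theta> f"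
  unfolding ennreal_step_norm[OF assms(2,3)] norm_theta_def norm_grad_def
  using norm_DD_ge norm_D1_ge norm_D2_ge assms(1) by (intro add_mono mult_left_mono) auto

section \<open>Step functions on pixels\<close>

definition cell_ivl :: "nat \<Rightarrow> nat \<Rightarrow> real set" where
  "cell_ivl N k = {(real k - 1) / 2 ^ N ..< real k / 2 ^ N}"

text \<open>Half-open pixels are disjoint, and distribution functions of measures on the grid are constant on
  them.\<close>

definition half_cell :: "nat \<Rightarrow> nat \<times> nat \<Rightarrow> plane set" where
  "half_cell N n = cell_ivl N (fst n) \<times> cell_ivl N (snd n)"

definition step_fun :: "nat \<Rightarrow> (nat \<times> nat \<Rightarrow> real) \<Rightarrow> plane \<Rightarrow> real" where
  "step_fun N c x = (\<Sum>n\<in>pixel_indices N. c n * indicator (half_cell N n) x)"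

definition step_distr :: "nat \<Rightarrow> (nat \<times> nat \<Rightarrow> real) \<Rightarrow> distr" where
  "step_distr N c = (\<lambda>\<phi>\<in>test_functions UNIV. \<integral>x. step_fun N c x * \<phi> x \<partial>lborel)"

lemma cell_ivl_measurable [measurable]: "cell_ivl N k \<in> sets borel"
  by (simp add: cell_ivl_def)

lemma half_cell_measurable: "half_cell N n \<in> sets borel"
proof -
  have "half_cell N n \<in> sets (borel \<Otimes>\<^sub>M borel)"
    unfolding half_cell_def by (intro pair_measureI cell_ivl_measurable)
  then show ?thesis by (simp only: borel_prod)
qed

lemma finite_pixel_indices: "finite (pixel_indices N)"
  by (simp add: pixel_indices_def)

lemma cell_ivl_disjoint: "x \<in> cell_ivl N k \<Longrightarrow> x \<in> cell_ivl N l \<Longrightarrow> k = l"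
proof -
  assume "x \<in> cell_ivl N k" "x \<in> cell_ivl N l"
  then have "real k - 1 \<le> x * 2 ^ N" "x * 2 ^ N < real k" "real l - 1 \<le> x * 2 ^ N" "x * 2 ^ N < real l"
    by (simp_all add: cell_ivl_def pos_divide_le_eq pos_less_divide_eq)
  then have "real k < real l + 1" "real l < real k + 1" by linarith+
  then show "k = l" by linarith
qed

lemma step_fun_eq:
  assumes "n \<in> pixel_indices N" "x \<in> half_cell N n"
  shows "step_fun N c x = c n"
proof -
  have "x \<notin> half_cell N n'" if "n' \<noteq> n" for n'
    using assms(2) that cell_ivl_disjoint unfolding half_cell_def mem_Times_iff by (metis prod_eqI)
  then have "step_fun N c x = (\<Sum>n'\<in>{n}. c n' * indicator (half_cell N n') x)"
    unfolding step_fun_def using assms(1) finite_pixel_indices by (intro sum.mono_neutral_right) auto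
  then show ?thesis using assms(2) by simp
qed

lemma step_fun_eq_0:
  assumes "\<And>n. n \<in> pixel_indices N \<Longrightarrow> x \<notin> half_cell N n"
  shows "step_fun N c x = 0"
  unfolding step_fun_def using assms by (intro sum.neutral) auto

lemma half_cell_subset_K:
  assumes "n \<in> pixel_indices N" "x \<in> half_cell N n"
  shows "0 \<le> fst x" "fst x < 1" "0 \<le> snd x" "snd x < 1"
proof -
  have *: "0 \<le> t \<and> t < 1" if "t \<in> cell_ivl N k" "1 \<le> k" "k \<le> 2 ^ N" for t k
  proof -
    have "real k \<le> 2 ^ N" using of_nat_mono[OF that(3), where 'a = real] by simp
    moreover have "real k - 1 \<le> t * 2 ^ N" "t * 2 ^ N < real k"
      using that(1) by (simp_all add: cell_ivl_def pos_divide_le_eq pos_less_divide_eq)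
    ultimately have "0 \<le> t * 2 ^ N" "t * 2 ^ N < 1 * 2 ^ N" using that(2) by linarith+
    then show ?thesis using mult_neg_pos[of t "2 ^ N"] by fastforce
  qed
  show "0 \<le> fst x" "fst x < 1" "0 \<le> snd x" "snd x < 1"
    using assms *[of "fst x" "fst n"] *[of "snd x" "snd n"]
    by (auto simp: half_cell_def pixel_indices_def mem_Times_iff)
qed

lemma emeasure_cell_ivl: "emeasure lborel (cell_ivl N k) = ennreal (1 / 2 ^ N)"
  unfolding cell_ivl_def by (subst emeasure_lborel_Ico) (simp_all add: divide_right_mono diff_divide_distrib[symmetric])

lemma emeasure_half_cell: "emeasure lborel (half_cell N n) = ennreal (1 / 4 ^ N)"
proof -
  have "emeasure (lborel \<Otimes>\<^sub>M lborel) (cell_ivl N (fst n) \<times> cell_ivl N (snd n)) = ennreal (1 / 2 ^ N) * ennreal (1 / 2 ^ N)"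
    by (subst lborel.emeasure_pair_measure_Times) (simp_all add: emeasure_cell_ivl)
  also have "\<dots> = ennreal (1 / 4 ^ N)"
    by (simp add: ennreal_mult[symmetric] power_mult_distrib[symmetric])
  finally show ?thesis by (simp add: half_cell_def lborel_plane)
qed

lemma measure_half_cell: "measure lborel (half_cell N n) = 1 / 4 ^ N"
  by (simp add: measure_def emeasure_half_cell)

lemma step_fun_measurable: "step_fun N c \<in> borel_measurable borel"
  unfolding step_fun_def[abs_def]
  by (intro borel_measurable_sum borel_measurable_times borel_measurable_const borel_measurable_indicator half_cell_measurable)

lemma integrable_step_fun: "integrable lborel (step_fun N c)"
  unfolding step_fun_def[abs_def]
  by (intro Bochner_Integration.integrable_sum integrable_mult_right)
    (simp add: half_cell_measurable emeasure_half_cell)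

lemma represents_step_fun: "represents (step_fun N c) (step_distr N c)"
  unfolding represents_def
proof (intro conjI allI impI ballI)
  show "set_integrable lborel C (step_fun N c)" if "compact C" for C
    unfolding set_integrable_def using borel_compact[OF that]
    by (intro integrable_mult_indicator integrable_step_fun) simp
qed (simp_all add: step_fun_measurable step_distr_def)

text \<open>A closed pixel and a half-open one differ by a null set.\<close>

lemma pixel_integral_const:
  fixes g :: "plane \<Rightarrow> real"
  assumes g: "g \<in> borel_measurable borel" "\<And>x. x \<in> half_cell N n \<Longrightarrow> g x = v"
  shows "(LINT x:pixel N n|lborel. g x) = v / 4 ^ N"
proof -
  obtain k l where n: "n = (k, l)" by (cases n)
  have "(LINT x:pixel N n|lborel. g x) = (\<integral>x. v * indicator (half_cell N n) x \<partial>lborel)"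
    unfolding set_lebesgue_integral_def
  proof (rule integral_cong_AE)
    show "(\<lambda>x. indicator (pixel N n) x *\<^sub>R g x) \<in> borel_measurable lborel"
      using g(1) borel_compact[OF compact_pixel[of N n]]
      by (intro borel_measurable_scaleR borel_measurable_indicator) simp_all
    show "(\<lambda>x. v * indicator (half_cell N n) x) \<in> borel_measurable lborel"
      by (intro borel_measurable_times borel_measurable_const borel_measurable_indicator)
        (simp add: half_cell_measurable)
    show "AE x in lborel. indicator (pixel N n) x *\<^sub>R g x = v * indicator (half_cell N n) x"
      using AE_off_line(1)[of "real k / 2 ^ N"] AE_off_line(2)[of "real l / 2 ^ N"]
    proof eventually_elim
      case (elim x)
      have I: "u \<in> {a..b} \<longleftrightarrow> u \<in> {a..<b}" if "u \<noteq> b" for u a b :: real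
        using that by (simp add: less_le)
      have "x \<in> pixel N n \<longleftrightarrow> x \<in> half_cell N n"
        unfolding n pixel_def half_cell_def cell_ivl_def prod.case mem_Times_iff I[OF elim(1)] I[OF elim(2)] by simp
      then show ?case using g(2)[of x] by (simp add: indicator_def)
    qed
  qed
  also have "\<dots> = v / 4 ^ N"
    using half_cell_measurable[of N n] emeasure_half_cell[of N n] by (simp add: measure_half_cell)
  finally show ?thesis .
qed

lemma pixel_mean_step_distr:
  assumes "\<And>n. n \<notin> pixel_indices N \<Longrightarrow> c n = 0"
  shows "pixel_mean N (step_distr N c) = c"
proof
  fix n
  show "pixel_mean N (step_distr N c) n = c n"
  proof (cases "n \<in> pixel_indices N")
    case True
    obtain k l where n: "n = (k, l)" by (cases n)
    have "nu N (step_distr N c) n = c n / 4 ^ N"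
      unfolding n nu_eq[OF represents_step_fun]
      by (rule pixel_integral_const[OF step_fun_measurable step_fun_eq]) (use True n in auto)
    then show ?thesis using True by (simp add: pixel_mean_def)
  next
    case False
    then show ?thesis using assms by (simp add: pixel_mean_def)
  qed
qed

lemma step_distr_sum:
  assumes \<phi>: "\<phi> \<in> test_functions UNIV"
  shows "step_distr N c \<phi> = (\<Sum>n\<in>pixel_indices N. c n * (\<integral>x. indicator (half_cell N n) x * \<phi> x \<partial>lborel))"
proof -
  have int: "integrable lborel (\<lambda>x. indicator (half_cell N n) x * \<phi> x)" for n
    using integrable_mult_indicator[OF _ test_function_integrable[OF \<phi>], of "half_cell N n"] half_cell_measurable
    by simp
  have "step_distr N c \<phi> = (\<integral>x. (\<Sum>n\<in>pixel_indices N. c n * (indicator (half_cell N n) x * \<phi> x)) \<partial>lborel)"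
    using \<phi> by (simp add: step_distr_def step_fun_def sum_distrib_right mult.assoc)
  also have "\<dots> = (\<Sum>n\<in>pixel_indices N. c n * (\<integral>x. indicator (half_cell N n) x * \<phi> x \<partial>lborel))"
    using int by (subst Bochner_Integration.integral_sum) auto
  finally show ?thesis .
qed

text \<open>The step function is integrable, so that continuity holds with the seminorm of order zero.\<close>

lemma step_distr_in_distributions: "step_distr N c \<in> distributions"
  unfolding distributions_def
proof (intro CollectI conjI ballI allI impI)
  show "step_distr N c \<in> extensional (test_functions UNIV)"
    unfolding step_distr_def by (rule restrict_extensional)
  have int: "integrable lborel (\<lambda>x. step_fun N c x * \<phi> x)" if \<phi>: "\<phi> \<in> test_functions UNIV" for \<phi>
  proof -
    obtain C where C: "\<And>x. \<bar>\<phi> x\<bar> \<le> C" using test_functions_bounded[OF \<phi>] by blast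
    show ?thesis
    proof (rule Bochner_Integration.integrable_bound[OF integrable_mult_right[OF integrable_norm[OF integrable_step_fun[of N c]], of C]])
      show "(\<lambda>x. step_fun N c x * \<phi> x) \<in> borel_measurable lborel"
        using borel_measurable_times[OF step_fun_measurable test_functions_measurable[OF \<phi>]] by simp
      show "AE x in lborel. norm (step_fun N c x * \<phi> x) \<le> norm (C * norm (step_fun N c x))"
      proof (rule AE_I2)
        fix x
        have "\<bar>step_fun N c x\<bar> * \<bar>\<phi> x\<bar> \<le> \<bar>step_fun N c x\<bar> * \<bar>C\<bar>"
          using C[of x] by (intro mult_left_mono) linarith+
        then show "norm (step_fun N c x * \<phi> x) \<le> norm (C * norm (step_fun N c x))"
          by (simp add: abs_mult mult.commute)
      qed
    qed
  qed
  show "step_distr N c (\<lambda>x. a * \<phi> x + b * \<psi> x) = a * step_distr N c \<phi> + b * step_distr N c \<psi>"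
    if "\<phi> \<in> test_functions UNIV" "\<psi> \<in> test_functions UNIV" for \<phi> \<psi> a b
  proof -
    have "(\<integral>x. step_fun N c x * (a * \<phi> x + b * \<psi> x) \<partial>lborel) =
        (\<integral>x. a * (step_fun N c x * \<phi> x) + b * (step_fun N c x * \<psi> x) \<partial>lborel)"
      by (simp add: algebra_simps)
    also have "\<dots> = a * (\<integral>x. step_fun N c x * \<phi> x \<partial>lborel) + b * (\<integral>x. step_fun N c x * \<psi> x \<partial>lborel)"
      using int[OF that(1)] int[OF that(2)] by simp
    finally show ?thesis using that test_functions_linear[OF that] by (simp add: step_distr_def)
  qed
  fix C :: "plane set" assume "compact C"
  show "\<exists>d p. \<forall>\<phi>\<in>test_functions UNIV. supp \<phi> \<subseteq> C \<longrightarrow> \<bar>step_distr N c \<phi>\<bar> \<le> d * test_seminorm p \<phi>"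
  proof (intro exI ballI impI)
    fix \<phi> assume \<phi>: "\<phi> \<in> test_functions UNIV"
    obtain B where B: "\<And>x. \<bar>\<phi> x\<bar> \<le> B" using test_functions_bounded[OF \<phi>] by blast
    let ?S = "SUP x. \<bar>\<phi> x\<bar>"
    have S: "\<bar>\<phi> x\<bar> \<le> ?S" for x by (rule cSUP_upper[OF UNIV_I bdd_aboveI2[of _ _ B]]) (rule B)
    have "{(i, j). i + j \<le> 0} = {(0::nat, 0::nat)}" by auto
    then have "test_seminorm 0 \<phi> = ?S" by (simp add: test_seminorm_def)
    moreover have "\<bar>\<integral>x. step_fun N c x * \<phi> x \<partial>lborel\<bar> \<le> (\<integral>x. \<bar>step_fun N c x\<bar> * ?S \<partial>lborel)"
    proof (rule order_trans[OF integral_abs_bound integral_mono])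
      show "integrable lborel (\<lambda>x. \<bar>step_fun N c x * \<phi> x\<bar>)" using int[OF \<phi>] by simp
      show "integrable lborel (\<lambda>x. \<bar>step_fun N c x\<bar> * ?S)" using integrable_step_fun by simp
      show "\<bar>step_fun N c x * \<phi> x\<bar> \<le> \<bar>step_fun N c x\<bar> * ?S" for x
        using S[of x] by (simp add: abs_mult mult_left_mono)
    qed
    ultimately show "\<bar>step_distr N c \<phi>\<bar> \<le> (\<integral>x. \<bar>step_fun N c x\<bar> \<partial>lborel) * test_seminorm 0 \<phi>"
      using \<phi> by (simp add: step_distr_def)
  qed
qed

lemma integrable_cell_times:
  fixes u :: "real \<Rightarrow> real"
  assumes "continuous_on UNIV u"
  shows "integrable lborel (\<lambda>t. indicator (cell_ivl N k) t * u t)"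
proof -
  have "set_integrable lborel {(real k - 1) / 2 ^ N .. real k / 2 ^ N} u"
    by (rule borel_integrable_atLeastAtMost'[OF continuous_on_subset[OF assms]]) simp
  then have "set_integrable lborel (cell_ivl N k) u"
    by (rule set_integrable_subset) (auto simp: cell_ivl_def)
  then show ?thesis by (simp add: set_integrable_def)
qed

lemma integral_cell_derivative:
  assumes "\<And>x. (U has_real_derivative u x) (at x)" "continuous_on UNIV u"
  shows "(\<integral>t. indicator (cell_ivl N (Suc k)) t * u t \<partial>lborel) = U (real (Suc k) / 2 ^ N) - U (real k / 2 ^ N)"
proof -
  let ?a = "real k / 2 ^ N" and ?b = "real (Suc k) / 2 ^ N"
  have um: "u \<in> borel_measurable borel" using assms(2) by (rule borel_measurable_continuous_onI)
  have "(\<integral>t. indicator (cell_ivl N (Suc k)) t * u t \<partial>lborel) = (\<integral>t. indicator {?a..?b} t *\<^sub>R u t \<partial>lborel)"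
  proof (rule integral_cong_AE)
    show "AE t in lborel. indicator (cell_ivl N (Suc k)) t * u t = indicator {?a..?b} t *\<^sub>R u t"
      using AE_lborel_singleton[of ?b]
      by eventually_elim (auto simp: cell_ivl_def indicator_def)
  qed (use um in \<open>auto intro!: borel_measurable_times borel_measurable_indicator\<close>)
  also have "\<dots> = U ?b - U ?a"
  proof (rule integral_FTC_atLeastAtMost)
    show "?a \<le> ?b" by (simp add: divide_right_mono)
    show "(U has_vector_derivative u x) (at x within {?a..?b})" for x
      unfolding has_real_derivative_iff_has_vector_derivative[symmetric]
      by (rule DERIV_subset[OF assms(1)]) simp
    show "continuous_on {?a..?b} u" using assms(2) continuous_on_subset by blast
  qed
  finally show ?thesis .
qed

lemma integral_half_cell:
  assumes \<phi>: "\<phi> \<in> test_functions UNIV"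
  shows "(\<integral>x. indicator (half_cell N (k, l)) x * \<phi> x \<partial>lborel) =
      (\<integral>t. indicator (cell_ivl N k) t * (\<integral>s. indicator (cell_ivl N l) s * \<phi> (t, s) \<partial>lborel) \<partial>lborel)"
    and "(\<integral>x. indicator (half_cell N (k, l)) x * \<phi> x \<partial>lborel) =
      (\<integral>s. indicator (cell_ivl N l) s * (\<integral>t. indicator (cell_ivl N k) t * \<phi> (t, s) \<partial>lborel) \<partial>lborel)"
proof -
  define f where "f t s = indicator (cell_ivl N k) t * (indicator (cell_ivl N l) s * \<phi> (t, s))" for t s
  have f_eq: "case_prod f = (\<lambda>x. indicator (half_cell N (k, l)) x * \<phi> x)"
    by (auto simp: fun_eq_iff f_def half_cell_def indicator_times)
  have "integrable lborel (\<lambda>x. indicator (half_cell N (k, l)) x *\<^sub>R \<phi> x)"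
    by (rule integrable_mult_indicator[OF _ test_function_integrable[OF \<phi>]]) (simp add: half_cell_measurable)
  then have int: "integrable (lborel \<Otimes>\<^sub>M lborel) (case_prod f)"
    unfolding lborel_plane f_eq by simp
  have "(\<integral>x. indicator (half_cell N (k, l)) x * \<phi> x \<partial>lborel) = (\<integral>t. \<integral>s. f t s \<partial>lborel \<partial>lborel)"
    using lborel_pair.integral_fst[OF int] unfolding lborel_plane f_eq by simp
  then show "(\<integral>x. indicator (half_cell N (k, l)) x * \<phi> x \<partial>lborel) =
      (\<integral>t. indicator (cell_ivl N k) t * (\<integral>s. indicator (cell_ivl N l) s * \<phi> (t, s) \<partial>lborel) \<partial>lborel)"
    by (simp add: f_def)
  have "(\<integral>x. indicator (half_cell N (k, l)) x * \<phi> x \<partial>lborel) = (\<integral>s. \<integral>t. f t s \<partial>lborel \<partial>lborel)"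
    using lborel_pair.integral_snd[OF int] unfolding lborel_plane f_eq by simp
  also have "\<dots> = (\<integral>s. \<integral>t. indicator (cell_ivl N l) s * (indicator (cell_ivl N k) t * \<phi> (t, s)) \<partial>lborel \<partial>lborel)"
    by (simp add: f_def mult.left_commute)
  finally show "(\<integral>x. indicator (half_cell N (k, l)) x * \<phi> x \<partial>lborel) =
      (\<integral>s. indicator (cell_ivl N l) s * (\<integral>t. indicator (cell_ivl N k) t * \<phi> (t, s) \<partial>lborel) \<partial>lborel)"
    by simp
qed

section \<open>Derivatives of step functions and upper bounds for the norm\<close>

lemma summation_by_parts:
  fixes c p :: "nat \<Rightarrow> real"
  shows "(\<Sum>k\<in>{1..n}. c k * (p k - p (k - 1))) = (\<Sum>k\<le>n. (c k - c (Suc k)) * p k) + c (Suc n) * p n - c 0 * p 0"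
proof (induction n)
  case 0
  show ?case by (simp add: algebra_simps)
next
  case (Suc n)
  have "(\<Sum>k\<in>{1..Suc n}. c k * (p k - p (k - 1))) = (\<Sum>k\<in>{1..n}. c k * (p k - p (k - 1))) + c (Suc n) * (p (Suc n) - p n)"
    by (simp add: atLeastAtMostSuc_conv add.commute)
  then show ?case unfolding Suc by (simp add: algebra_simps)
qed

lemma summation_by_parts_0:
  fixes c p :: "nat \<Rightarrow> real"
  assumes "c 0 = 0" "c (Suc n) = 0"
  shows "(\<Sum>k\<in>{1..n}. c k * (p k - p (k - 1))) = (\<Sum>k\<le>n. (c k - c (Suc k)) * p k)"
  using summation_by_parts[of c p n] assms by simp

text \<open>The Lebesgue measure on a pixel interval, carried to an edge of the grid by \<open>g\<close>.\<close>

definition line_measure :: "(real \<Rightarrow> plane) \<Rightarrow> nat \<Rightarrow> nat \<Rightarrow> plane measure" where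
  "line_measure g N k = distr (density lborel (\<lambda>s. ennreal (indicator (cell_ivl N k) s))) borel g"

lemma line_measure:
  fixes \<phi> :: "plane \<Rightarrow> real"
  assumes "continuous_on UNIV g"
  shows "sets (line_measure g N k) = sets borel" "finite_measure (line_measure g N k)"
    "measure (line_measure g N k) UNIV = 1 / 2 ^ N"
    "\<phi> \<in> borel_measurable borel \<Longrightarrow>
      (\<integral>x. \<phi> x \<partial>line_measure g N k) = (\<integral>s. indicator (cell_ivl N k) s * \<phi> (g s) \<partial>lborel)"
proof -
  have gm: "g \<in> borel_measurable borel" using assms by (rule borel_measurable_continuous_onI)
  let ?D = "density lborel (\<lambda>s. ennreal (indicator (cell_ivl N k) s))"
  have im: "(\<lambda>s. indicator (cell_ivl N k) s :: real) \<in> borel_measurable lborel" by simp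
  have gD: "g \<in> ?D \<rightarrow>\<^sub>M borel" using gm by simp
  show "sets (line_measure g N k) = sets borel" by (simp add: line_measure_def)
  have em: "emeasure (line_measure g N k) UNIV = ennreal (1 / 2 ^ N)"
    unfolding line_measure_def using gD emeasure_cell_ivl[of N k]
    by (simp add: emeasure_distr emeasure_density ennreal_indicator)
  show "finite_measure (line_measure g N k)"
    by (rule finite_measureI) (use em in \<open>simp add: line_measure_def\<close>)
  show "measure (line_measure g N k) UNIV = 1 / 2 ^ N" using em by (simp add: measure_def)
  assume \<phi>: "\<phi> \<in> borel_measurable borel"
  have "(\<integral>x. \<phi> x \<partial>line_measure g N k) = (\<integral>s. \<phi> (g s) \<partial>?D)"
    unfolding line_measure_def by (rule integral_distr[OF gD \<phi>])
  also have "\<dots> = (\<integral>s. indicator (cell_ivl N k) s *\<^sub>R \<phi> (g s) \<partial>lborel)"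
    by (rule integral_density) (use im measurable_compose[OF gm \<phi>] in auto)
  finally show "(\<integral>x. \<phi> x \<partial>line_measure g N k) = (\<integral>s. indicator (cell_ivl N k) s * \<phi> (g s) \<partial>lborel)" by simp
qed

definition point_mass :: "plane \<Rightarrow> plane measure" where
  "point_mass x = distr (count_space {()}) borel (\<lambda>_. x)"

lemma point_mass:
  fixes \<phi> :: "plane \<Rightarrow> real"
  shows "sets (point_mass x) = sets borel" "finite_measure (point_mass x)"
    "measure (point_mass x) UNIV = 1"
    "A \<in> sets borel \<Longrightarrow> x \<notin> A \<Longrightarrow> measure (point_mass x) A = 0"
    "\<phi> \<in> borel_measurable borel \<Longrightarrow> (\<integral>z. \<phi> z \<partial>point_mass x) = \<phi> x"
proof -
  have m: "(\<lambda>_. x) \<in> count_space {()} \<rightarrow>\<^sub>M borel" by simp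
  have em: "emeasure (point_mass x) A = of_nat (card ((\<lambda>_. x) -` A \<inter> {()}))" if "A \<in> sets borel" for A
    unfolding point_mass_def using that by (simp add: emeasure_distr[OF m])
  have em1: "emeasure (point_mass x) UNIV = 1" using em[of UNIV] by simp
  show "sets (point_mass x) = sets borel" by (simp add: point_mass_def)
  show "finite_measure (point_mass x)"
    by (rule finite_measureI) (use em1 in \<open>simp add: point_mass_def\<close>)
  show "measure (point_mass x) UNIV = 1" using em1 by (simp add: measure_def)
  show "measure (point_mass x) A = 0" if "A \<in> sets borel" "x \<notin> A"
    using em[OF that(1)] that(2) by (simp add: measure_def)
  show "(\<integral>z. \<phi> z \<partial>point_mass x) = \<phi> x" if "\<phi> \<in> borel_measurable borel"
    unfolding point_mass_def by (simp add: integral_distr[OF m that] lebesgue_integral_count_space_finite)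
qed

lemma combination_distr:
  fixes M :: "'i \<Rightarrow> plane measure" and a :: "'i \<Rightarrow> real"
  assumes I: "finite I" and M: "\<And>i. i \<in> I \<Longrightarrow> finite_measure (M i)" "\<And>i. i \<in> I \<Longrightarrow> sets (M i) = sets borel"
    and T: "T \<in> extensional (test_functions UNIV)"
      "\<And>\<phi>. \<phi> \<in> test_functions UNIV \<Longrightarrow> T \<phi> = (\<Sum>i\<in>I. a i * (\<integral>x. \<phi> x \<partial>M i))"
  shows "T = measure_distr (\<lambda>A. \<Sum>i\<in>I. a i * measure (M i) A)"
    and "norm_M T \<le> ennreal (\<Sum>i\<in>I. \<bar>a i\<bar> * measure (M i) UNIV)"
proof -
  let ?m = "\<lambda>A. \<Sum>i\<in>I. a i * measure (M i) A"
  have c1: "finite_signed_measure ?m"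
    by (rule combination_signed_measure(1)[OF I]) (simp_all add: M)
  have c2: "variation ?m UNIV \<le> ennreal (\<Sum>i\<in>I. \<bar>a i\<bar> * measure (M i) UNIV)"
    by (rule combination_signed_measure(2)[OF I]) (simp_all add: M)
  have c3: "(\<integral>x. \<phi> x \<partial>pos_part ?m) - (\<integral>x. \<phi> x \<partial>neg_part ?m) = (\<Sum>i\<in>I. a i * (\<integral>x. \<phi> x \<partial>M i))"
    if "\<phi> \<in> borel_measurable borel" "\<And>x. \<bar>\<phi> x\<bar> \<le> C" for \<phi> C
    by (rule combination_signed_measure(3)[OF I _ _ that]) (simp_all add: M)
  show eq: "T = measure_distr ?m"
  proof (rule extensionalityI[OF T(1)])
    show "measure_distr ?m \<in> extensional (test_functions UNIV)"
      unfolding measure_distr_def by (rule restrict_extensional)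
    fix \<phi> assume \<phi>: "\<phi> \<in> test_functions UNIV"
    obtain C where C: "\<And>x. \<bar>\<phi> x\<bar> \<le> C" using test_functions_bounded[OF \<phi>] by blast
    show "T \<phi> = measure_distr ?m \<phi>"
      using T(2)[OF \<phi>] c3[OF test_functions_measurable[OF \<phi>] C] \<phi> by (simp add: measure_distr_def)
  qed
  have "norm_M T \<le> variation ?m UNIV"
    unfolding norm_M_def by (rule INF_lower) (use c1 eq in simp)
  then show "norm_M T \<le> ennreal (\<Sum>i\<in>I. \<bar>a i\<bar> * measure (M i) UNIV)"
    using c2 by (rule order_trans)
qed

lemma grid_subset_K: "grid N \<subseteq> K"
proof
  fix x assume "x \<in> grid N"
  then obtain i j where x: "x = (real i / 2 ^ N, real j / 2 ^ N)" "i \<le> 2 ^ N" "j \<le> 2 ^ N"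
    unfolding grid_def by blast
  show "x \<in> K"
    using of_nat_mono[OF x(2), where 'a = real] of_nat_mono[OF x(3), where 'a = real]
    by (simp add: x(1) K_def)
qed

lemma measures_on_mono: "S \<subseteq> S' \<Longrightarrow> measures_on S \<subseteq> measures_on S'"
proof
  fix T assume S: "S \<subseteq> S'" and "T \<in> measures_on S"
  then obtain m where m: "T = measure_distr m" "finite_signed_measure m"
    "\<And>A. A \<in> sets borel \<Longrightarrow> A \<inter> S = {} \<Longrightarrow> m A = 0"
    unfolding measures_on_def by auto
  have "m A = 0" if "A \<in> sets borel" "A \<inter> S' = {}" for A
    using m(3)[OF that(1)] that(2) S by blast
  then show "T \<in> measures_on S'" unfolding measures_on_def using m(1,2) by auto
qed

lemma distr_extensional:
  "distr_D1 T \<in> extensional (test_functions UNIV)" "distr_D2 T \<in> extensional (test_functions UNIV)"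
  "distr_DD T \<in> extensional (test_functions UNIV)"
  unfolding distr_D1_def distr_D2_def distr_DD_def by (rule restrict_extensional)+

lemma sum_pixel_indices:
  "(\<Sum>n\<in>pixel_indices N. h n) = (\<Sum>l\<in>{1..2 ^ N}. \<Sum>k\<in>{1..2 ^ N}. h (k, l))"
  "(\<Sum>n\<in>pixel_indices N. h n) = (\<Sum>k\<in>{1..2 ^ N}. \<Sum>l\<in>{1..2 ^ N}. h (k, l))"
  unfolding pixel_indices_def
  by (simp_all add: sum.cartesian_product' sum.swap[of "\<lambda>k l. h (k, l)"])

definition knot :: "nat \<Rightarrow> nat \<times> nat \<Rightarrow> plane" where
  "knot N n = (real (fst n) / 2 ^ N, real (snd n) / 2 ^ N)"

context
  fixes N :: nat and c :: "nat \<times> nat \<Rightarrow> real"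
  assumes supp: "\<And>n. n \<notin> pixel_indices N \<Longrightarrow> c n = 0"
begin

lemma c_boundary: "c (0, l) = 0" "c (k, 0) = 0" "c (Suc (2 ^ N), l) = 0" "c (k, Suc (2 ^ N)) = 0"
  by (auto intro!: supp simp: pixel_indices_def)

text \<open>Integrating \<open>\<partial>\<^sub>1 \<phi>\<close> over a pixel leaves integrals over its two vertical edges. Summation
  by parts then collects the two pixels at each edge.\<close>

lemma step_distr_D1:
  assumes \<phi>: "\<phi> \<in> test_functions UNIV"
  shows "distr_D1 (step_distr N c) \<phi> =
    (\<Sum>n\<in>{..2 ^ N} \<times> {1..2 ^ N}. jump1 c n *
      (\<integral>x. \<phi> x \<partial>line_measure (\<lambda>s. (real (fst n) / 2 ^ N, s)) N (snd n)))"
proof -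
  define P where "P k l = (\<integral>s. indicator (cell_ivl N l) s * \<phi> (real k / 2 ^ N, s) \<partial>lborel)" for k l
  note sm = test_functionsD(1)[OF \<phi>]
  note intP = integrable_cell_times[OF smooth_section_continuous(2)[OF sm]]
  have cell: "(\<integral>x. indicator (half_cell N (k, l)) x * pderiv1 \<phi> x \<partial>lborel) = P k l - P (k - 1) l" if pos: "1 \<le> k" for k l
  proof -
    obtain k' where k: "k = Suc k'" using pos by (cases k) auto
    have "(\<integral>t. indicator (cell_ivl N (Suc k')) t * pderiv1 \<phi> (t, s) \<partial>lborel) =
        \<phi> (real (Suc k') / 2 ^ N, s) - \<phi> (real k' / 2 ^ N, s)" for s
      by (rule integral_cell_derivative[OF smooth_section_derivative(1)[OF sm]
            smooth_section_continuous(1)[OF smooth_pderivs(1)[OF sm]]])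
    then have "(\<integral>x. indicator (half_cell N (k, l)) x * pderiv1 \<phi> x \<partial>lborel) =
        (\<integral>s. indicator (cell_ivl N l) s * \<phi> (real (Suc k') / 2 ^ N, s) - indicator (cell_ivl N l) s * \<phi> (real k' / 2 ^ N, s) \<partial>lborel)"
      unfolding k integral_half_cell(2)[OF test_functions_pderiv(1)[OF \<phi>]] by (simp add: right_diff_distrib)
    also have "\<dots> = P k l - P (k - 1) l"
      unfolding P_def k by (subst Bochner_Integration.integral_diff[OF intP intP]) simp
    finally show ?thesis .
  qed
  have "distr_D1 (step_distr N c) \<phi> = - (\<Sum>l\<in>{1..2 ^ N}. \<Sum>k\<in>{1..2 ^ N}. c (k, l) * (P k l - P (k - 1) l))"
    unfolding distr_D1_eq[OF \<phi>] step_distr_sum[OF test_functions_pderiv(1)[OF \<phi>]] sum_pixel_indices(1)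
    using cell by simp
  also have "\<dots> = - (\<Sum>l\<in>{1..2 ^ N}. \<Sum>k\<le>2 ^ N. (c (k, l) - c (Suc k, l)) * P k l)"
    using summation_by_parts_0[of "\<lambda>k. c (k, _)" "2 ^ N" "\<lambda>k. P k _"] c_boundary by simp
  also have "\<dots> = (\<Sum>l\<in>{1..2 ^ N}. \<Sum>k\<le>2 ^ N. jump1 c (k, l) * P k l)"
    unfolding sum_negf[symmetric] by (simp add: jump1_def algebra_simps)
  also have "\<dots> = (\<Sum>n\<in>{..2 ^ N} \<times> {1..2 ^ N}. jump1 c n * P (fst n) (snd n))"
    by (subst sum.swap) (simp add: sum.cartesian_product case_prod_beta)
  also have "\<dots> = (\<Sum>n\<in>{..2 ^ N} \<times> {1..2 ^ N}. jump1 c n *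
      (\<integral>x. \<phi> x \<partial>line_measure (\<lambda>s. (real (fst n) / 2 ^ N, s)) N (snd n)))"
    unfolding P_def
    by (intro sum.cong refl arg_cong2[where f = "(*)"] line_measure(4)[symmetric]
        test_functions_measurable[OF \<phi>] continuous_intros)
  finally show ?thesis .
qed

lemma step_distr_D2:
  assumes \<phi>: "\<phi> \<in> test_functions UNIV"
  shows "distr_D2 (step_distr N c) \<phi> =
    (\<Sum>n\<in>{1..2 ^ N} \<times> {..2 ^ N}. jump2 c n *
      (\<integral>x. \<phi> x \<partial>line_measure (\<lambda>t. (t, real (snd n) / 2 ^ N)) N (fst n)))"
proof -
  define P where "P k l = (\<integral>t. indicator (cell_ivl N k) t * \<phi> (t, real l / 2 ^ N) \<partial>lborel)" for k l
  note sm = test_functionsD(1)[OF \<phi>]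
  note intP = integrable_cell_times[OF smooth_section_continuous(1)[OF sm]]
  have cell: "(\<integral>x. indicator (half_cell N (k, l)) x * pderiv2 \<phi> x \<partial>lborel) = P k l - P k (l - 1)" if pos: "1 \<le> l" for k l
  proof -
    obtain l' where l: "l = Suc l'" using pos by (cases l) auto
    have "(\<integral>s. indicator (cell_ivl N (Suc l')) s * pderiv2 \<phi> (t, s) \<partial>lborel) =
        \<phi> (t, real (Suc l') / 2 ^ N) - \<phi> (t, real l' / 2 ^ N)" for t
      by (rule integral_cell_derivative[OF smooth_section_derivative(2)[OF sm]
            smooth_section_continuous(2)[OF smooth_pderivs(2)[OF sm]]])
    then have "(\<integral>x. indicator (half_cell N (k, l)) x * pderiv2 \<phi> x \<partial>lborel) =
        (\<integral>t. indicator (cell_ivl N k) t * \<phi> (t, real (Suc l') / 2 ^ N) - indicator (cell_ivl N k) t * \<phi> (t, real l' / 2 ^ N) \<partial>lborel)"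
      unfolding l integral_half_cell(1)[OF test_functions_pderiv(2)[OF \<phi>]] by (simp add: right_diff_distrib)
    also have "\<dots> = P k l - P k (l - 1)"
      unfolding P_def l by (subst Bochner_Integration.integral_diff[OF intP intP]) simp
    finally show ?thesis .
  qed
  have "distr_D2 (step_distr N c) \<phi> = - (\<Sum>k\<in>{1..2 ^ N}. \<Sum>l\<in>{1..2 ^ N}. c (k, l) * (P k l - P k (l - 1)))"
    unfolding distr_D2_eq[OF \<phi>] step_distr_sum[OF test_functions_pderiv(2)[OF \<phi>]] sum_pixel_indices(2)
    using cell by simp
  also have "\<dots> = - (\<Sum>k\<in>{1..2 ^ N}. \<Sum>l\<le>2 ^ N. (c (k, l) - c (k, Suc l)) * P k l)"
    using summation_by_parts_0[of "\<lambda>l. c (_, l)" "2 ^ N" "\<lambda>l. P _ l"] c_boundary by simp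
  also have "\<dots> = (\<Sum>k\<in>{1..2 ^ N}. \<Sum>l\<le>2 ^ N. jump2 c (k, l) * P k l)"
    unfolding sum_negf[symmetric] by (simp add: jump2_def algebra_simps)
  also have "\<dots> = (\<Sum>n\<in>{1..2 ^ N} \<times> {..2 ^ N}. jump2 c n * P (fst n) (snd n))"
    by (simp add: sum.cartesian_product case_prod_beta)
  also have "\<dots> = (\<Sum>n\<in>{1..2 ^ N} \<times> {..2 ^ N}. jump2 c n *
      (\<integral>x. \<phi> x \<partial>line_measure (\<lambda>t. (t, real (snd n) / 2 ^ N)) N (fst n)))"
    unfolding P_def
    by (intro sum.cong refl arg_cong2[where f = "(*)"] line_measure(4)[symmetric]
        test_functions_measurable[OF \<phi>] continuous_intros)
  finally show ?thesis .
qed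

text \<open>Integrating \<open>\<partial>\<^sub>2\<partial>\<^sub>1 \<phi>\<close> over a pixel leaves the values at its four corners. Summation by
  parts in both directions collects the four pixels at each knot.\<close>

lemma step_distr_DD:
  assumes \<phi>: "\<phi> \<in> test_functions UNIV"
  shows "distr_DD (step_distr N c) \<phi> =
    (\<Sum>n\<in>{..2 ^ N} \<times> {..2 ^ N}. jump12 c n * (\<integral>x. \<phi> x \<partial>point_mass (knot N n)))"
proof -
  define p where "p k l = \<phi> (real k / 2 ^ N, real l / 2 ^ N)" for k l
  note sm = test_functionsD(1)[OF \<phi>]
  have cell: "(\<integral>x. indicator (half_cell N (k, l)) x * pderiv2 (pderiv1 \<phi>) x \<partial>lborel) =
      (p k l - p k (l - 1)) - (p (k - 1) l - p (k - 1) (l - 1))" if pos: "1 \<le> k" "1 \<le> l" for k l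
  proof -
    obtain k' where k: "k = Suc k'" using pos by (cases k) auto
    obtain l' where l: "l = Suc l'" using pos by (cases l) auto
    let ?b = "real (Suc l') / 2 ^ N" and ?a = "real l' / 2 ^ N"
    have "(\<integral>s. indicator (cell_ivl N (Suc l')) s * pderiv2 (pderiv1 \<phi>) (t, s) \<partial>lborel) =
        pderiv1 \<phi> (t, ?b) - pderiv1 \<phi> (t, ?a)" for t
      by (rule integral_cell_derivative[OF smooth_section_derivative(2)[OF smooth_pderivs(1)[OF sm]]
            smooth_section_continuous(2)[OF smooth_pderivs(2)[OF smooth_pderivs(1)[OF sm]]]])
    then have "(\<integral>x. indicator (half_cell N (k, l)) x * pderiv2 (pderiv1 \<phi>) x \<partial>lborel) =
        (\<integral>t. indicator (cell_ivl N (Suc k')) t * (pderiv1 \<phi> (t, ?b) - pderiv1 \<phi> (t, ?a)) \<partial>lborel)"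
      unfolding k l integral_half_cell(1)[OF test_functions_pderiv(2)[OF test_functions_pderiv(1)[OF \<phi>]]] by simp
    also have "\<dots> = (\<phi> (real (Suc k') / 2 ^ N, ?b) - \<phi> (real (Suc k') / 2 ^ N, ?a)) - (\<phi> (real k' / 2 ^ N, ?b) - \<phi> (real k' / 2 ^ N, ?a))"
      by (intro integral_cell_derivative DERIV_diff smooth_section_derivative(1)[OF sm]
          continuous_on_diff smooth_section_continuous(1)[OF smooth_pderivs(1)[OF sm]])
    finally show ?thesis unfolding p_def k l by simp
  qed
  have "distr_DD (step_distr N c) \<phi> =
      (\<Sum>l\<in>{1..2 ^ N}. \<Sum>k\<in>{1..2 ^ N}. c (k, l) * ((p k l - p k (l - 1)) - (p (k - 1) l - p (k - 1) (l - 1))))"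
    unfolding distr_DD_eq[OF \<phi>] step_distr_sum[OF test_functions_pderiv(2)[OF test_functions_pderiv(1)[OF \<phi>]]]
      sum_pixel_indices(1)
    using cell by simp
  also have "\<dots> = (\<Sum>l\<in>{1..2 ^ N}. \<Sum>k\<le>2 ^ N. (c (k, l) - c (Suc k, l)) * (p k l - p k (l - 1)))"
    using summation_by_parts_0[of "\<lambda>k. c (k, _)" "2 ^ N" "\<lambda>k. p k _ - p k (_ - 1)"] c_boundary by simp
  also have "\<dots> = (\<Sum>k\<le>2 ^ N. \<Sum>l\<in>{1..2 ^ N}. (c (k, l) - c (Suc k, l)) * (p k l - p k (l - 1)))"
    by (rule sum.swap)
  also have "\<dots> = (\<Sum>k\<le>2 ^ N. \<Sum>l\<le>2 ^ N. ((c (k, l) - c (Suc k, l)) - (c (k, Suc l) - c (Suc k, Suc l))) * p k l)"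
    using summation_by_parts_0[of "\<lambda>l. c (_, l) - c (Suc _, l)" "2 ^ N" "\<lambda>l. p _ l"] c_boundary by simp
  also have "\<dots> = (\<Sum>k\<le>2 ^ N. \<Sum>l\<le>2 ^ N. jump12 c (k, l) * p k l)"
    by (simp add: jump12_def algebra_simps)
  also have "\<dots> = (\<Sum>n\<in>{..2 ^ N} \<times> {..2 ^ N}. jump12 c n * p (fst n) (snd n))"
    by (simp add: sum.cartesian_product case_prod_beta)
  also have "\<dots> = (\<Sum>n\<in>{..2 ^ N} \<times> {..2 ^ N}. jump12 c n * (\<integral>x. \<phi> x \<partial>point_mass (knot N n)))"
    unfolding p_def
    by (intro sum.cong refl arg_cong2[where f = "(*)"])
      (simp add: point_mass(5)[OF test_functions_measurable[OF \<phi>]] knot_def)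
  finally show ?thesis .
qed

lemma norm_D1_step: "norm_M (distr_D1 (step_distr N c)) \<le> ennreal (\<Sum>n\<in>{..2 ^ N} \<times> {1..2 ^ N}. \<bar>jump1 c n\<bar> / 2 ^ N)"
proof -
  have cont: "continuous_on UNIV (\<lambda>s. (real (fst n) / 2 ^ N, s))" for n :: "nat \<times> nat"
    by (intro continuous_intros)
  have "norm_M (distr_D1 (step_distr N c)) \<le> ennreal (\<Sum>n\<in>{..2 ^ N} \<times> {1..2 ^ N}. \<bar>jump1 c n\<bar> *
      measure (line_measure (\<lambda>s. (real (fst n) / 2 ^ N, s)) N (snd n)) UNIV)"
    by (rule combination_distr(2)[OF _ _ _ distr_extensional(1) step_distr_D1])
      (simp_all add: line_measure(1,2)[OF cont])
  then show ?thesis by (simp add: line_measure(3)[OF cont])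
qed

lemma norm_D2_step: "norm_M (distr_D2 (step_distr N c)) \<le> ennreal (\<Sum>n\<in>{1..2 ^ N} \<times> {..2 ^ N}. \<bar>jump2 c n\<bar> / 2 ^ N)"
proof -
  have cont: "continuous_on UNIV (\<lambda>t. (t, real (snd n) / 2 ^ N))" for n :: "nat \<times> nat"
    by (intro continuous_intros)
  have "norm_M (distr_D2 (step_distr N c)) \<le> ennreal (\<Sum>n\<in>{1..2 ^ N} \<times> {..2 ^ N}. \<bar>jump2 c n\<bar> *
      measure (line_measure (\<lambda>t. (t, real (snd n) / 2 ^ N)) N (fst n)) UNIV)"
    by (rule combination_distr(2)[OF _ _ _ distr_extensional(2) step_distr_D2])
      (simp_all add: line_measure(1,2)[OF cont])
  then show ?thesis by (simp add: line_measure(3)[OF cont])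
qed

lemma norm_DD_step: "norm_M (distr_DD (step_distr N c)) \<le> ennreal (\<Sum>n\<in>{..2 ^ N} \<times> {..2 ^ N}. \<bar>jump12 c n\<bar>)"
proof -
  have "norm_M (distr_DD (step_distr N c)) \<le> ennreal (\<Sum>n\<in>{..2 ^ N} \<times> {..2 ^ N}. \<bar>jump12 c n\<bar> *
      measure (point_mass (knot N n)) UNIV)"
    by (rule combination_distr(2)[OF _ _ _ distr_extensional(3) step_distr_DD])
      (simp_all add: point_mass(1,2))
  then show ?thesis by (simp add: point_mass(3))
qed

lemma step_distr_DD_grid: "distr_DD (step_distr N c) \<in> measures_on (grid N)"
proof -
  let ?I = "{..2 ^ N :: nat} \<times> {..2 ^ N :: nat}"
  let ?m = "\<lambda>A. \<Sum>n\<in>?I. jump12 c n * measure (point_mass (knot N n)) A"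
  have 1: "distr_DD (step_distr N c) = measure_distr ?m"
    by (rule combination_distr(1)[OF _ _ _ distr_extensional(3) step_distr_DD])
      (simp_all add: point_mass(1,2))
  have 2: "finite_signed_measure ?m"
    by (rule combination_signed_measure(1)) (simp_all add: point_mass(1,2))
  have 3: "?m A = 0" if A: "A \<in> sets borel" "A \<inter> grid N = {}" for A
  proof (rule sum.neutral, rule ballI)
    fix n assume n: "n \<in> ?I"
    have "knot N n \<in> grid N" unfolding grid_def knot_def using n by auto
    then show "jump12 c n * measure (point_mass (knot N n)) A = 0"
      using point_mass(4)[OF A(1), of "knot N n"] A(2) by auto
  qed
  show ?thesis unfolding measures_on_def using 1 2 3 by blast
qed

lemma norm_theta_step_le:
  assumes "0 \<le> \<theta>" "\<theta> \<le> 1"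
  shows "norm_theta \<theta> (step_distr N c) \<le> ennreal (step_norm N \<theta> c)"
  unfolding ennreal_step_norm[OF assms] norm_theta_def norm_grad_def
  by (intro add_mono mult_left_mono norm_DD_step norm_D1_step norm_D2_step) auto

lemma step_distr_M_DD0: "step_distr N c \<in> M_DD0"
proof -
  have "distr_DD (step_distr N c) \<in> measures_on K"
    by (rule subsetD[OF measures_on_mono[OF grid_subset_K] step_distr_DD_grid])
  moreover have "step_distr N c \<phi> = 0" if \<phi>: "\<phi> \<in> test_functions (- K)" for \<phi>
  proof -
    have z: "step_fun N c x * \<phi> x = 0" for x
    proof (cases "x \<in> K")
      case True
      then have "x \<notin> supp \<phi>" using test_functionsD(3)[OF \<phi>] by blast
      then show ?thesis using test_functionsD(4)[OF \<phi>] by simp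
    next
      case False
      have "x \<notin> half_cell N n" if n: "n \<in> pixel_indices N" for n
        using half_cell_subset_K[OF n, of x] False unfolding K_def mem_Times_iff by fastforce
      then show ?thesis by (simp add: step_fun_eq_0)
    qed
    have "(\<lambda>x. step_fun N c x * \<phi> x) = (\<lambda>_. 0)" by (rule ext) (rule z)
    then show ?thesis using test_functions_UNIV[OF \<phi>] by (simp add: step_distr_def)
  qed
  ultimately show ?thesis using step_distr_in_distributions by (simp add: M_DD0_def)
qed

lemma step_distr_grid_pos:
  assumes "\<And>n. 0 \<le> c n"
  shows "step_distr N c \<in> M_DD0_pos_grid N"
proof -
  have "0 \<le> step_distr N c \<phi>" if "\<phi> \<in> test_functions UNIV" "\<forall>x. 0 \<le> \<phi> x" for \<phi>
  proof -
    have "0 \<le> step_fun N c x" for x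
      unfolding step_fun_def using assms by (intro sum_nonneg mult_nonneg_nonneg) auto
    then have "0 \<le> (\<integral>x. step_fun N c x * \<phi> x \<partial>lborel)"
      using that(2) by (intro Bochner_Integration.integral_nonneg mult_nonneg_nonneg) auto
    then show ?thesis using that(1) by (simp add: step_distr_def)
  qed
  then show ?thesis
    using step_distr_M_DD0 step_distr_DD_grid by (auto simp: M_DD0_pos_grid_def M_DD0_pos_def)
qed

end

section \<open>The finite-dimensional problem\<close>

text \<open>Distribution functions of measures on the grid depend on a coordinate \<open>t\<close> only through this
  index \<open>i\<close>.\<close>

definition knots_below :: "nat \<Rightarrow> nat \<Rightarrow> real \<Rightarrow> bool" where
  "knots_below N i t \<longleftrightarrow> (\<forall>i'\<le>2 ^ N. real i' / 2 ^ N \<le> t \<longleftrightarrow> i' \<le> i)"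

lemma knots_below_cell:
  assumes "t \<in> cell_ivl N (Suc i)"
  shows "knots_below N i t"
proof -
  have t: "real i \<le> t * 2 ^ N" "t * 2 ^ N < real (Suc i)"
    using assms by (simp_all add: cell_ivl_def pos_divide_le_eq pos_less_divide_eq)
  have "real i' / 2 ^ N \<le> t \<longleftrightarrow> i' \<le> i" for i'
  proof -
    have "real i' / 2 ^ N \<le> t \<longleftrightarrow> real i' \<le> t * 2 ^ N" by (simp add: pos_divide_le_eq)
    also have "\<dots> \<longleftrightarrow> i' \<le> i" using t by linarith
    finally show ?thesis .
  qed
  then show ?thesis by (simp add: knots_below_def)
qed

lemma knots_below_ge_1:
  assumes "1 \<le> t"
  shows "knots_below N (2 ^ N) t"
proof -
  have "real i' / 2 ^ N \<le> t" if "i' \<le> 2 ^ N" for i'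
  proof -
    have "real i' / 2 ^ N \<le> 1" using of_nat_mono[OF that, where 'a = real] by simp
    then show ?thesis using assms by linarith
  qed
  then show ?thesis by (simp add: knots_below_def)
qed

lemma knots_below_exists:
  assumes "0 \<le> t"
  obtains i where "i \<le> 2 ^ N" "knots_below N i t" "i < 2 ^ N \<Longrightarrow> t \<in> cell_ivl N (Suc i)" "i = 2 ^ N \<Longrightarrow> 1 \<le> t"
proof (cases "1 \<le> t")
  case True
  then show ?thesis by (intro that[of "2 ^ N"] knots_below_ge_1) auto
next
  case False
  define i where "i = nat \<lfloor>t * 2 ^ N\<rfloor>"
  have "0 \<le> t * 2 ^ N" using assms by simp
  then have ri: "real i = of_int \<lfloor>t * 2 ^ N\<rfloor>" by (simp add: i_def)
  have t: "real i \<le> t * 2 ^ N" "t * 2 ^ N < real i + 1" unfolding ri by linarith+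
  have "t * 2 ^ N < 1 * 2 ^ N" using False by (intro mult_strict_right_mono) auto
  then have "real i < 2 ^ N" using t(1) by linarith
  then have "real i < real (2 ^ N)" by (simp only: of_nat_power of_nat_numeral)
  then have i: "i < 2 ^ N" unfolding of_nat_less_iff .
  have c: "t \<in> cell_ivl N (Suc i)"
    using t by (simp add: cell_ivl_def pos_divide_le_eq pos_less_divide_eq)
  show ?thesis by (rule that[of i]) (use i c knots_below_cell[OF c] in auto)
qed

lemma finite_grid: "finite (grid N)"
proof -
  have "grid N = (\<lambda>(i, j). (real i / 2 ^ N, real j / 2 ^ N)) ` ({..2 ^ N} \<times> {..2 ^ N})"
    unfolding grid_def by auto
  then show ?thesis by simp
qed

text \<open>The distribution function \<open>F\<close> of a measure on the grid is constant on half-open cells, including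
  the unbounded ones to the right of and above the image. Its value on a cell is the limit of the
  integrals against the bumps of that cell. Hence it is the pixel mean inside the image, and zero
  outside, because \<open>f\<close> vanishes there.\<close>

lemma grid_imp_step_distr:
  assumes f: "f \<in> M_DD0" and grid: "distr_DD f \<in> measures_on (grid N)"
  shows "f = step_distr N (pixel_mean N f)"
proof -
  obtain m where m: "finite_signed_measure m" "distr_DD f = measure_distr m"
    and mg: "\<And>A. A \<in> sets borel \<Longrightarrow> A \<inter> grid N = {} \<Longrightarrow> m A = 0"
    using grid unfolding measures_on_def by auto
  let ?F = "\<lambda>x. m (quadrant x)"
  have rep: "represents ?F f"
    by (rule M_DD0_representation[OF f m]) (use mg grid_subset_K in blast)
  have gm: "grid N \<in> sets borel" by (rule borel_closed[OF finite_imp_closed[OF finite_grid]])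
  have F: "?F x = m (quadrant x \<inter> grid N)" for x
  proof -
    note q = quadrant_measurable[of x]
    have "m (quadrant x) = m ((quadrant x \<inter> grid N) \<union> (quadrant x - grid N))" by (simp add: Int_Diff_Un)
    also have "\<dots> = m (quadrant x \<inter> grid N) + m (quadrant x - grid N)"
      by (rule signed_measure_Un[OF m(1)]) (use q gm in auto)
    also have "m (quadrant x - grid N) = 0" by (rule mg) (use q gm in auto)
    finally show ?thesis by simp
  qed
  have F_cong: "?F x = ?F x'"
    if "knots_below N i (fst x)" "knots_below N l (snd x)" "knots_below N i (fst x')" "knots_below N l (snd x')"
    for x x' i l
  proof -
    have "quadrant x \<inter> grid N = quadrant x' \<inter> grid N"
      using that by (auto simp: quadrant_def grid_def knots_below_def)
    then show ?thesis by (simp add: F)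
  qed
  \<comment> \<open>For \<open>i = 2^N\<close> or \<open>l = 2^N\<close> the cell lies outside the image and the mean is zero by
    definition, which is consistent because \<open>f\<close> vanishes on the bumps there.\<close>
  have val: "pixel_mean N f (Suc i, Suc l) = ?F x"
    if "knots_below N i (fst x)" "knots_below N l (snd x)" for i l x
  proof -
    have "?F z = ?F x" if "z \<in> half_cell N (Suc i, Suc l)" for z
    proof (rule F_cong[OF _ _ \<open>knots_below N i (fst x)\<close> \<open>knots_below N l (snd x)\<close>])
      show "knots_below N i (fst z)" "knots_below N l (snd z)"
        using that by (auto simp: half_cell_def intro: knots_below_cell)
    qed
    moreover have "?F \<in> borel_measurable borel" using rep by (simp add: represents_def)
    ultimately have "(LINT z:pixel N (Suc i, Suc l)|lborel. ?F z) = ?F x / 4 ^ N"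
      by (intro pixel_integral_const)
    then have "(\<lambda>j. 4 ^ N * f (cell_test N j (Suc i) (Suc l))) \<longlonglongrightarrow> 4 ^ N * (?F x / 4 ^ N)"
      using pixel_integral_limit[OF rep, of N "Suc i" "Suc l"] by (intro tendsto_mult_left) simp
    then show ?thesis using LIMSEQ_unique[OF pixel_mean_limit[OF f]] by simp
  qed
  have F_step: "?F x = step_fun N (pixel_mean N f) x" for x
  proof (cases "0 \<le> fst x \<and> 0 \<le> snd x")
    case False
    have "y \<notin> quadrant x" if "y \<in> grid N" for y
    proof
      assume "y \<in> quadrant x"
      moreover have "0 \<le> fst y" "0 \<le> snd y" using that by (auto simp: grid_def)
      ultimately show False using False by (auto simp: quadrant_def mem_Times_iff)
    qed
    then have "quadrant x \<inter> grid N = {}" by blast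
    then have "?F x = 0" using F signed_measure_empty[OF m(1)] by simp
    moreover have "step_fun N (pixel_mean N f) x = 0"
    proof (rule step_fun_eq_0, rule notI)
      fix n assume "n \<in> pixel_indices N" "x \<in> half_cell N n"
      from half_cell_subset_K[OF this] False show False by linarith
    qed
    ultimately show ?thesis by simp
  next
    case True
    obtain i where i: "i \<le> 2 ^ N" "knots_below N i (fst x)"
      "i < 2 ^ N \<Longrightarrow> fst x \<in> cell_ivl N (Suc i)" "i = 2 ^ N \<Longrightarrow> 1 \<le> fst x"
      using knots_below_exists[of "fst x" N] True by blast
    obtain l where l: "l \<le> 2 ^ N" "knots_below N l (snd x)"
      "l < 2 ^ N \<Longrightarrow> snd x \<in> cell_ivl N (Suc l)" "l = 2 ^ N \<Longrightarrow> 1 \<le> snd x"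
      using knots_below_exists[of "snd x" N] True by blast
    have v: "?F x = pixel_mean N f (Suc i, Suc l)" using val[OF i(2) l(2)] by simp
    show ?thesis
    proof (cases "i < 2 ^ N \<and> l < 2 ^ N")
      case True
      have "(Suc i, Suc l) \<in> pixel_indices N" using True by (auto simp: pixel_indices_def)
      moreover have "x \<in> half_cell N (Suc i, Suc l)" using True i(3) l(3) by (simp add: half_cell_def mem_Times_iff)
      ultimately show ?thesis using v step_fun_eq by simp
    next
      case False
      then have "pixel_mean N f (Suc i, Suc l) = 0" by (auto simp: pixel_mean_def pixel_indices_def)
      moreover have ge: "1 \<le> fst x \<or> 1 \<le> snd x" using False i(1,4) l(1,4) by linarith
      have "step_fun N (pixel_mean N f) x = 0"
      proof (rule step_fun_eq_0, rule notI)
        fix n assume "n \<in> pixel_indices N" "x \<in> half_cell N n"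
        from half_cell_subset_K[OF this] ge show False by linarith
      qed
      ultimately show ?thesis using v by simp
    qed
  qed
  have fd: "f \<in> distributions" using f by (simp add: M_DD0_def)
  show ?thesis
  proof (rule extensionalityI[of _ "test_functions UNIV"])
    show "f \<in> extensional (test_functions UNIV)" using fd by (simp add: distributions_def)
    show "step_distr N (pixel_mean N f) \<in> extensional (test_functions UNIV)"
      unfolding step_distr_def by (rule restrict_extensional)
    show "f \<phi> = step_distr N (pixel_mean N f) \<phi>" if "\<phi> \<in> test_functions UNIV" for \<phi>
      using rep that F_step by (simp add: represents_def step_distr_def)
  qed
qed

text \<open>The matrices of values of the nonnegative step functions.\<close>

definition pixel_cone :: "nat \<Rightarrow> (nat \<times> nat \<Rightarrow> real) set" where
  "pixel_cone N = {c. (\<forall>n. 0 \<le> c n) \<and> (\<forall>n. n \<notin> pixel_indices N \<longrightarrow> c n = 0)}"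

lemma pixel_coneI: "(\<And>n. 0 \<le> c n) \<Longrightarrow> (\<And>n. n \<notin> pixel_indices N \<Longrightarrow> c n = 0) \<Longrightarrow> c \<in> pixel_cone N"
  by (simp add: pixel_cone_def)

lemma pixel_coneD: "c \<in> pixel_cone N \<Longrightarrow> 0 \<le> c n" "c \<in> pixel_cone N \<Longrightarrow> n \<notin> pixel_indices N \<Longrightarrow> c n = 0"
  unfolding pixel_cone_def by blast+

definition pixel_objective :: "nat \<Rightarrow> (nat \<times> nat \<Rightarrow> real) \<Rightarrow> real \<Rightarrow> real \<Rightarrow> (nat \<times> nat \<Rightarrow> real) \<Rightarrow> real" where
  "pixel_objective N y \<theta> \<Lambda> c = (\<Sum>n\<in>pixel_indices N. (y n - c n / 4 ^ N)\<^sup>2) + \<Lambda> * step_norm N \<theta> c"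

lemma step_norm_nonneg: "0 \<le> \<theta> \<Longrightarrow> \<theta> \<le> 1 \<Longrightarrow> 0 \<le> step_norm N \<theta> c"
  unfolding step_norm_def by (intro add_nonneg_nonneg mult_nonneg_nonneg sum_nonneg) auto

lemma pixel_mean_in_cone: "f \<in> M_DD0_pos \<Longrightarrow> pixel_mean N f \<in> pixel_cone N"
  by (rule pixel_coneI) (simp_all add: pixel_mean_nonneg, simp add: pixel_mean_def)

lemma data_term: "(L2_set (\<lambda>n. y n - nu N f n) (pixel_indices N))\<^sup>2 =
    (\<Sum>n\<in>pixel_indices N. (y n - pixel_mean N f n / 4 ^ N)\<^sup>2)"
proof -
  have "(L2_set (\<lambda>n. y n - nu N f n) (pixel_indices N))\<^sup>2 = (\<Sum>n\<in>pixel_indices N. (y n - nu N f n)\<^sup>2)"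
    unfolding L2_set_def by (rule real_sqrt_pow2) (simp add: sum_nonneg)
  also have "\<dots> = (\<Sum>n\<in>pixel_indices N. (y n - pixel_mean N f n / 4 ^ N)\<^sup>2)"
    by (rule sum.cong) (simp_all add: pixel_mean_def)
  finally show ?thesis .
qed

lemma pixel_objective_ennreal:
  assumes "0 \<le> \<theta>" "\<theta> \<le> 1" "0 < \<Lambda>"
  shows "ennreal (pixel_objective N y \<theta> \<Lambda> c) = ennreal (\<Sum>n\<in>pixel_indices N. (y n - c n / 4 ^ N)\<^sup>2) + ennreal \<Lambda> * ennreal (step_norm N \<theta> c)"
  unfolding pixel_objective_def using assms step_norm_nonneg[OF assms(1,2)]
  by (simp add: ennreal_plus ennreal_mult sum_nonneg del: sum_ennreal)

text \<open>Replacing \<open>f\<close> by its pixel means keeps the data term and does not increase the norm.\<close>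

lemma objective_ge_pixel_objective:
  assumes "0 \<le> \<theta>" "\<theta> \<le> 1" "0 < \<Lambda>" "f \<in> M_DD0"
  shows "ennreal (pixel_objective N y \<theta> \<Lambda> (pixel_mean N f)) \<le> objective N y \<theta> \<Lambda> f"
  unfolding pixel_objective_ennreal[OF assms(1-3)] objective_def data_term
  by (intro add_left_mono mult_left_mono norm_theta_ge assms) auto

lemma objective_step_distr:
  assumes "0 \<le> \<theta>" "\<theta> \<le> 1" "0 < \<Lambda>" "c \<in> pixel_cone N"
  shows "objective N y \<theta> \<Lambda> (step_distr N c) = ennreal (pixel_objective N y \<theta> \<Lambda> c)"
proof -
  have supp: "\<And>n. n \<notin> pixel_indices N \<Longrightarrow> c n = 0" by (rule pixel_coneD(2)[OF assms(4)])
  have co: "pixel_mean N (step_distr N c) = c" by (rule pixel_mean_step_distr) (rule supp)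
  have mem: "step_distr N c \<in> M_DD0" by (rule step_distr_M_DD0) (rule supp)
  have "norm_theta \<theta> (step_distr N c) \<le> ennreal (step_norm N \<theta> c)"
    by (rule norm_theta_step_le[OF _ assms(1,2)]) (rule supp)
  moreover have "ennreal (step_norm N \<theta> c) \<le> norm_theta \<theta> (step_distr N c)"
    using norm_theta_ge[OF mem assms(1,2), of N] by (simp only: co)
  ultimately have "norm_theta \<theta> (step_distr N c) = ennreal (step_norm N \<theta> c)" by (rule antisym)
  then show ?thesis unfolding pixel_objective_ennreal[OF assms(1-3)] objective_def data_term co by simp
qed

lemma grid_eq_step_distr_cone: "M_DD0_pos_grid N = step_distr N ` pixel_cone N"
proof (intro equalityI subsetI)
  fix f assume f: "f \<in> M_DD0_pos_grid N"
  then have "f = step_distr N (pixel_mean N f)" "pixel_mean N f \<in> pixel_cone N"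
    by (auto simp: M_DD0_pos_grid_def M_DD0_pos_def intro!: grid_imp_step_distr pixel_mean_in_cone)
  then show "f \<in> step_distr N ` pixel_cone N" by blast
next
  fix f assume "f \<in> step_distr N ` pixel_cone N"
  then obtain c where "f = step_distr N c" "c \<in> pixel_cone N" by blast
  have "step_distr N c \<in> M_DD0_pos_grid N"
    by (rule step_distr_grid_pos) (simp_all add: pixel_coneD[OF \<open>c \<in> pixel_cone N\<close>])
  then show "f \<in> M_DD0_pos_grid N" using \<open>f = step_distr N c\<close> by simp
qed

lemma continuous_pixel_objective: "continuous_on UNIV (pixel_objective N y \<theta> \<Lambda>)"
  unfolding pixel_objective_def[abs_def] step_norm_def jump12_def jump1_def jump2_def case_prod_beta
  by (intro continuous_intros continuous_on_product_coordinates) simp_all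

text \<open>A large entry makes the data term at least as large as the objective at zero, so the minimum over a compact box
  is the minimum over the whole cone.\<close>

lemma pixel_objective_minimum_exists:
  assumes "0 \<le> \<theta>" "\<theta> \<le> 1" "0 < \<Lambda>"
  obtains c where "c \<in> pixel_cone N" "\<And>d. d \<in> pixel_cone N \<Longrightarrow> pixel_objective N y \<theta> \<Lambda> c \<le> pixel_objective N y \<theta> \<Lambda> d"
proof -
  let ?J = "pixel_objective N y \<theta> \<Lambda>"
  \<comment> \<open>An entry above \<open>4^N * b\<close> alone makes the data term at least as large as the objective at
    zero; adding one ensures \<open>j \<le> (j + 1)^2\<close>.\<close>
  define b where "b = (\<Sum>n\<in>pixel_indices N. \<bar>y n\<bar>) + ?J (\<lambda>_. 0) + 1"
  define X where "X n = (if n \<in> pixel_indices N then {0..4 ^ N * b} else {0})" for n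
  have J0: "0 \<le> ?J c" for c
    unfolding pixel_objective_def using assms step_norm_nonneg by (intro add_nonneg_nonneg sum_nonneg mult_nonneg_nonneg) auto
  have b0: "0 \<le> b" unfolding b_def using J0 by (intro add_nonneg_nonneg sum_nonneg) auto
  have "compactin (product_topology (\<lambda>_. euclidean) UNIV) (PiE UNIV X)"
    unfolding compactin_PiE by (simp add: X_def)
  then have comp: "compact (PiE UNIV X)" by (simp add: euclidean_product_topology)
  have z: "(\<lambda>_. 0) \<in> PiE UNIV X" using b0 by (simp add: X_def PiE_iff)
  have "\<exists>c\<in>PiE UNIV X. \<forall>d\<in>PiE UNIV X. ?J c \<le> ?J d"
    by (rule continuous_attains_inf[OF comp]) (use z continuous_on_subset[OF continuous_pixel_objective] in auto)
  then obtain c where c: "c \<in> PiE UNIV X" "\<And>d. d \<in> PiE UNIV X \<Longrightarrow> ?J c \<le> ?J d" by blast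
  have "c \<in> pixel_cone N"
  proof -
    have cX: "c n \<in> X n" for n by (rule PiE_mem[OF c(1) UNIV_I])
    show ?thesis
    proof (rule pixel_coneI)
      show "0 \<le> c n" for n using cX[of n] by (cases "n \<in> pixel_indices N") (simp_all add: X_def)
      show "c n = 0" if "n \<notin> pixel_indices N" for n using cX[of n] that by (simp add: X_def)
    qed
  qed
  moreover have "?J c \<le> ?J d" if d: "d \<in> pixel_cone N" for d
  proof (cases "d \<in> PiE UNIV X")
    case True
    then show ?thesis by (rule c(2))
  next
    case False
    then obtain n where "d n \<notin> X n" by (auto simp: PiE_iff)
    then have n: "n \<in> pixel_indices N" "4 ^ N * b < d n"
      using pixel_coneD[OF d, of n] by (auto simp: X_def split: if_splits)
    have "\<bar>y n\<bar> \<le> (\<Sum>n\<in>pixel_indices N. \<bar>y n\<bar>)"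
      using n(1) finite_pixel_indices by (intro member_le_sum) auto
    moreover have "b < d n / 4 ^ N" using n(2) by (simp add: pos_less_divide_eq mult.commute)
    ultimately have gt: "?J (\<lambda>_. 0) + 1 \<le> d n / 4 ^ N - y n" unfolding b_def by linarith
    have "?J (\<lambda>_. 0) \<le> (?J (\<lambda>_. 0) + 1) * (?J (\<lambda>_. 0) + 1)"
      using J0[of "\<lambda>_. 0"] mult_nonneg_nonneg[OF J0 J0, of "\<lambda>_. 0" "\<lambda>_. 0"] by (simp add: algebra_simps)
    also have "\<dots> \<le> (d n / 4 ^ N - y n) * (d n / 4 ^ N - y n)"
      using gt J0[of "\<lambda>_. 0"] by (intro mult_mono) linarith+
    also have "\<dots> = (y n - d n / 4 ^ N)\<^sup>2" by (simp add: power2_eq_square algebra_simps)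
    also have "\<dots> \<le> (\<Sum>n\<in>pixel_indices N. (y n - d n / 4 ^ N)\<^sup>2)"
      using n(1) finite_pixel_indices by (intro member_le_sum) auto
    also have "\<dots> \<le> ?J d" unfolding pixel_objective_def using assms step_norm_nonneg by simp
    finally have "?J (\<lambda>_. 0) \<le> ?J d" .
    then show ?thesis using c(2)[OF z] by linarith
  qed
  ultimately show ?thesis using that by blast
qed

lemma step_norm_midpoint:
  assumes "0 \<le> \<theta>" "\<theta> \<le> 1"
  shows "step_norm N \<theta> (\<lambda>n. (c n + d n) / 2) \<le> (step_norm N \<theta> c + step_norm N \<theta> d) / 2"
proof -
  let ?m = "\<lambda>n. (c n + d n) / 2"
  have j: "jump12 ?m n = (jump12 c n + jump12 d n) / 2" "jump1 ?m n = (jump1 c n + jump1 d n) / 2"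
    "jump2 ?m n = (jump2 c n + jump2 d n) / 2" for n
    by (cases n; simp add: jump12_def jump1_def jump2_def field_simps)+
  have s: "(\<Sum>n\<in>A. \<bar>(u n + v n) / 2\<bar> / r) \<le> ((\<Sum>n\<in>A. \<bar>u n\<bar> / r) + (\<Sum>n\<in>A. \<bar>v n\<bar> / r)) / 2"
    if "0 < r" for A :: "(nat \<times> nat) set" and u v and r :: real
  proof -
    have "(\<Sum>n\<in>A. \<bar>(u n + v n) / 2\<bar> / r) \<le> (\<Sum>n\<in>A. (\<bar>u n\<bar> / r + \<bar>v n\<bar> / r) / 2)"
    proof (rule sum_mono)
      fix n
      have "\<bar>(u n + v n) / 2\<bar> / r \<le> ((\<bar>u n\<bar> + \<bar>v n\<bar>) / 2) / r"
        using that by (intro divide_right_mono) auto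
      then show "\<bar>(u n + v n) / 2\<bar> / r \<le> (\<bar>u n\<bar> / r + \<bar>v n\<bar> / r) / 2" by (simp add: add_divide_distrib)
    qed
    then show ?thesis by (simp add: sum.distrib sum_divide_distrib[symmetric])
  qed
  have s1: "(\<Sum>n\<in>A. \<bar>(u n + v n) / 2\<bar>) \<le> ((\<Sum>n\<in>A. \<bar>u n\<bar>) + (\<Sum>n\<in>A. \<bar>v n\<bar>)) / 2"
    for A :: "(nat \<times> nat) set" and u v :: "nat \<times> nat \<Rightarrow> real"
    using s[of 1 u v A] by (simp only: div_by_1 zero_less_one simp_thms)
  have "step_norm N \<theta> ?m \<le>
      \<theta> * (((\<Sum>n\<in>{..2 ^ N} \<times> {..2 ^ N}. \<bar>jump12 c n\<bar>) + (\<Sum>n\<in>{..2 ^ N} \<times> {..2 ^ N}. \<bar>jump12 d n\<bar>)) / 2) +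
      (1 - \<theta>) * (((\<Sum>n\<in>{1..2 ^ N} \<times> {..2 ^ N}. \<bar>jump2 c n\<bar> / 2 ^ N) + (\<Sum>n\<in>{1..2 ^ N} \<times> {..2 ^ N}. \<bar>jump2 d n\<bar> / 2 ^ N)) / 2 +
        ((\<Sum>n\<in>{..2 ^ N} \<times> {1..2 ^ N}. \<bar>jump1 c n\<bar> / 2 ^ N) + (\<Sum>n\<in>{..2 ^ N} \<times> {1..2 ^ N}. \<bar>jump1 d n\<bar> / 2 ^ N)) / 2)"
    unfolding step_norm_def j
    by (intro add_mono mult_left_mono s s1) (use assms in simp_all)
  also have "\<dots> = (step_norm N \<theta> c + step_norm N \<theta> d) / 2"
    unfolding step_norm_def by (simp add: field_simps)
  finally show ?thesis .
qed

text \<open>The parallelogram identity makes the data term strictly midpoint convex, and the norm is midpoint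
  convex.\<close>

lemma pixel_objective_strictly_convex:
  assumes "0 \<le> \<theta>" "\<theta> \<le> 1" "0 < \<Lambda>" and c: "c \<in> pixel_cone N" "d \<in> pixel_cone N" "c \<noteq> d"
  shows "pixel_objective N y \<theta> \<Lambda> (\<lambda>n. (c n + d n) / 2) < (pixel_objective N y \<theta> \<Lambda> c + pixel_objective N y \<theta> \<Lambda> d) / 2"
proof -
  obtain n0 where "c n0 \<noteq> d n0" using c(3) by blast
  then have n0: "n0 \<in> pixel_indices N" "c n0 \<noteq> d n0" using pixel_coneD(2)[OF c(1), of n0] pixel_coneD(2)[OF c(2), of n0] by metis+
  \<comment> \<open>The identity \<open>((a + b)/2)^2 = (a^2 + b^2)/2 - ((a - b)/2)^2\<close>.\<close>
  have id: "(y n - (c n + d n) / 2 / 4 ^ N)\<^sup>2 =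
      ((y n - c n / 4 ^ N)\<^sup>2 + (y n - d n / 4 ^ N)\<^sup>2) / 2 - ((c n - d n) / (2 * 4 ^ N))\<^sup>2" for n
    by (simp add: power2_eq_square field_simps)
  have "(\<Sum>n\<in>pixel_indices N. (y n - (c n + d n) / 2 / 4 ^ N)\<^sup>2) <
      (\<Sum>n\<in>pixel_indices N. ((y n - c n / 4 ^ N)\<^sup>2 + (y n - d n / 4 ^ N)\<^sup>2) / 2)"
  proof (rule sum_strict_mono_ex1[OF finite_pixel_indices], unfold id)
    have le: "a - b\<^sup>2 \<le> a" for a b :: real by simp
    have lt: "b \<noteq> 0 \<Longrightarrow> a - b\<^sup>2 < a" for a b :: real by simp
    show "\<forall>n\<in>pixel_indices N. ((y n - c n / 4 ^ N)\<^sup>2 + (y n - d n / 4 ^ N)\<^sup>2) / 2 - ((c n - d n) / (2 * 4 ^ N))\<^sup>2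
        \<le> ((y n - c n / 4 ^ N)\<^sup>2 + (y n - d n / 4 ^ N)\<^sup>2) / 2"
      by (intro ballI le)
    show "\<exists>n\<in>pixel_indices N. ((y n - c n / 4 ^ N)\<^sup>2 + (y n - d n / 4 ^ N)\<^sup>2) / 2 - ((c n - d n) / (2 * 4 ^ N))\<^sup>2
        < ((y n - c n / 4 ^ N)\<^sup>2 + (y n - d n / 4 ^ N)\<^sup>2) / 2"
      by (rule bexI[OF lt n0(1)]) (use n0(2) in simp)
  qed
  also have "\<dots> = ((\<Sum>n\<in>pixel_indices N. (y n - c n / 4 ^ N)\<^sup>2) + (\<Sum>n\<in>pixel_indices N. (y n - d n / 4 ^ N)\<^sup>2)) / 2"
    by (simp add: sum.distrib sum_divide_distrib[symmetric])
  moreover have "\<Lambda> * step_norm N \<theta> (\<lambda>n. (c n + d n) / 2) \<le> \<Lambda> * ((step_norm N \<theta> c + step_norm N \<theta> d) / 2)"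
    using assms by (intro mult_left_mono step_norm_midpoint) auto
  ultimately show ?thesis unfolding pixel_objective_def by (simp add: field_simps)
qed

theorem proposition8:
  fixes N :: nat and y :: "nat \<times> nat \<Rightarrow> real" and \<theta> \<Lambda> :: real
  assumes "0 < \<theta>" and "\<theta> \<le> 1" and "0 < \<Lambda>"
  shows "\<exists>f. {g \<in> argmin (objective N y \<theta> \<Lambda>) M_DD0_pos. g \<in> M_DD0_pos_grid N} = {f}
           \<and> argmin (objective N y \<theta> \<Lambda>) (M_DD0_pos_grid N) = {f}"
proof -
  let ?J = "pixel_objective N y \<theta> \<Lambda>" and ?O = "objective N y \<theta> \<Lambda>"
  have \<theta>: "0 \<le> \<theta>" "\<theta> \<le> 1" using assms by auto
  obtain c where c: "c \<in> pixel_cone N" "\<And>d. d \<in> pixel_cone N \<Longrightarrow> ?J c \<le> ?J d"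
    using pixel_objective_minimum_exists[OF \<theta> assms(3)] by blast
  have uniq: "d = c" if d: "d \<in> pixel_cone N" "?J d \<le> ?J c" for d
  proof (rule ccontr)
    assume "d \<noteq> c"
    have "(\<lambda>n. (d n + c n) / 2) \<in> pixel_cone N"
      by (rule pixel_coneI) (simp_all add: pixel_coneD[OF d(1)] pixel_coneD[OF c(1)])
    then have "?J c \<le> ?J (\<lambda>n. (d n + c n) / 2)" by (rule c(2))
    also have "\<dots> < (?J d + ?J c) / 2"
      by (rule pixel_objective_strictly_convex[OF \<theta> assms(3) d(1) c(1) \<open>d \<noteq> c\<close>])
    finally show False using d(2) by simp
  qed
  have Jnn: "0 \<le> ?J d" for d
    unfolding pixel_objective_def using assms step_norm_nonneg[OF \<theta>] by (intro add_nonneg_nonneg sum_nonneg mult_nonneg_nonneg) auto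
  let ?f = "step_distr N c"
  have sub: "M_DD0_pos_grid N \<subseteq> M_DD0_pos" "M_DD0_pos \<subseteq> M_DD0"
    by (auto simp: M_DD0_pos_grid_def M_DD0_pos_def)
  have f: "?f \<in> M_DD0_pos_grid N" using c(1) grid_eq_step_distr_cone by blast
  have min: "?O ?f \<le> ?O g" if "g \<in> M_DD0_pos" for g
  proof -
    have "?O ?f \<le> ennreal (?J (pixel_mean N g))"
      unfolding objective_step_distr[OF \<theta> assms(3) c(1)] by (intro ennreal_leI c(2) pixel_mean_in_cone that)
    also have "\<dots> \<le> ?O g" using that sub(2) by (intro objective_ge_pixel_objective \<theta> assms(3)) auto
    finally show ?thesis .
  qed
  have only: "g = ?f" if g: "g \<in> M_DD0_pos_grid N" "?O g \<le> ?O ?f" for g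
  proof -
    obtain d where d: "g = step_distr N d" "d \<in> pixel_cone N" using g(1) grid_eq_step_distr_cone by blast
    have "ennreal (?J d) \<le> ennreal (?J c)"
      using g(2) unfolding d(1) objective_step_distr[OF \<theta> assms(3) c(1)] objective_step_distr[OF \<theta> assms(3) d(2)] .
    then have "?J d \<le> ?J c" using Jnn by simp
    then show ?thesis using uniq[OF d(2)] d(1) by simp
  qed
  have argmin: "g \<in> argmin ?O S \<longleftrightarrow> g \<in> S \<and> (\<forall>h\<in>S. ?O g \<le> ?O h)" for g S
    unfolding argmin_def is_arg_min_def mem_Collect_eq not_less[symmetric] by blast
  have fp: "?f \<in> M_DD0_pos" using f sub(1) by blast
  have 1: "{g \<in> argmin ?O M_DD0_pos. g \<in> M_DD0_pos_grid N} = {?f}"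
  proof (intro equalityI subsetI)
    fix g assume "g \<in> {g \<in> argmin ?O M_DD0_pos. g \<in> M_DD0_pos_grid N}"
    then have "g \<in> M_DD0_pos_grid N" "?O g \<le> ?O ?f" using argmin[of g M_DD0_pos] fp by simp_all
    then show "g \<in> {?f}" using only by simp
  next
    fix g assume "g \<in> {?f}"
    then show "g \<in> {g \<in> argmin ?O M_DD0_pos. g \<in> M_DD0_pos_grid N}"
      using argmin[of g M_DD0_pos] f fp min by simp
  qed
  have 2: "argmin ?O (M_DD0_pos_grid N) = {?f}"
  proof (intro equalityI subsetI)
    fix g assume "g \<in> argmin ?O (M_DD0_pos_grid N)"
    then have "g \<in> M_DD0_pos_grid N" "?O g \<le> ?O ?f" using argmin[of g "M_DD0_pos_grid N"] f by simp_all
    then show "g \<in> {?f}" using only by simp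
  next
    fix g assume g: "g \<in> {?f}"
    have "?O ?f \<le> ?O h" if "h \<in> M_DD0_pos_grid N" for h by (rule min[OF subsetD[OF sub(1) that]])
    then show "g \<in> argmin ?O (M_DD0_pos_grid N)"
      using argmin[of ?f "M_DD0_pos_grid N"] f g by simp
  qed
  show ?thesis by (rule exI[of _ ?f], rule conjI[OF 1 2])
qed

end
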